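(* Assume that $H(\mathrm d s)=h(s)\,\mathrm d s$ has a density $h$ with respect to Lebesgue measure on $\mathbb{R}_+$. Let $\bm y=(y_1,\dots,y_n)\in\mathbb{X}^n$ have $k$ distinct values $\bm y^*=(y^*_1,\dots,y^*_k)$ with counts $n_j=\#\{i:y_i=y^*_j\}$. Then the conditional distribution of $\tilde\mu$ given $\bm Y=\bm y$ and $U_n=u$ equals the distribution of $$\sum_{j=1}^k S^*_j\delta_{y^*_j}+\tilde\mu',$$ where: (i) $\bm S^*=(S^*_1,\dots,S^*_k)$ is a vector of independent random variables, $S^*_j$ having density $f_{S^*_j}(s)\propto e^{-us}s^{n_j}h(s)$, $j=1,\dots,k$; (ii) $\tilde\mu'$ is a random measure whose Laplace functional is, for every bounded non-negative measurable $f$ with bounded support, $$\mathsf E\Big[\exp\Big(-\int_{\mathbb{X}} f(z)\,\tilde\mu'(\mathrm d z)\Big)\Big]=\frac{\mathsf E\Big[\exp\Big\{-\int_{\mathbb{X}}(f(z)+u)\,\tilde\mu^!_{\bm y^*}(\mathrm d z)\Big\}\Big]}{\mathsf E\Big[\exp\Big\{-\int_{\mathbb{X}}u\,\tilde\mu^!_{\bm y^*}(\mathrm d z)\Big\}\Big]};$$ and $\bm S^*$ and $\tilde\mu'$ are independent. Moreover, the conditional distribution of $U_n$ given $\bm Y=\bm y$ has a Lebesgue density satisfying $$f_{U_n\mid\bm Y}(u)\propto u^{n-1}\,\mathsf E\Big[e^{-\int u\,\tilde\mu^!_{\bm y^*}(\mathrm d z)}\Big]\prod_{j=1}^k\kappa(u,n_j),\qquad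 u>0.$$
   Context: $(\mathbb{X},\mathcal{X})$ is a Polish space with its Borel $\sigma$-algebra. $\Phi=\sum_{j\ge1}\delta_{X_j}$ is a simple point process on $\mathbb{X}$ with almost surely finitely many points, and $H$ is a probability distribution on $\mathbb{R}_+$. $\Psi=\sum_j\delta_{(X_j,S_j)}$ is obtained by attaching to the points of $\Phi$ i.i.d. marks $S_j\sim H$ independent of $\Phi$; $\tilde\mu(B)=\sum_jS_j\delta_{X_j}(B)$, $T=\tilde\mu(\mathbb{X})$, $\tilde p=\tilde\mu/T$ (with $\tilde p\equiv0$ if $T=0$). Conditionally on $\tilde\mu$, $Y_1,Y_2,\dots$ are i.i.d. from $\tilde p$, and $\bm Y=(Y_1,\dots,Y_n)$. The auxiliary variable $U_n$ is defined by the joint law $\mathsf P(\bm Y\in\mathrm d\bm y,U_n\in\mathrm du,\tilde\mu\in\mathrm d\mu)=\frac{u^{n-1}}{\Gamma(n)}e^{-Tu}\mathrm du\prod_{i=1}^n\mu(\mathrm dy_i)\,\mathbf P_\Psi(\mathrm d\mu)$, where $\mathbf P_\Psi$ is the law of $\tilde\mu$ (i.e. given $\tilde\mu$ and $\bm Y$, $U_n\sim$ Gamma with shape $n$ and rate $T$). The $k$-th moment measure is $M_{\Phi^k}(A_1\times\cdots\times A_k)=\mathsf E[\prod_{i=1}^k\Phi(A_i)]$. The $k$-th Palm kernel $\{\mathbf P^{\bm x}_\Phi\}_{\bm x\in\mathbb{X}^k}$ is the ($M_{\Phi^k}$-a.e. unique) probability kernel with $\mathsf E[\int_B\mathbf 1_L(\Phi)\Phi^k(\mathrm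 d\bm x)]=\int_B\mathbf P^{\bm x}_\Phi(L)M_{\Phi^k}(\mathrm d\bm x)$ for measurable $B\subset\mathbb{X}^k$ and measurable sets $L$ of counting measures; a point process $\Phi_{\bm x}\sim\mathbf P^{\bm x}_\Phi$ has atoms at $x_1,\dots,x_k$, and the reduced Palm version is $\Phi^!_{\bm x}=\Phi_{\bm x}-\sum_{j=1}^k\delta_{x_j}$. $\tilde\mu^!_{\bm x}$ denotes the random measure $\sum_{X\in\Phi^!_{\bm x}}S_X\delta_X$ obtained by marking the points of $\Phi^!_{\bm x}$ with i.i.d. marks $S_X\sim H$. Also $\kappa(u,m)=\int_{\mathbb{R}_+}e^{-us}s^mH(\mathrm ds)$. *)

theory Defs
  imports "HOL-Probability.Probability"
begin

text \<open>Space of simple finite counting measures on X, represented by their (finite) support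
  sets, with the sigma-algebra generated by the counting maps F \<mapsto> card (F \<inter> A), A Borel.\<close>
definition fcnt :: "'x::topological_space set measure" where
  "fcnt = sigma {F. finite F}
     {{F. finite F \<and> card (F \<inter> A) = m} | A m. A \<in> sets (borel :: 'x measure)}"

definition rm :: "'x::topological_space measure measure" where
  "rm = sigma {M. sets M = sets (borel :: 'x measure)}
     {{M. sets M = sets (borel :: 'x measure) \<and> emeasure M A \<in> E} | A E.
        A \<in> sets (borel :: 'x measure) \<and> E \<in> sets (borel :: ennreal measure)}"

definition wmeasure :: "'x::topological_space set \<Rightarrow> ('x \<Rightarrow> real) \<Rightarrow> 'x measure" where
  "wmeasure F s = measure_of UNIV (sets borel) (\<lambda>A. \<Sum>x\<in>F \<inter> A. ennreal (s x))"

definition Hm :: "(real \<Rightarrow> real) \<Rightarrow> real measure" where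
  "Hm h = density lborel (\<lambda>s. ennreal (indicator {0..} s * h s))"

definition kappa :: "(real \<Rightarrow> real) \<Rightarrow> real \<Rightarrow> nat \<Rightarrow> ennreal" where
  "kappa h u m = (\<integral>\<^sup>+ s. ennreal (exp (- u * s) * s ^ m) \<partial>Hm h)"

definition negexp :: "ennreal \<Rightarrow> ennreal" where
  "negexp x = (if x = \<top> then 0 else ennreal (exp (- enn2real x)))"

definition Xpow :: "nat \<Rightarrow> (nat \<Rightarrow> 'x::topological_space) measure" where
  "Xpow k = PiM {..<k} (\<lambda>_. borel)"

definition moment :: "'x::topological_space set measure \<Rightarrow> nat \<Rightarrow> (nat \<Rightarrow> 'x) measure" where
  "moment P\<Phi> k = measure_of (space (Xpow k)) (sets (Xpow k))
     (\<lambda>B. \<integral>\<^sup>+ F. of_nat (card {x \<in> B. \<forall>i<k. x i \<in> F}) \<partial>P\<Phi>)"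

definition is_palm :: "'x::topological_space set measure \<Rightarrow> nat \<Rightarrow> ((nat \<Rightarrow> 'x) \<Rightarrow> 'x set measure) \<Rightarrow> bool" where
  "is_palm P\<Phi> k K \<longleftrightarrow>
     K \<in> measurable (Xpow k) (subprob_algebra fcnt) \<and>
     (\<forall>x \<in> space (Xpow k). prob_space (K x)) \<and>
     (\<forall>B \<in> sets (Xpow k). \<forall>L \<in> sets fcnt.
        (\<integral>\<^sup>+ F. indicator L F * of_nat (card {x \<in> B. \<forall>i<k. x i \<in> F}) \<partial>P\<Phi>)
        = (\<integral>\<^sup>+ x \<in> B. emeasure (K x) L \<partial>moment P\<Phi> k))"

definition psi_law :: "'x::topological_space set measure \<Rightarrow> (real \<Rightarrow> real) \<Rightarrow> 'x measure measure" where
  "psi_law P\<Phi> h = measure_of (space rm) (sets rm)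
     (\<lambda>L. \<integral>\<^sup>+ F. \<integral>\<^sup>+ s. indicator L (wmeasure F s) \<partial>PiM F (\<lambda>_. Hm h) \<partial>P\<Phi>)"

definition Tm :: "'x measure \<Rightarrow> real" where
  "Tm \<mu> = enn2real (emeasure \<mu> (space \<mu>))"

definition joint :: "'x::topological_space set measure \<Rightarrow> (real \<Rightarrow> real) \<Rightarrow> nat
    \<Rightarrow> ((nat \<Rightarrow> 'x) \<times> real \<times> 'x measure) measure" where
  "joint P\<Phi> h n = measure_of (space (Xpow n \<Otimes>\<^sub>M lborel \<Otimes>\<^sub>M rm)) (sets (Xpow n \<Otimes>\<^sub>M lborel \<Otimes>\<^sub>M rm))
     (\<lambda>E. \<integral>\<^sup>+ \<mu>. \<integral>\<^sup>+ u.
        ennreal (indicator {0<..} u * u ^ (n - 1) / Gamma (real n) * exp (- Tm \<mu> * u)) *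
        (\<integral>\<^sup>+ y. indicator E (y, u, \<mu>) \<partial>PiM {..<n} (\<lambda>_. \<mu>)) \<partial>lborel \<partial>psi_law P\<Phi> h)"

definition dvals :: "nat \<Rightarrow> (nat \<Rightarrow> 'x) \<Rightarrow> 'x list" where
  "dvals n y = remdups (map y [0..<n])"

definition cnt :: "nat \<Rightarrow> (nat \<Rightarrow> 'x) \<Rightarrow> nat \<Rightarrow> nat" where
  "cnt n y j = card {i. i < n \<and> y i = dvals n y ! j}"

definition dvec :: "nat \<Rightarrow> (nat \<Rightarrow> 'x) \<Rightarrow> nat \<Rightarrow> 'x" where
  "dvec n y = (\<lambda>j\<in>{..<length (dvals n y)}. dvals n y ! j)"

text \<open>E[exp(- \<integral> g d tilde-mu^!_{y*})], where tilde-mu^!_{y*} marks the reduced Palm process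
  \<Phi>^!_{y*} = \<Phi>_{y*} - \<Sum>_j \<delta>_{y*_j} (with \<Phi>_{y*} \<sim> P k y*, k = number of distinct values)
  with i.i.d. H-marks.\<close>
definition redlap :: "(real \<Rightarrow> real) \<Rightarrow> (nat \<Rightarrow> (nat \<Rightarrow> 'x) \<Rightarrow> 'x::topological_space set measure)
    \<Rightarrow> nat \<Rightarrow> (nat \<Rightarrow> 'x) \<Rightarrow> ('x \<Rightarrow> real) \<Rightarrow> ennreal" where
  "redlap h P n y g =
     (\<integral>\<^sup>+ F. \<integral>\<^sup>+ s. negexp (\<integral>\<^sup>+ z. ennreal (g z) \<partial>wmeasure (F - set (dvals n y)) s)
        \<partial>PiM (F - set (dvals n y)) (\<lambda>_. Hm h)
      \<partial>P (length (dvals n y)) (dvec n y))"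

definition laplace :: "'x measure measure \<Rightarrow> ('x \<Rightarrow> real) \<Rightarrow> ennreal" where
  "laplace Q f = (\<integral>\<^sup>+ M. negexp (\<integral>\<^sup>+ z. ennreal (f z) \<partial>M) \<partial>Q)"

definition admissible :: "('x::metric_space \<Rightarrow> real) \<Rightarrow> bool" where
  "admissible f \<longleftrightarrow> f \<in> borel_measurable borel \<and> (\<forall>z. 0 \<le> f z) \<and> bounded (range f)
     \<and> bounded {z. f z \<noteq> 0}"

definition Sdist :: "(real \<Rightarrow> real) \<Rightarrow> real \<Rightarrow> nat \<Rightarrow> real measure" where
  "Sdist h u m = density lborel
     (\<lambda>s. ennreal (indicator {0..} s * exp (- u * s) * s ^ m * h s) / kappa h u m)"

definition atoms_plus :: "'x::topological_space list \<Rightarrow> (nat \<Rightarrow> real) \<Rightarrow> 'x measure \<Rightarrow> 'x measure" where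
  "atoms_plus ys s M = measure_of UNIV (sets borel)
     (\<lambda>A. (\<Sum>j<length ys. if ys ! j \<in> A then ennreal (s j) else 0) + emeasure M A)"

definition post_law :: "(real \<Rightarrow> real) \<Rightarrow> nat \<Rightarrow> (nat \<Rightarrow> 'x::topological_space) \<Rightarrow> real
    \<Rightarrow> 'x measure measure \<Rightarrow> 'x measure measure" where
  "post_law h n y u Q = distr
     (PiM {..<length (dvals n y)} (\<lambda>j. Sdist h u (cnt n y j)) \<Otimes>\<^sub>M Q) rm
     (\<lambda>(s, M). atoms_plus (dvals n y) s M)"

definition good_Q :: "(real \<Rightarrow> real) \<Rightarrow> (nat \<Rightarrow> (nat \<Rightarrow> 'x) \<Rightarrow> 'x::polish_space set measure) \<Rightarrow> nat
    \<Rightarrow> ((nat \<Rightarrow> 'x) \<Rightarrow> real \<Rightarrow> 'x measure measure) \<Rightarrow> bool" where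
  "good_Q h P n Q \<longleftrightarrow> (\<forall>y \<in> space (Xpow n). \<forall>u > 0.
     prob_space (Q y u) \<and> sets (Q y u) = sets rm \<and>
     (\<forall>f. admissible f \<longrightarrow>
        laplace (Q y u) f = redlap h P n y (\<lambda>z. f z + u) / redlap h P n y (\<lambda>_. u)))"

definition gU :: "(real \<Rightarrow> real) \<Rightarrow> (nat \<Rightarrow> (nat \<Rightarrow> 'x) \<Rightarrow> 'x::topological_space set measure) \<Rightarrow> nat
    \<Rightarrow> (nat \<Rightarrow> 'x) \<Rightarrow> real \<Rightarrow> ennreal" where
  "gU h P n y u = ennreal (indicator {0<..} u * u ^ (n - 1)) * redlap h P n y (\<lambda>_. u)
     * (\<Prod>j<length (dvals n y). kappa h u (cnt n y j))"

end

theory Submission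
  imports Defs
begin

text \<open>
  Polish spaces embed measurably into the reals, so the points of a finite configuration can be
  enumerated measurably; this makes sums over tuples of points and expectations over the marks
  measurable in the configuration.

  Expanding the product measure of the joint law over the atoms of the configuration writes the law
  of \<open>(Y, U, \<mu>)\<close> as an expectation of a sum over \<open>n\<close>-tuples \<open>y\<close> of points. Conditioning on which
  entries of \<open>y\<close> coincide reduces such a sum to \<open>k\<close>-tuples of distinct points, so that
  \<open>y \<mapsto> P\<^bsup>y*\<^esup>\<close> is itself an \<open>n\<close>-th order Palm kernel, and the Campbell formula applies. For given
  \<open>y\<close> and \<open>u\<close> the weight \<open>e\<^bsup>-uT\<^esup> \<Prod> S\<^bsub>y i\<^esub>\<close> factorises over the atoms at the observed values and
  the remaining ones: the former produce the densities \<open>e\<^bsup>-us\<^esup> s\<^bsup>m\<^esup> h(s)\<close>, the latter the exponentially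
  tilted reduced Palm process.

  Any random measure with the prescribed Laplace functional has the law of the tilted process: the
  functional determines the joint moments of the variables \<open>exp (- M(A))\<close>, hence by the Weierstrass
  theorem, applied to one coordinate at a time, their joint law.
\<close>

section \<open>Measures given by functionals\<close>

text \<open>The laws in the statement are given by \<open>measure_of\<close>, which yields the zero
  measure whenever its set function is not countably additive. Each formula is therefore extended to
  an additive, homogeneous, monotonically continuous functional on functions: this gives countable
  additivity and the integral formula at once, and leaves measurability of the integrands as the
  real obligation. The obstacle there is that index sets vary: the marks live on a product indexed
  by the configuration itself, and the number of distinct values varies with the data. Both are
  removed by splitting over a countable quantity, the number of points or the coincidence pattern.

  All normalising constants must be positive and finite without moment assumptions. For u > 0 and
  multiplicities at least 1 the function e^(-us) s^m is bounded, so \<open>kappa\<close> is finite;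
  H has a density, hence no atom at 0, so \<open>kappa\<close> is positive; a reduced Palm
  configuration is finite, so its tilting constant is positive for every y. The event T = 0 carries
  no mass of the joint law, which is thus in general only a subprobability.\<close>

definition integral_functional :: "'a measure \<Rightarrow> (('a \<Rightarrow> ennreal) \<Rightarrow> ennreal) \<Rightarrow> bool" where
  "integral_functional S I \<longleftrightarrow>
    (\<forall>f\<in>borel_measurable S. \<forall>g\<in>borel_measurable S. I (\<lambda>x. f x + g x) = I f + I g) \<and>
    (\<forall>f\<in>borel_measurable S. \<forall>c. I (\<lambda>x. c * f x) = c * I f) \<and>
    (\<forall>F. (\<forall>i::nat. F i \<in> borel_measurable S) \<longrightarrow> incseq F \<longrightarrow>
      incseq (\<lambda>i. I (F i)) \<and> I (\<lambda>x. SUP i. F i x) = (SUP i. I (F i))) \<and>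
    (\<forall>f g. (\<forall>x\<in>space S. f x = g x) \<longrightarrow> I f = I g)"

text \<open>Countable additivity is continuity along the partial sums of indicators, and the
  integral formula follows by \<open>borel_measurable_induct\<close>. Dependence on the values on
  \<open>space S\<close> alone is what lets the induction replace a function by one that agrees with
  it there.\<close>

lemma integral_functional_measure_of:
  fixes I :: "('a \<Rightarrow> ennreal) \<Rightarrow> ennreal"
  assumes I: "integral_functional S I"
  defines "N \<equiv> measure_of (space S) (sets S) (\<lambda>E. I (indicator E))"
  shows "sets N = sets S"
    and "E \<in> sets S \<Longrightarrow> emeasure N E = I (indicator E)"
    and "f \<in> borel_measurable S \<Longrightarrow> integral\<^sup>N N f = I f"
proof -
  have lin: "\<And>f g. f \<in> borel_measurable S \<Longrightarrow> g \<in> borel_measurable S \<Longrightarrow> I (\<lambda>x. f x + g x) = I f + I g"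
    and cmult: "\<And>f c. f \<in> borel_measurable S \<Longrightarrow> I (\<lambda>x. c * f x) = c * I f"
    and sup: "\<And>F. (\<And>i::nat. F i \<in> borel_measurable S) \<Longrightarrow> incseq F \<Longrightarrow> I (\<lambda>x. SUP i. F i x) = (SUP i. I (F i))"
    and ext: "\<And>f g. (\<And>x. x \<in> space S \<Longrightarrow> f x = g x) \<Longrightarrow> I f = I g"
    using I by (auto simp: integral_functional_def)
  show sets: "sets N = sets S" unfolding N_def by simp
  have zero: "I (\<lambda>x. 0) = 0"
    using cmult[of "\<lambda>_. 0" 0] by simp
  have sum: "I (\<lambda>x. \<Sum>i\<in>J. F i x) = (\<Sum>i\<in>J. I (F i))"
    if "finite J" "\<And>i. F i \<in> borel_measurable S" for F :: "nat \<Rightarrow> 'a \<Rightarrow> ennreal" and J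
    using that(1)
  proof induction
    case (insert j J)
    have "(\<lambda>x. \<Sum>i\<in>J. F i x) \<in> borel_measurable S"
      using that(2) by (intro borel_measurable_sum) auto
    with insert show ?case by (simp add: lin that(2))
  qed (simp add: zero)
  have em: "emeasure N E = I (indicator E)" if "E \<in> sets S" for E
    unfolding N_def
  proof (rule emeasure_measure_of_sigma)
    show "sigma_algebra (space S) (sets S)" ..
    show "positive (sets S) (\<lambda>E. I (indicator E))"
      using ext[of "indicator {}" "\<lambda>_. 0"] by (simp add: positive_def zero)
    show "E \<in> sets S" by fact
    show "countably_additive (sets S) (\<lambda>E. I (indicator E))"
    proof (rule countably_additiveI)
      fix A :: "nat \<Rightarrow> 'a set" assume A: "range A \<subseteq> sets S" "disjoint_family A"
      have [measurable]: "A i \<in> sets S" for i using A by auto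
      have "indicator (\<Union>i. A i) = (\<lambda>x. SUP m. \<Sum>i<m. indicator (A i) x :: ennreal)"
        by (auto simp: fun_eq_iff suminf_indicator[OF A(2), symmetric] suminf_eq_SUP)
      then have "I (indicator (\<Union>i. A i)) = (SUP m. I (\<lambda>x. \<Sum>i<m. indicator (A i) x))"
        by (simp only:, subst sup)
          (auto simp: incseq_def le_fun_def intro!: sum_mono2)
      also have "\<dots> = (SUP m. \<Sum>i<m. I (indicator (A i)))"
        by (intro SUP_cong refl, subst sum) auto
      finally show "(\<Sum>i. I (indicator (A i))) = I (indicator (\<Union>i. A i))"
        by (simp add: suminf_eq_SUP)
    qed
  qed
  then show "E \<in> sets S \<Longrightarrow> emeasure N E = I (indicator E)" .
  assume "f \<in> borel_measurable S"
  then show "integral\<^sup>N N f = I f"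
  proof (induction rule: borel_measurable_induct)
    case (cong f g)
    have "space N = space S" using sets by (rule sets_eq_imp_space_eq)
    then have "integral\<^sup>N N f = integral\<^sup>N N g" using cong(3) by (intro nn_integral_cong) simp
    moreover have "I f = I g" using cong(3) by (rule ext)
    ultimately show ?case using cong by simp
  next
    case (set A) then show ?case by (simp add: em sets)
  next
    case (mult u c) then show ?case
      by (subst nn_integral_cmult) (auto simp: cmult measurable_cong_sets[OF sets refl])
  next
    case (add u v)
    then show ?case
      by (subst nn_integral_add) (auto simp: lin measurable_cong_sets[OF sets refl])
  next
    case (seq U)
    then have "integral\<^sup>N N (\<lambda>x. SUP i. U i x) = (SUP i. integral\<^sup>N N (U i))"
      by (intro nn_integral_monotone_convergence_SUP)
        (auto simp: measurable_cong_sets[OF sets refl])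
    moreover have "Sup (range U) = (\<lambda>x. SUP i. U i x)" by (auto simp: fun_eq_iff image_comp)
    ultimately show ?case using seq sup[of U] by simp
  qed
qed

lemma integral_functional_nn_integral_comp:
  assumes g [measurable]: "g \<in> measurable M S"
  shows "integral_functional S (\<lambda>f. \<integral>\<^sup>+x. f (g x) \<partial>M)"
  unfolding integral_functional_def
proof (intro conjI ballI allI impI)
  fix F :: "nat \<Rightarrow> 'b \<Rightarrow> ennreal" assume F: "\<forall>i. F i \<in> borel_measurable S" "incseq F"
  then have le: "i \<le> j \<Longrightarrow> F i x \<le> F j x" for i j x
    by (auto simp: incseq_def le_fun_def)
  then show "incseq (\<lambda>i. \<integral>\<^sup>+ x. F i (g x) \<partial>M)"
    by (auto simp: incseq_def intro!: nn_integral_mono)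
  show "(\<integral>\<^sup>+ x. (SUP i. F i (g x)) \<partial>M) = (SUP i. \<integral>\<^sup>+ x. F i (g x) \<partial>M)"
    using F(1) le by (intro nn_integral_monotone_convergence_SUP)
      (auto simp: incseq_def le_fun_def intro!: measurable_compose[OF g])
next
  fix f f' :: "'b \<Rightarrow> ennreal" assume "\<forall>x\<in>space S. f x = f' x"
  then show "(\<integral>\<^sup>+ x. f (g x) \<partial>M) = (\<integral>\<^sup>+ x. f' (g x) \<partial>M)"
    using measurable_space[OF g] by (intro nn_integral_cong) auto
qed (auto intro!: nn_integral_add nn_integral_cmult measurable_compose[OF g])

lemma integral_functional_cmult:
  assumes "integral_functional S I"
  shows "integral_functional S (\<lambda>f. c * I f)"
  using assms unfolding integral_functional_def
  by (auto simp: distrib_left mult.left_commute SUP_mult_left_ennreal incseq_def intro!: mult_left_mono arg_cong[where f = "(*) c"])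

text \<open>Mixtures over a parameter. Measurability in the parameter is assumed because the outer
  integral is additive only on measurable integrands; checking it is the main work in the
  applications.\<close>

lemma integral_functional_nn_integral:
  fixes I :: "'a \<Rightarrow> ('b \<Rightarrow> ennreal) \<Rightarrow> ennreal"
  assumes I: "\<And>w. w \<in> space N \<Longrightarrow> integral_functional S (I w)"
    and meas: "\<And>f. f \<in> borel_measurable S \<Longrightarrow> (\<lambda>w. I w f) \<in> borel_measurable N"
  shows "integral_functional S (\<lambda>f. \<integral>\<^sup>+w. I w f \<partial>N)"
  unfolding integral_functional_def
proof (intro conjI ballI allI impI)
  fix f g :: "'b \<Rightarrow> ennreal" assume fg: "f \<in> borel_measurable S" "g \<in> borel_measurable S"
  then have "(\<integral>\<^sup>+w. I w (\<lambda>x. f x + g x) \<partial>N) = (\<integral>\<^sup>+w. I w f + I w g \<partial>N)"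
    using I by (intro nn_integral_cong) (auto simp: integral_functional_def)
  also have "\<dots> = (\<integral>\<^sup>+w. I w f \<partial>N) + (\<integral>\<^sup>+w. I w g \<partial>N)"
    using fg by (intro nn_integral_add meas)
  finally show "(\<integral>\<^sup>+w. I w (\<lambda>x. f x + g x) \<partial>N) = (\<integral>\<^sup>+w. I w f \<partial>N) + (\<integral>\<^sup>+w. I w g \<partial>N)" .
next
  fix f :: "'b \<Rightarrow> ennreal" and c assume f: "f \<in> borel_measurable S"
  then have "(\<integral>\<^sup>+w. I w (\<lambda>x. c * f x) \<partial>N) = (\<integral>\<^sup>+w. c * I w f \<partial>N)"
    using I by (intro nn_integral_cong) (auto simp: integral_functional_def)
  then show "(\<integral>\<^sup>+w. I w (\<lambda>x. c * f x) \<partial>N) = c * (\<integral>\<^sup>+w. I w f \<partial>N)"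
    using f by (simp add: nn_integral_cmult meas)
next
  fix F :: "nat \<Rightarrow> 'b \<Rightarrow> ennreal" assume F: "\<forall>i. F i \<in> borel_measurable S" "incseq F"
  then have inc: "incseq (\<lambda>i. I w (F i))" and sup: "I w (\<lambda>x. SUP i. F i x) = (SUP i. I w (F i))"
    if "w \<in> space N" for w
    using I[OF that] by (auto simp: integral_functional_def)
  then show "incseq (\<lambda>i. \<integral>\<^sup>+w. I w (F i) \<partial>N)"
    by (auto simp: incseq_def intro!: nn_integral_mono)
  have "(\<integral>\<^sup>+w. I w (\<lambda>x. SUP i. F i x) \<partial>N) = (\<integral>\<^sup>+w. (SUP i. I w (F i)) \<partial>N)"
    using sup by (intro nn_integral_cong)
  \<comment> \<open>Monotonicity in \<open>i\<close> is known only for \<open>w\<close> in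
    \<open>space N\<close>, hence the almost-everywhere form of monotone convergence.\<close>
  also have "\<dots> = (SUP i. \<integral>\<^sup>+w. I w (F i) \<partial>N)"
    using F(1) inc by (intro nn_integral_monotone_convergence_SUP_AE meas)
      (auto simp: incseq_def intro!: AE_I2)
  finally show "(\<integral>\<^sup>+w. I w (\<lambda>x. SUP i. F i x) \<partial>N) = (SUP i. \<integral>\<^sup>+w. I w (F i) \<partial>N)" .
next
  fix f g :: "'b \<Rightarrow> ennreal" assume "\<forall>x\<in>space S. f x = g x"
  then show "(\<integral>\<^sup>+w. I w f \<partial>N) = (\<integral>\<^sup>+w. I w g \<partial>N)"
    using I by (intro nn_integral_cong) (simp add: integral_functional_def)
qed

text \<open>A finite sum is a mixture over \<open>count_space J\<close>, where every function of the
  parameter is measurable.\<close>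

lemma integral_functional_sum:
  assumes "finite J" "\<And>j. j \<in> J \<Longrightarrow> integral_functional S (I j)"
  shows "integral_functional S (\<lambda>f. \<Sum>j\<in>J. I j f)"
proof -
  have "integral_functional S (\<lambda>f. \<integral>\<^sup>+j. I j f \<partial>count_space J)"
    using assms by (intro integral_functional_nn_integral) auto
  then show ?thesis using assms(1) by (simp add: nn_integral_count_space_finite)
qed

lemma integral_functional_apply: "x \<in> space S \<Longrightarrow> integral_functional S (\<lambda>f. f x)"
  by (auto simp: integral_functional_def incseq_def le_fun_def)

lemma integral_functional_add:
  assumes I: "integral_functional S I" and J: "integral_functional S J"
  shows "integral_functional S (\<lambda>f. I f + J f)"
proof -
  have "integral_functional S (\<lambda>f. \<Sum>b\<in>{True, False}. (if b then I else J) f)"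
    using assms by (intro integral_functional_sum) auto
  then show ?thesis by simp
qed

section \<open>The measurable space of measures on X\<close>

lemma space_rm: "space (rm :: 'x::topological_space measure measure) = {M. sets M = sets borel}"
  unfolding rm_def by (intro space_measure_of) auto

lemma space_rmD: "M \<in> space (rm :: 'x::topological_space measure measure) \<Longrightarrow> space M = UNIV"
  by (auto simp: space_rm dest: sets_eq_imp_space_eq)

lemma measurable_rm_emeasure [measurable]:
  assumes "A \<in> sets (borel :: 'x::topological_space measure)"
  shows "(\<lambda>M. emeasure M A) \<in> borel_measurable (rm :: 'x measure measure)"
proof (rule measurableI)
  fix E :: "ennreal set" assume E: "E \<in> sets borel"
  have "(\<lambda>M. emeasure M A) -` E \<inter> space rm
      = {M. sets M = sets (borel :: 'x measure) \<and> emeasure M A \<in> E}"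
    by (auto simp: space_rm)
  also have "\<dots> \<in> sets rm"
    unfolding rm_def using assms E
    by (subst sets_measure_of) (auto intro!: sigma_sets.Basic)
  finally show "(\<lambda>M. emeasure M A) -` E \<inter> space (rm :: 'x measure measure) \<in> sets rm" .
qed simp

lemma measurable_rmI:
  fixes f :: "'a \<Rightarrow> 'x::topological_space measure"
  assumes "\<And>x. x \<in> space N \<Longrightarrow> sets (f x) = sets borel"
    and "\<And>A. A \<in> sets borel \<Longrightarrow> (\<lambda>x. emeasure (f x) A) \<in> borel_measurable N"
  shows "f \<in> measurable N rm"
  unfolding rm_def
proof (rule measurable_measure_of)
  show "f \<in> space N \<rightarrow> {M. sets M = sets borel}" using assms(1) by auto
  fix Y assume "Y \<in> {{M. sets M = sets (borel :: 'x measure) \<and> emeasure M A \<in> E} | A E.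
        A \<in> sets (borel :: 'x measure) \<and> E \<in> sets (borel :: ennreal measure)}"
  then obtain A E where Y: "Y = {M. sets M = sets borel \<and> emeasure M A \<in> E}"
    and "A \<in> sets borel" "E \<in> sets borel" by auto
  then have "(\<lambda>x. emeasure (f x) A) -` E \<inter> space N \<in> sets N"
    using assms(2) by measurable
  also have "(\<lambda>x. emeasure (f x) A) -` E \<inter> space N = f -` Y \<inter> space N"
    using assms(1) by (auto simp: Y)
  finally show "f -` Y \<inter> space N \<in> sets N" .
qed auto

lemma measurable_rm_nn_integral [measurable]:
  fixes f :: "'x::topological_space \<Rightarrow> ennreal"
  assumes "f \<in> borel_measurable borel"
  shows "(\<lambda>M. integral\<^sup>N M f) \<in> borel_measurable rm"
  using assms
proof (induction rule: borel_measurable_induct)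
  case (cong f g)
  have "integral\<^sup>N M f = integral\<^sup>N M g" if "M \<in> space rm" for M
    using that cong(3) by (intro nn_integral_cong) auto
  with cong show ?case by (metis (no_types, lifting) measurable_cong)
next
  case (set A)
  then have "(\<lambda>M. integral\<^sup>N M (indicator A)) \<in> borel_measurable rm \<longleftrightarrow>
      (\<lambda>M. emeasure M A) \<in> borel_measurable rm"
    by (intro measurable_cong) (simp add: space_rm)
  with set show ?case by simp
next
  case (mult u c)
  then have "(\<lambda>M. integral\<^sup>N M (\<lambda>x. c * u x)) \<in> borel_measurable rm \<longleftrightarrow>
      (\<lambda>M. c * integral\<^sup>N M u) \<in> borel_measurable rm"
    by (intro measurable_cong nn_integral_cmult) (auto simp: space_rm cong: measurable_cong_sets)
  with mult show ?case by simp
next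
  case (add u v)
  then have "(\<lambda>M. integral\<^sup>N M (\<lambda>x. v x + u x)) \<in> borel_measurable rm \<longleftrightarrow>
      (\<lambda>M. integral\<^sup>N M v + integral\<^sup>N M u) \<in> borel_measurable rm"
    by (intro measurable_cong nn_integral_add) (auto simp: space_rm cong: measurable_cong_sets)
  with add show ?case by simp
next
  case (seq U)
  have "Sup (range U) = (\<lambda>x. SUP i. U i x)" by (auto simp: fun_eq_iff image_comp)
  with seq have "(\<lambda>M. integral\<^sup>N M (Sup (range U))) \<in> borel_measurable rm \<longleftrightarrow>
      (\<lambda>M. SUP i. integral\<^sup>N M (U i)) \<in> borel_measurable rm"
    by (intro measurable_cong)
      (auto simp: space_rm intro!: nn_integral_monotone_convergence_SUP cong: measurable_cong_sets)
  moreover have "(\<lambda>M. SUP i. integral\<^sup>N M (U i)) \<in> borel_measurable rm"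
    using seq by measurable
  ultimately show ?case by blast
qed

text \<open>Atoms indexed by a finite family, with repetitions allowed, serve both
  \<open>atoms_plus\<close> and, with the null measure for \<open>M\<close>,
  \<open>wmeasure\<close>.\<close>

lemma measure_of_sum_atoms:
  fixes s :: "'i \<Rightarrow> ennreal" and x :: "'i \<Rightarrow> 'x::topological_space" and M :: "'x measure"
  assumes J: "finite J" and M: "sets M = sets borel"
  defines "N \<equiv> measure_of UNIV (sets borel) (\<lambda>A. (\<Sum>j\<in>J. if x j \<in> A then s j else 0) + emeasure M A)"
  shows "sets N = sets borel"
    and "A \<in> sets borel \<Longrightarrow> emeasure N A = (\<Sum>j\<in>J. if x j \<in> A then s j else 0) + emeasure M A"
proof -
  let ?I = "\<lambda>f. (\<Sum>j\<in>J. s j * f (x j)) + integral\<^sup>N M f"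
  have ind: "?I (indicator A) = (\<Sum>j\<in>J. if x j \<in> A then s j else 0) + emeasure M A"
    if "A \<in> sets borel" for A
    using that by (auto simp: M intro!: sum.cong)
  have N: "N = measure_of (space borel) (sets borel) (\<lambda>E. ?I (indicator E))"
    unfolding N_def space_borel
    by (rule measure_of_eq) (auto simp: ind sets.sigma_sets_eq[of borel, simplified])
  have "integral_functional borel ?I"
    using J by (intro integral_functional_add integral_functional_sum integral_functional_cmult
        integral_functional_apply integral_functional_nn_integral_comp measurable_ident_sets M) auto
  note * = integral_functional_measure_of[OF this, folded N]
  show "sets N = sets borel" by (rule *)
  show "A \<in> sets borel \<Longrightarrow> emeasure N A = (\<Sum>j\<in>J. if x j \<in> A then s j else 0) + emeasure M A"
    by (simp add: * ind)
qed

section \<open>Finite configurations\<close>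

lemma
  assumes "sets M = sets (borel :: 'x::topological_space measure)"
  shows sets_atoms_plus: "sets (atoms_plus ys s M) = sets (borel :: 'x measure)"
    and emeasure_atoms_plus: "A \<in> sets borel \<Longrightarrow> emeasure (atoms_plus ys s M) A =
      (\<Sum>j<length ys. if ys ! j \<in> A then ennreal (s j) else 0) + emeasure M A"
  unfolding atoms_plus_def
  by (rule measure_of_sum_atoms[OF finite_lessThan assms]; assumption)+

lemma
  assumes "finite (F :: 'x::topological_space set)"
  shows sets_wmeasure: "sets (wmeasure F s) = sets (borel :: 'x measure)"
    and emeasure_wmeasure: "A \<in> sets borel \<Longrightarrow> emeasure (wmeasure F s) A =
      (\<Sum>x\<in>F. if x \<in> A then ennreal (s x) else 0)"
proof -
  let ?N = "null_measure (borel :: 'x measure)"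
  have eq: "wmeasure F s = measure_of UNIV (sets borel)
      (\<lambda>A. (\<Sum>x\<in>F. if x \<in> A then ennreal (s x) else 0) + emeasure ?N A)"
    unfolding wmeasure_def
    by (rule measure_of_eq) (simp_all add: assms sum.inter_restrict)
  note * = measure_of_sum_atoms[OF assms, where M = ?N and x = "\<lambda>x. x" and s = "\<lambda>x. ennreal (s x)", folded eq]
  show "sets (wmeasure F s) = sets (borel :: 'x measure)" by (rule *) simp
  show "A \<in> sets borel \<Longrightarrow> emeasure (wmeasure F s) A =
      (\<Sum>x\<in>F. if x \<in> A then ennreal (s x) else 0)" by (subst *) simp_all
qed

lemma wmeasure_in_space_rm: "finite F \<Longrightarrow> wmeasure F s \<in> space rm"
  by (simp add: space_rm sets_wmeasure)

text \<open>The number \<open>k\<close> of atoms is fixed although their positions vary with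
  \<open>w\<close>, so that the marks stay in one product space. A varying number of atoms is
  reduced to this by a countable case distinction.\<close>

lemma measurable_atoms_plus:
  fixes x :: "nat \<Rightarrow> 'a \<Rightarrow> 'x::topological_space"
  assumes "\<And>j. j < k \<Longrightarrow> x j \<in> measurable N borel"
    and "\<And>j. j < k \<Longrightarrow> (\<lambda>w. s w j) \<in> borel_measurable N"
    and M: "M \<in> measurable N rm"
  shows "(\<lambda>w. atoms_plus (map (\<lambda>j. x j w) [0..<k]) (s w) (M w)) \<in> measurable N rm"
proof (rule measurable_rmI)
  have M': "sets (M w) = sets borel" if "w \<in> space N" for w
    using measurable_space[OF M that] by (simp add: space_rm)
  then show "sets (atoms_plus (map (\<lambda>j. x j w) [0..<k]) (s w) (M w)) = sets borel"
    if "w \<in> space N" for w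
    using that by (simp add: sets_atoms_plus)
  fix A :: "'x set" assume A: "A \<in> sets borel"
  have eq: "emeasure (atoms_plus (map (\<lambda>j. x j w) [0..<k]) (s w) (M w)) A =
      (\<Sum>j<k. if x j w \<in> A then ennreal (s w j) else 0) + emeasure (M w) A" if "w \<in> space N" for w
    using that A by (simp add: emeasure_atoms_plus M')
  have "(\<lambda>w. emeasure (M w) A) \<in> borel_measurable N"
    using M A by measurable
  moreover have "(\<lambda>w. \<Sum>j<k. if x j w \<in> A then ennreal (s w j) else 0) \<in> borel_measurable N"
  proof (intro borel_measurable_sum)
    fix j assume "j \<in> {..<k}"
    then have [measurable]: "x j \<in> measurable N borel" "(\<lambda>w. s w j) \<in> borel_measurable N"
      using assms by auto
    from A have [measurable]: "A \<in> sets borel" .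
    show "(\<lambda>w. if x j w \<in> A then ennreal (s w j) else 0) \<in> borel_measurable N"
      by measurable
  qed
  ultimately show "(\<lambda>w. emeasure (atoms_plus (map (\<lambda>j. x j w) [0..<k]) (s w) (M w)) A) \<in> borel_measurable N"
    by (subst measurable_cong[OF eq]) simp_all
qed

section \<open>A Borel injection into the reals\<close>

lemma ternary_expansion_less:
  fixes a b :: "nat \<Rightarrow> real"
  assumes a: "\<And>n. a n \<in> {0, 1}" and b: "\<And>n. b n \<in> {0, 1}"
    and N: "a N = 1" "b N = 0" "\<And>n. n < N \<Longrightarrow> a n = b n"
  shows "(\<Sum>n. b n * (1/3) ^ n) < (\<Sum>n. a n * (1/3) ^ n)"
proof -
  have sum: "summable (\<lambda>n. c n * (1/3) ^ n)" if "\<And>n. \<bar>c n\<bar> \<le> 1" for c :: "nat \<Rightarrow> real"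
  proof (rule summable_comparison_test')
    show "summable (\<lambda>n. (1/3::real) ^ n)" by (rule summable_geometric) simp
    show "norm (c n * (1/3) ^ n) \<le> (1/3) ^ n" for n
      using that[of n] by (simp add: abs_mult mult_left_le_one_le power_abs)
  qed
  define d where "d n = a n - b n" for n
  have d1: "\<bar>d n\<bar> \<le> 1" for n using a[of n] b[of n] by (auto simp: d_def)
  have sa: "summable (\<lambda>n. a n * (1/3) ^ n)" and sb: "summable (\<lambda>n. b n * (1/3) ^ n)"
    using a b by (auto intro!: sum) (smt (verit) insert_iff singletonD)+
  have "(\<Sum>n. a n * (1/3) ^ n) - (\<Sum>n. b n * (1/3) ^ n) = (\<Sum>n. d n * (1/3) ^ n)"
    using suminf_diff[OF sa sb] by (simp add: d_def left_diff_distrib)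
  also have "\<dots> = (\<Sum>n. d (n + Suc N) * (1/3) ^ (n + Suc N)) + (\<Sum>n<Suc N. d n * (1/3) ^ n)"
    by (rule suminf_split_initial_segment) (rule sum[OF d1])
  also have "(\<Sum>n<Suc N. d n * (1/3) ^ n) = (1/3) ^ N"
    using N by (simp add: d_def)
  also have "(\<Sum>n. d (n + Suc N) * (1/3) ^ (n + Suc N)) \<ge> (\<Sum>n. - ((1/3) ^ Suc N) * (1/3) ^ n)"
  proof (rule suminf_le)
    show "- ((1/3) ^ Suc N) * (1/3) ^ n \<le> d (n + Suc N) * (1/3) ^ (n + Suc N)" for n
      using mult_right_mono[of "-1" "d (n + Suc N)" "(1/3) ^ (n + Suc N)"] d1[of "n + Suc N"]
      by (simp add: power_add abs_le_iff mult.commute)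
    show "summable (\<lambda>n. - ((1/3) ^ Suc N) * (1/3::real) ^ n)"
      by (intro summable_mult summable_geometric) simp
    show "summable (\<lambda>n. d (n + Suc N) * (1/3) ^ (n + Suc N))"
      using sum[OF d1] by (rule summable_ignore_initial_segment)
  qed
  \<comment> \<open>Base 3 leaves room: the first differing digit contributes (1/3)^N, and all later
    digits together lose at most half of that. In base 2 the two could balance.\<close>
  moreover have "(\<Sum>n. - ((1/3) ^ Suc N) * (1/3::real) ^ n) = - ((1/3) ^ N / 2)"
    by (subst suminf_mult) (auto simp: suminf_geometric)
  ultimately show ?thesis
    using zero_less_power[of "1/3::real" N] by linarith
qed

text \<open>A point is encoded by the basic open sets that contain it, read as ternary digits 0 and
  1. Distinct points are separated by a basic set, and the first index at which their codes differ
  decides which sum is larger.\<close>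

lemma ex_borel_injection_real:
  "\<exists>\<phi> :: 'x::{second_countable_topology, t2_space} \<Rightarrow> real. inj \<phi> \<and> \<phi> \<in> borel_measurable borel"
proof -
  obtain B :: "'x set set" where B: "countable B" "topological_basis B"
    using ex_countable_basis by blast
  have ne: "B \<noteq> {}" using B(2) by (metis UNIV_I empty_iff open_UNIV topological_basisE)
  define U where "U = from_nat_into B"
  have U: "range U = B" unfolding U_def using B ne by (simp add: range_from_nat_into)
  define \<phi> :: "'x \<Rightarrow> real" where "\<phi> x = (\<Sum>n. indicator (U n) x * (1/3) ^ n)" for x
  have op: "open (U n)" for n using U B(2) by (metis rangeI topological_basis_open)
  have less: "\<phi> x \<noteq> \<phi> y" if N: "x \<in> U N" "y \<notin> U N" "\<And>n. n < N \<Longrightarrow> x \<in> U n \<longleftrightarrow> y \<in> U n" for x y N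
  proof -
    have "\<phi> y < \<phi> x"
      unfolding \<phi>_def
      by (rule ternary_expansion_less[where N = N]) (use N in \<open>auto simp: indicator_def\<close>)
    then show ?thesis by simp
  qed
  have "inj \<phi>"
  proof (rule injI, rule ccontr)
    fix x y assume eq: "\<phi> x = \<phi> y" and "x \<noteq> y"
    then obtain V where "open V" "x \<in> V" "y \<notin> V" using t1_space by blast
    then obtain b where "b \<in> B" "x \<in> b" "b \<subseteq> V" using B(2) topological_basisE by metis
    with \<open>y \<notin> V\<close> U have ex: "\<exists>n. (x \<in> U n) \<noteq> (y \<in> U n)" by blast
    define N where "N = (LEAST n. (x \<in> U n) \<noteq> (y \<in> U n))"
    have "(x \<in> U N) \<noteq> (y \<in> U N)" "\<And>n. n < N \<Longrightarrow> x \<in> U n \<longleftrightarrow> y \<in> U n"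
      unfolding N_def using LeastI_ex[OF ex] not_less_Least by blast+
    then have "\<phi> x \<noteq> \<phi> y" using less[of x N y] less[of y N x] by metis
    with eq show False by simp
  qed
  moreover have "\<phi> \<in> borel_measurable borel"
    unfolding \<phi>_def
    by (intro borel_measurable_suminf borel_measurable_times borel_measurable_indicator borel_open op)
      simp_all
  ultimately show ?thesis by blast
qed

section \<open>Measurable enumeration of a finite configuration\<close>

lemma space_fcnt: "space fcnt = {F. finite F}"
  unfolding fcnt_def by (intro space_measure_of) auto

lemma measurable_card_fcnt_Int [measurable]:
  assumes "A \<in> sets (borel :: 'x::topological_space measure)"
  shows "(\<lambda>F. card (F \<inter> A)) \<in> measurable (fcnt :: 'x set measure) (count_space UNIV)"
proof (subst measurable_count_space_eq2_countable, safe)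
  fix m
  have "(\<lambda>F. card (F \<inter> A)) -` {m} \<inter> space fcnt = {F. finite F \<and> card (F \<inter> A) = m}"
    by (auto simp: space_fcnt)
  also have "\<dots> \<in> sets fcnt"
    unfolding fcnt_def using assms by (subst sets_measure_of) (auto intro!: sigma_sets.Basic)
  finally show "(\<lambda>F. card (F \<inter> A)) -` {m} \<inter> space (fcnt :: 'x set measure) \<in> sets fcnt" .
qed auto

lemma measurable_card_fcnt [measurable]:
  "card \<in> measurable (fcnt :: 'x::topological_space set measure) (count_space UNIV)"
  using measurable_card_fcnt_Int[of UNIV] by simp

lemma measurable_fcntI:
  fixes G :: "'a \<Rightarrow> 'x::topological_space set"
  assumes "\<And>x. x \<in> space N \<Longrightarrow> finite (G x)"
    and "\<And>A. A \<in> sets borel \<Longrightarrow> (\<lambda>x. card (G x \<inter> A)) \<in> measurable N (count_space UNIV)"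
  shows "G \<in> measurable N fcnt"
  unfolding fcnt_def
proof (rule measurable_measure_of)
  show "G \<in> space N \<rightarrow> {F. finite F}" using assms(1) by auto
  fix Y assume "Y \<in> {{F. finite F \<and> card (F \<inter> A) = m} | A m. A \<in> sets (borel :: 'x measure)}"
  then obtain A m where Y: "Y = {F. finite F \<and> card (F \<inter> A) = m}" "A \<in> sets borel" by auto
  have "(\<lambda>x. card (G x \<inter> A)) -` {m} \<inter> space N \<in> sets N"
    using assms(2)[OF Y(2)] by (rule measurable_sets) simp
  also have "(\<lambda>x. card (G x \<inter> A)) -` {m} \<inter> space N = G -` Y \<inter> space N"
    using assms(1) by (auto simp: Y)
  finally show "G -` Y \<inter> space N \<in> sets N" .
qed auto

text \<open>Serves to order the points of a configuration; any Borel injection will do.\<close>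

definition embed_real :: "'x::polish_space \<Rightarrow> real" where
  "embed_real = (SOME \<phi>. inj \<phi> \<and> \<phi> \<in> borel_measurable borel)"

lemma inj_embed_real: "inj embed_real"
  and measurable_embed_real [measurable]: "embed_real \<in> borel_measurable borel"
  using someI_ex[OF ex_borel_injection_real] by (auto simp: embed_real_def)

definition rank_in :: "'x::polish_space set \<Rightarrow> 'x \<Rightarrow> nat" where
  "rank_in F z = card (F \<inter> {w. embed_real w < embed_real z})"

text \<open>The value for \<open>i\<close> beyond the number of points is a constant, so that
  \<open>pt i\<close> is measurable on all configurations.\<close>

definition pt :: "nat \<Rightarrow> 'x::polish_space set \<Rightarrow> 'x" where
  "pt i F = (if i < card F then the_inv_into F (rank_in F) i else undefined)"

lemma bij_betw_rank_in:
  assumes "finite F" shows "bij_betw (rank_in F) F {..<card F}"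
proof -
  have less: "rank_in F z < rank_in F w" if "z \<in> F" "embed_real z < embed_real w" for z w
    unfolding rank_in_def using that assms by (intro psubset_card_mono) auto
  have inj: "inj_on (rank_in F) F"
  proof (rule inj_onI)
    fix z w assume "z \<in> F" "w \<in> F" "rank_in F z = rank_in F w"
    with less[of z w] less[of w z] have "embed_real z = embed_real w" by force
    then show "z = w" by (rule injD[OF inj_embed_real])
  qed
  have "rank_in F z < card F" if "z \<in> F" for z
    unfolding rank_in_def using that assms by (intro psubset_card_mono) auto
  then have "rank_in F ` F \<subseteq> {..<card F}" by auto
  moreover have "card (rank_in F ` F) = card F" using inj by (rule card_image)
  ultimately have "rank_in F ` F = {..<card F}"
    by (intro card_subset_eq) auto
  with inj show ?thesis by (simp add: bij_betw_def)
qed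

lemma bij_betw_pt:
  assumes "finite F" shows "bij_betw (\<lambda>i. pt i F) {..<card F} F"
  using bij_betw_the_inv_into[OF bij_betw_rank_in[OF assms]]
  by (rule bij_betw_cong[THEN iffD1, rotated]) (simp add: pt_def)

lemma rank_in_pt: "finite F \<Longrightarrow> i < card F \<Longrightarrow> rank_in F (pt i F) = i"
  using bij_betw_rank_in[of F] by (simp add: pt_def f_the_inv_into_f_bij_betw)

text \<open>Rational levels isolate the point of rank \<open>i\<close>: with \<open>i\<close> points
  below \<open>q1\<close> and \<open>i + 1\<close> below \<open>q2\<close>, exactly one point lies
  in between, and the third count says that it is in \<open>A\<close>. This leaves countably many
  conditions on counting maps, which are measurable by construction of \<open>fcnt\<close>.\<close>

lemma pt_mem_iff:
  assumes F: "finite F" and i: "i < card F"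
  shows "pt i F \<in> A \<longleftrightarrow> (\<exists>q1 q2 :: rat. card (F \<inter> {w. embed_real w < of_rat q1}) = i \<and>
    card (F \<inter> {w. embed_real w < of_rat q2}) = Suc i \<and>
    card (F \<inter> (A \<inter> {w. of_rat q1 \<le> embed_real w \<and> embed_real w < of_rat q2})) = 1)" (is "_ \<longleftrightarrow> ?R")
proof
  let ?e = "embed_real :: 'a \<Rightarrow> real"
  let ?z = "pt i F"
  have zF: "?z \<in> F" using bij_betw_pt[OF F] i by (auto simp: bij_betw_def)
  have rz: "card (F \<inter> {w. ?e w < ?e ?z}) = i" using rank_in_pt[OF F i] by (simp add: rank_in_def)
  assume "?z \<in> A"
  \<comment> \<open>The inserted numbers keep both sets nonempty when the point is the first or the
    last one, so that \<open>Max\<close> and \<open>Min\<close> are meaningful.\<close>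
  let ?S = "insert (?e ?z - 1) (?e ` {w\<in>F. ?e w < ?e ?z})"
  let ?T = "insert (?e ?z + 1) (?e ` {w\<in>F. ?e ?z < ?e w})"
  have "Max ?S < ?e ?z" "Min ?T > ?e ?z" using F by auto
  then obtain q1 q2 where q: "Max ?S < of_rat q1" "of_rat q1 < ?e ?z" "?e ?z < of_rat q2" "of_rat q2 < Min ?T"
    using of_rat_dense[of "Max ?S" "?e ?z"] of_rat_dense[of "?e ?z" "Min ?T"] by blast
  have q1: "?e w < of_rat q1 \<longleftrightarrow> ?e w < ?e ?z" if "w \<in> F" for w
  proof
    assume "?e w < ?e ?z"
    then have "?e w \<le> Max ?S" using that F by (intro Max_ge) auto
    with q show "?e w < of_rat q1" by simp
  qed (use q in simp)
  have q2: "?e w < of_rat q2 \<longleftrightarrow> ?e w \<le> ?e ?z" if "w \<in> F" for w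
  proof
    show "?e w \<le> ?e ?z" if *: "?e w < of_rat q2"
    proof (rule ccontr)
      assume "\<not> ?e w \<le> ?e ?z"
      then have "?e w \<ge> Min ?T" using \<open>w \<in> F\<close> F by (intro Min_le) auto
      with q * show False by simp
    qed
  qed (use q in simp)
  have le: "?e w \<le> ?e ?z \<longleftrightarrow> ?e w < ?e ?z \<or> w = ?z" for w
    by (auto simp: le_less inj_eq[OF inj_embed_real])
  have s1: "F \<inter> {w. ?e w < of_rat q1} = F \<inter> {w. ?e w < ?e ?z}" using q1 by auto
  have "F \<inter> {w. ?e w < of_rat q2} = insert ?z (F \<inter> {w. ?e w < ?e ?z})" using q2 le zF by auto
  then have s2: "card (F \<inter> {w. ?e w < of_rat q2}) = Suc i" using F rz by simp
  have "F \<inter> (A \<inter> {w. of_rat q1 \<le> ?e w \<and> ?e w < of_rat q2}) = {?z}"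
    using q1 q2 le zF \<open>?z \<in> A\<close> q by (auto simp: not_less[symmetric])
  then show ?R
    using s1 s2 rz by (intro exI[of _ q1] exI[of _ q2]) auto
next
  let ?e = "embed_real :: 'a \<Rightarrow> real"
  assume ?R
  then obtain q1 q2 :: rat where q: "card (F \<inter> {w. ?e w < of_rat q1}) = i"
    "card (F \<inter> {w. ?e w < of_rat q2}) = Suc i"
    "card (F \<inter> (A \<inter> {w. of_rat q1 \<le> ?e w \<and> ?e w < of_rat q2})) = 1" by blast
  then obtain z where z: "F \<inter> (A \<inter> {w. of_rat q1 \<le> ?e w \<and> ?e w < of_rat q2}) = {z}"
    by (auto simp: card_1_singleton_iff)
  then have z': "z \<in> F" "z \<in> A" "of_rat q1 \<le> ?e z" "?e z < of_rat q2" by auto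
  have sub: "insert z (F \<inter> {w. ?e w < of_rat q1}) \<subseteq> F \<inter> {w. ?e w < of_rat q2}" 
    using z' by auto
  have "card (insert z (F \<inter> {w. ?e w < of_rat q1})) = Suc i" using F q(1) z' by auto
  with sub q(2) F have eq: "insert z (F \<inter> {w. ?e w < of_rat q1}) = F \<inter> {w. ?e w < of_rat q2}"
    by (intro card_subset_eq) auto
  have "F \<inter> {w. ?e w < ?e z} = F \<inter> {w. ?e w < of_rat q1}"
    using eq z' by (auto simp: set_eq_iff) 
  then have "rank_in F z = rank_in F (pt i F)" using q(1) F i by (simp add: rank_in_def[of F z] rank_in_pt)
  moreover have "pt i F \<in> F" using bij_betw_pt[OF F] i by (auto simp: bij_betw_def)
  ultimately have "z = pt i F"
    using bij_betw_rank_in[OF F] z'(1) by (auto simp: bij_betw_def inj_on_def)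
  with z' show "pt i F \<in> A" by simp
qed

lemma measurable_pt [measurable]: "pt i \<in> measurable fcnt (borel :: 'x::polish_space measure)"
proof (rule measurableI)
  fix A :: "'x set" assume A [measurable]: "A \<in> sets borel"
  have "pt i -` A \<inter> space fcnt = {F \<in> space fcnt. if i < card F then
      (\<exists>q1 q2 :: rat. card (F \<inter> {w. embed_real w < of_rat q1}) = i \<and>
    card (F \<inter> {w. embed_real w < of_rat q2}) = Suc i \<and>
    card (F \<inter> (A \<inter> {w. of_rat q1 \<le> embed_real w \<and> embed_real w < of_rat q2})) = 1)
    else undefined \<in> A}"
    using pt_mem_iff[of _ i A] by (auto simp: space_fcnt) (auto simp: pt_def)
  also have "\<dots> \<in> sets fcnt" by measurable
  finally show "pt i -` A \<inter> space fcnt \<in> sets fcnt" .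
qed simp

section \<open>Campbell measures and Palm kernels\<close>

lemma wmeasure_eq_atoms_plus:
  fixes F :: "'x::polish_space set"
  assumes "finite F"
  shows "wmeasure F s = atoms_plus (map (\<lambda>i. pt i F) [0..<card F]) (\<lambda>i\<in>{..<card F}. s (pt i F)) (null_measure borel)"
proof (rule measure_eqI)
  show "sets (wmeasure F s) = sets (atoms_plus (map (\<lambda>i. pt i F) [0..<card F])
      (\<lambda>i\<in>{..<card F}. s (pt i F)) (null_measure borel))"
    by (simp add: sets_wmeasure assms sets_atoms_plus)
  fix A assume "A \<in> sets (wmeasure F s)"
  then have "A \<in> sets borel" by (simp add: sets_wmeasure assms)
  then show "emeasure (wmeasure F s) A = emeasure (atoms_plus (map (\<lambda>i. pt i F) [0..<card F])
      (\<lambda>i\<in>{..<card F}. s (pt i F)) (null_measure borel)) A"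
    by (simp add: emeasure_wmeasure assms emeasure_atoms_plus
        sum.reindex_bij_betw[OF bij_betw_pt[OF assms], symmetric] cong: if_cong)
qed

lemma measurable_atoms_plus_const:
  fixes ys :: "'x::topological_space list"
  assumes "sets H = sets borel" "M \<in> space rm"
  shows "(\<lambda>t. atoms_plus ys t M) \<in> measurable (PiM {..<length ys} (\<lambda>_. H)) rm"
proof -
  have [measurable_cong]: "sets H = sets borel" by fact
  have "(\<lambda>t. atoms_plus (map (\<lambda>j. ys ! j) [0..<length ys]) t M) \<in> measurable (PiM {..<length ys} (\<lambda>_. H)) rm"
    by (rule measurable_atoms_plus) (use assms in auto)
  then show ?thesis by (simp add: map_nth)
qed

lemma measurable_wmeasure:
  fixes F :: "'x::topological_space set"
  assumes F: "finite F" and H: "sets H = sets borel"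
  shows "wmeasure F \<in> measurable (PiM F (\<lambda>_. H)) rm"
proof (rule measurable_rmI)
  have [measurable_cong]: "sets H = sets borel" by fact
  fix A :: "'x set" assume "A \<in> sets borel"
  then have "emeasure (wmeasure F s) A = (\<Sum>x\<in>F. if x \<in> A then ennreal (s x) else 0)" for s
    using F by (rule emeasure_wmeasure[rotated])
  moreover have "(\<lambda>s. \<Sum>x\<in>F. if x \<in> A then ennreal (s x) else 0) \<in> borel_measurable (PiM F (\<lambda>_. H))"
    by measurable
  ultimately show "(\<lambda>s. emeasure (wmeasure F s) A) \<in> borel_measurable (PiM F (\<lambda>_. H))" by simp
qed (use F sets_wmeasure in auto)

text \<open>The product over \<open>F\<close> lives on a space that changes with \<open>F\<close>.
  Relabelling the points by \<open>pt\<close> moves it to a product that depends on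
  \<open>card F\<close> only, and i.i.d. marks are invariant under relabelling.\<close>

lemma nn_integral_marks_eq:
  fixes F :: "'x::polish_space set"
  assumes F: "finite F" and H: "prob_space H" "sets H = sets borel"
    and \<phi>: "\<phi> \<in> borel_measurable rm"
  shows "(\<integral>\<^sup>+s. \<phi> (wmeasure F s) \<partial>PiM F (\<lambda>_. H)) =
    (\<integral>\<^sup>+t. \<phi> (atoms_plus (map (\<lambda>i. pt i F) [0..<card F]) t (null_measure borel))
      \<partial>PiM {..<card F} (\<lambda>_. H))"
proof -
  let ?m = "card F" and ?R = "\<lambda>\<omega>. \<lambda>i\<in>{..<card F}. \<omega> (pt i F)"
  let ?D = "distr (PiM F (\<lambda>_. H)) (PiM {..<?m} (\<lambda>_. H)) ?R"
  have b: "inj_on (\<lambda>i. pt i F) {..<?m}" "(\<lambda>i. pt i F) \<in> {..<?m} \<rightarrow> F"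
    using bij_betw_pt[OF F] by (auto simp: bij_betw_def)
  have "?D = PiM {..<?m} (\<lambda>_. H)"
    using distr_PiM_reindex[OF _ b, of "\<lambda>_. H"] H by simp
  moreover have "(\<lambda>t. \<phi> (atoms_plus (map (\<lambda>i. pt i F) [0..<card F]) t (null_measure borel)))
      \<in> borel_measurable (PiM {..<?m} (\<lambda>_. H))"
    using measurable_atoms_plus_const[OF H(2), of "null_measure borel" "map (\<lambda>i. pt i F) [0..<card F]"] \<phi>
    by (simp add: space_rm measurable_compose)
  moreover have "?R \<in> measurable (PiM F (\<lambda>_. H)) (PiM {..<?m} (\<lambda>_. H))"
    using b by (intro measurable_restrict measurable_component_singleton) auto
  ultimately show ?thesis
    using nn_integral_distr[of ?R "PiM F (\<lambda>_. H)" "PiM {..<?m} (\<lambda>_. H)"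
        "\<lambda>t. \<phi> (atoms_plus (map (\<lambda>i. pt i F) [0..<card F]) t (null_measure borel))"]
    by (simp add: wmeasure_eq_atoms_plus[OF F])
qed

text \<open>Once the marks are indexed by numbers, the domain of integration depends on
  \<open>x\<close> through the number of points only. Splitting over its countably many values
  leaves a fixed product measure and a jointly measurable integrand.\<close>

lemma measurable_nn_integral_marks:
  fixes G :: "'a \<Rightarrow> 'x::polish_space set"
  assumes H: "prob_space H" "sets H = sets borel"
    and \<phi> [measurable]: "(\<lambda>(x, M). \<phi> x M) \<in> borel_measurable (N \<Otimes>\<^sub>M rm)"
    and G [measurable]: "G \<in> measurable N fcnt"
  shows "(\<lambda>x. \<integral>\<^sup>+s. \<phi> x (wmeasure (G x) s) \<partial>PiM (G x) (\<lambda>_. H)) \<in> borel_measurable N"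
proof -
  have [measurable_cong]: "sets H = sets borel" by fact
  interpret H: prob_space H by fact
  let ?a = "\<lambda>m x t. atoms_plus (map (\<lambda>i. pt i (G x)) [0..<m]) t (null_measure borel)"
  let ?f = "\<lambda>m x. \<integral>\<^sup>+t. \<phi> x (?a m x t) \<partial>PiM {..<m} (\<lambda>_. H)"
  have fin: "finite (G x)" if "x \<in> space N" for x
    using measurable_space[OF G that] by (simp add: space_fcnt)
  have meas: "\<phi> x \<in> borel_measurable rm" if "x \<in> space N" for x
    using measurable_Pair2[OF \<phi> that] by simp
  have "(\<lambda>x. \<integral>\<^sup>+s. \<phi> x (wmeasure (G x) s) \<partial>PiM (G x) (\<lambda>_. H)) \<in> borel_measurable N \<longleftrightarrow>
      (\<lambda>x. ?f (card (G x)) x) \<in> borel_measurable N"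
    using fin meas by (intro measurable_cong nn_integral_marks_eq H) auto
  also have "(\<lambda>x. ?f (card (G x)) x) \<in> borel_measurable N"
  proof (rule measurable_compose_countable[where f = ?f])
    show "(\<lambda>x. card (G x)) \<in> measurable N (count_space UNIV)" by measurable
    fix m :: nat
    interpret PH: prob_space "PiM {..<m} (\<lambda>_. H)" by (intro prob_space_PiM H)
    have [measurable]: "(\<lambda>w. ?a m (fst w) (snd w)) \<in> measurable (N \<Otimes>\<^sub>M PiM {..<m} (\<lambda>_. H)) rm"
      by (rule measurable_atoms_plus) (auto simp: space_rm)
    have "(\<lambda>(x, t). \<phi> x (?a m x t)) \<in> borel_measurable (N \<Otimes>\<^sub>M PiM {..<m} (\<lambda>_. H))"
      using measurable_compose[OF _ \<phi>, of "\<lambda>w. (fst w, ?a m (fst w) (snd w))"] by (simp add: split_beta')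
    then show "?f m \<in> borel_measurable N"
      by (rule PH.borel_measurable_nn_integral)
  qed
  finally show ?thesis .
qed

section \<open>Sums over tuples of points\<close>

definition tuples :: "nat \<Rightarrow> 'x set \<Rightarrow> (nat \<Rightarrow> 'x) set" where
  "tuples k F = PiE {..<k} (\<lambda>_. F)"

lemma finite_tuples [simp]: "finite F \<Longrightarrow> finite (tuples k F)"
  unfolding tuples_def by (intro finite_PiE) auto

lemma space_Xpow: "space (Xpow k :: (nat \<Rightarrow> 'x::topological_space) measure) = tuples k UNIV"
  by (simp add: Xpow_def space_PiM tuples_def)

lemma tuples_subset_Xpow: "tuples k F \<subseteq> space (Xpow k)"
  by (auto simp: space_Xpow tuples_def)

lemma card_tuples: "finite F \<Longrightarrow> card (tuples k F) = card F ^ k"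
  by (simp add: tuples_def card_PiE)

lemma bij_betw_tuples:
  assumes "bij_betw f A B"
  shows "bij_betw (\<lambda>\<sigma>. \<lambda>i\<in>{..<k}. f (\<sigma> i)) (tuples k A) (tuples k B)"
proof (rule bij_betw_byWitness[where f' = "\<lambda>y. \<lambda>i\<in>{..<k}. the_inv_into A f (y i)"])
  have inj: "inj_on f A" and im: "f ` A = B" using assms by (auto simp: bij_betw_def)
  show "\<forall>\<sigma>\<in>tuples k A. (\<lambda>i\<in>{..<k}. the_inv_into A f ((\<lambda>i\<in>{..<k}. f (\<sigma> i)) i)) = \<sigma>"
    using inj by (auto simp: tuples_def fun_eq_iff PiE_iff extensional_def the_inv_into_f_f)
  show "\<forall>y\<in>tuples k B. (\<lambda>i\<in>{..<k}. f ((\<lambda>i\<in>{..<k}. the_inv_into A f (y i)) i)) = y"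
    using inj im by (auto simp: tuples_def fun_eq_iff PiE_iff extensional_def f_the_inv_into_f)
  show "(\<lambda>\<sigma>. \<lambda>i\<in>{..<k}. f (\<sigma> i)) ` tuples k A \<subseteq> tuples k B"
    using im by (auto simp: tuples_def)
  show "(\<lambda>y. \<lambda>i\<in>{..<k}. the_inv_into A f (y i)) ` tuples k B \<subseteq> tuples k A"
    using the_inv_into_into[OF inj _ subset_refl] im by (auto simp: tuples_def PiE_iff)
qed

text \<open>As for the marks: tuples of points become tuples of indices, and for a fixed number of
  points the sum has a fixed finite index set.\<close>

lemma measurable_sum_tuples:
  fixes G :: "'a \<Rightarrow> 'x::polish_space set" and g :: "'a \<Rightarrow> (nat \<Rightarrow> 'x) \<Rightarrow> ennreal"
  assumes g [measurable]: "(\<lambda>(x, y). g x y) \<in> borel_measurable (N \<Otimes>\<^sub>M Xpow k)"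
    and G [measurable]: "G \<in> measurable N fcnt"
  shows "(\<lambda>x. \<Sum>y\<in>tuples k (G x). g x y) \<in> borel_measurable N"
proof -
  have fin: "finite (G x)" if "x \<in> space N" for x
    using measurable_space[OF G that] by (simp add: space_fcnt)
  let ?f = "\<lambda>m x. \<Sum>\<sigma>\<in>tuples k {..<m}. g x (\<lambda>i\<in>{..<k}. pt (\<sigma> i) (G x))"
  have "(\<lambda>x. \<Sum>y\<in>tuples k (G x). g x y) \<in> borel_measurable N \<longleftrightarrow>
      (\<lambda>x. ?f (card (G x)) x) \<in> borel_measurable N"
    by (intro measurable_cong sum.reindex_bij_betw[symmetric] bij_betw_tuples bij_betw_pt fin)
  also have "(\<lambda>x. ?f (card (G x)) x) \<in> borel_measurable N"
  proof (rule measurable_compose_countable)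
    show "(\<lambda>x. card (G x)) \<in> measurable N (count_space UNIV)" by measurable
    fix m :: nat
    have [measurable]: "(\<lambda>x. \<lambda>i\<in>{..<k}. pt (\<sigma> i) (G x)) \<in> measurable N (Xpow k)" for \<sigma> :: "nat \<Rightarrow> nat"
      unfolding Xpow_def by measurable
    have "(\<lambda>x. g x (\<lambda>i\<in>{..<k}. pt (\<sigma> i) (G x))) \<in> borel_measurable N" for \<sigma> :: "nat \<Rightarrow> nat"
      using measurable_compose[OF _ g, of "\<lambda>x. (x, \<lambda>i\<in>{..<k}. pt (\<sigma> i) (G x))"] by simp
    then show "?f m \<in> borel_measurable N" by (intro borel_measurable_sum)
  qed
  finally show ?thesis .
qed

text \<open>Repeated entries count: \<open>moment\<close> and \<open>is_palm\<close> refer to the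
  full power of the counting measure, so the sum runs over all tuples and not just over the
  injective ones.\<close>

lemma card_tuples_eq_sum:
  assumes "finite F" "B \<subseteq> space (Xpow k)"
  shows "of_nat (card {x \<in> B. \<forall>i<k. x i \<in> F}) = (\<Sum>x\<in>tuples k F. indicator B x :: ennreal)"
proof -
  have "{x \<in> B. \<forall>i<k. x i \<in> F} = tuples k F \<inter> B"
    using assms(2) by (auto simp: tuples_def space_Xpow PiE_iff)
  then show ?thesis using assms(1) by (simp add: indicator_def of_bool_def sum.If_cases)
qed

section \<open>Campbell measures, moment measures and the Campbell formula\<close>

locale finite_point_process = prob_space P for P :: "'x::polish_space set measure" +
  assumes sets_P [measurable_cong]: "sets P = sets fcnt"
begin

lemma finite_config: "F \<in> space P \<Longrightarrow> finite F"
  using sets_P by (auto dest!: sets_eq_imp_space_eq simp: space_fcnt)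

lemma measurable_sum_tuples_P:
  fixes g :: "(nat \<Rightarrow> 'x) \<times> 'x set \<Rightarrow> ennreal"
  assumes [measurable]: "g \<in> borel_measurable (Xpow k \<Otimes>\<^sub>M fcnt)"
  shows "(\<lambda>F. \<Sum>x\<in>tuples k F. g (x, F)) \<in> borel_measurable P"
  by (rule measurable_sum_tuples[where g = "\<lambda>F x. g (x, F)"]) measurable

definition campbell :: "nat \<Rightarrow> ((nat \<Rightarrow> 'x) \<times> 'x set) measure" where
  "campbell k = measure_of (space (Xpow k \<Otimes>\<^sub>M fcnt)) (sets (Xpow k \<Otimes>\<^sub>M fcnt))
    (\<lambda>E. \<integral>\<^sup>+F. (\<Sum>x\<in>tuples k F. indicator E (x, F)) \<partial>P)"

lemma campbell_functional:
  "integral_functional (Xpow k \<Otimes>\<^sub>M fcnt) (\<lambda>g. \<integral>\<^sup>+F. (\<Sum>x\<in>tuples k F. g (x, F)) \<partial>P)"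
proof (intro integral_functional_nn_integral measurable_sum_tuples_P)
  fix F assume "F \<in> space P"
  then have "finite F" by (rule finite_config)
  then show "integral_functional (Xpow k \<Otimes>\<^sub>M fcnt) (\<lambda>g. \<Sum>x\<in>tuples k F. g (x, F))"
    using tuples_subset_Xpow
    by (intro integral_functional_sum integral_functional_apply) (auto simp: space_pair_measure space_fcnt)
qed

lemmas sets_campbell [measurable_cong] = integral_functional_measure_of(1)[OF campbell_functional, folded campbell_def]
  and emeasure_campbell = integral_functional_measure_of(2)[OF campbell_functional, folded campbell_def]
  and nn_integral_campbell = integral_functional_measure_of(3)[OF campbell_functional, folded campbell_def]

text \<open>Being a marginal of the Campbell measure makes the counting formula in
  \<open>moment\<close> countably additive, and turns integrals against it into sums over
  tuples.\<close>

lemma moment_eq_distr_campbell: "moment P k = distr (campbell k) (Xpow k) fst"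
  (is "_ = ?M")
proof -
  have em: "emeasure ?M B = (\<integral>\<^sup>+F. of_nat (card {x \<in> B. \<forall>i<k. x i \<in> F}) \<partial>P)"
    if B [measurable]: "B \<in> sets (Xpow k)" for B
  proof -
    have "emeasure ?M B = integral\<^sup>N ?M (indicator B)" by simp
    also have "\<dots> = (\<integral>\<^sup>+z. indicator B (fst z) \<partial>campbell k)"
      by (subst nn_integral_distr) auto
    also have "\<dots> = (\<integral>\<^sup>+F. (\<Sum>x\<in>tuples k F. indicator B x) \<partial>P)"
      by (subst nn_integral_campbell) auto
    also have "\<dots> = (\<integral>\<^sup>+F. of_nat (card {x \<in> B. \<forall>i<k. x i \<in> F}) \<partial>P)"
      using sets.sets_into_space[OF B] by (intro nn_integral_cong card_tuples_eq_sum[symmetric] finite_config)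
    finally show ?thesis .
  qed
  have "moment P k = measure_of (space (Xpow k)) (sets (Xpow k)) (emeasure ?M)"
    unfolding moment_def by (rule measure_of_eq) (auto simp: em sets.space_closed sets.sigma_sets_eq)
  also have "\<dots> = ?M" using measure_of_of_measure[of ?M] by simp
  finally show ?thesis .
qed

lemma sets_moment [measurable_cong]: "sets (moment P k) = sets (Xpow k)"
  by (simp add: moment_eq_distr_campbell)

lemma nn_integral_moment:
  assumes [measurable]: "f \<in> borel_measurable (Xpow k)"
  shows "integral\<^sup>N (moment P k) f = (\<integral>\<^sup>+F. (\<Sum>x\<in>tuples k F. f x) \<partial>P)"
  unfolding moment_eq_distr_campbell
  by (subst nn_integral_distr)
    (auto simp: nn_integral_campbell)

text \<open>The defining identity of the kernel equates two measures on rectangles, a generator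
  closed under intersection. With a countable cover by rectangles of finite measure, uniqueness of
  the extension gives the identity for every measurable \<open>g\<close>.\<close>

lemma nn_integral_palm:
  assumes K: "is_palm P k K" and g [measurable]: "g \<in> borel_measurable (Xpow k \<Otimes>\<^sub>M fcnt)"
  shows "(\<integral>\<^sup>+F. (\<Sum>x\<in>tuples k F. g (x, F)) \<partial>P) = (\<integral>\<^sup>+x. (\<integral>\<^sup>+F. g (x, F) \<partial>K x) \<partial>moment P k)"
proof -
  let ?S = "Xpow k \<Otimes>\<^sub>M fcnt :: ((nat \<Rightarrow> 'x) \<times> 'x set) measure"
  have K1 [measurable]: "K \<in> measurable (Xpow k) (subprob_algebra fcnt)"
    and K2: "\<And>B L. B \<in> sets (Xpow k) \<Longrightarrow> L \<in> sets fcnt \<Longrightarrow>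
      (\<integral>\<^sup>+ F. indicator L F * of_nat (card {x \<in> B. \<forall>i<k. x i \<in> F}) \<partial>P)
        = (\<integral>\<^sup>+ x \<in> B. emeasure (K x) L \<partial>moment P k)"
    using K by (auto simp: is_palm_def)
  have sK: "sets (K x) = sets fcnt" if "x \<in> space (Xpow k)" for x
    using sets_kernel[OF K1 that] .
  have spm: "space (moment P k) = space (Xpow k)" by (rule sets_eq_imp_space_eq[OF sets_moment])
  let ?I = "\<lambda>g. \<integral>\<^sup>+x. (\<integral>\<^sup>+F. g (x, F) \<partial>K x) \<partial>moment P k"
  let ?D = "measure_of (space ?S) (sets ?S) (\<lambda>E. ?I (indicator E))"
  have "integral_functional ?S ?I"
  proof (rule integral_functional_nn_integral)
    show "integral_functional ?S (\<lambda>g. \<integral>\<^sup>+F. g (x, F) \<partial>K x)" if "x \<in> space (moment P k)" for x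
      using that by (intro integral_functional_nn_integral_comp)
        (simp add: spm measurable_cong_sets[OF sK refl])
    show "(\<lambda>x. \<integral>\<^sup>+F. f (x, F) \<partial>K x) \<in> borel_measurable (moment P k)"
      if [measurable]: "f \<in> borel_measurable ?S" for f :: "(nat \<Rightarrow> 'x) \<times> 'x set \<Rightarrow> ennreal"
      using nn_integral_measurable_subprob_algebra2[OF _ K1, of "\<lambda>x F. f (x, F)"]
      by (simp add: measurable_cong_sets[OF sets_moment refl])
  qed
  note D = integral_functional_measure_of[OF this]
  \<comment> \<open>The moment measure is not assumed \<open>\<sigma>\<close>-finite, but the Campbell measure is: bound the number of points.\<close>
  define X where "X m = {F :: 'x set. finite F \<and> card F \<le> m}" for m
  have X: "X m \<in> sets fcnt" for m
  proof -
    have "{F \<in> space fcnt. card F \<le> m} \<in> sets fcnt" by measurable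
    then show ?thesis by (simp add: X_def space_fcnt)
  qed
  have "campbell k = ?D"
  proof (rule measure_eqI_generator_eq)
    let ?E = "{a \<times> b |a b. a \<in> sets (Xpow k) \<and> b \<in> sets (fcnt :: 'x set measure)}"
    show "Int_stable ?E" by (rule Int_stable_pair_measure_generator)
    show "?E \<subseteq> Pow (space ?S)" unfolding space_pair_measure by (rule pair_measure_closed)
    show "sets (campbell k) = sigma_sets (space ?S) ?E"
      by (subst sets_campbell) (simp add: sets_pair_measure space_pair_measure)
    show "sets ?D = sigma_sets (space ?S) ?E"
      by (subst D(1)) (simp add: sets_pair_measure space_pair_measure)
    show "emeasure (campbell k) Y = emeasure ?D Y" if "Y \<in> ?E" for Y
    proof -
      from that obtain a b where Y: "Y = a \<times> b" and a: "a \<in> sets (Xpow k)" and b: "b \<in> sets fcnt"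
        by auto
      then have Y': "Y \<in> sets ?S" by auto
      have "emeasure (campbell k) Y = (\<integral>\<^sup>+F. (\<Sum>x\<in>tuples k F. indicator Y (x, F)) \<partial>P)"
        by (rule emeasure_campbell[OF Y'])
      also have "\<dots> = (\<integral>\<^sup>+F. indicator b F * of_nat (card {x \<in> a. \<forall>i<k. x i \<in> F}) \<partial>P)"
        using sets.sets_into_space[OF a]
        by (intro nn_integral_cong, subst card_tuples_eq_sum)
          (auto simp: finite_config Y indicator_times sum_distrib_left mult.commute)
      also have "\<dots> = (\<integral>\<^sup>+x\<in>a. emeasure (K x) b \<partial>moment P k)" by (rule K2[OF a b])
      also have "\<dots> = ?I (indicator Y)"
        by (intro nn_integral_cong)
          (simp add: Y indicator_times spm sK b nn_integral_cmult_indicator mult.commute[of "emeasure _ _"])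
      also have "\<dots> = emeasure ?D Y" by (rule D(2)[OF Y', symmetric])
      finally show ?thesis .
    qed
    show "range (\<lambda>m. space (Xpow k) \<times> X m) \<subseteq> ?E" using X by auto
    show "(\<Union>m. space (Xpow k) \<times> X m) = space ?S"
      by (auto simp: X_def space_pair_measure space_fcnt)
    show "emeasure (campbell k) (space (Xpow k) \<times> X m) \<noteq> \<infinity>" for m
    proof -
      have "emeasure (campbell k) (space (Xpow k) \<times> X m) = (\<integral>\<^sup>+F. (\<Sum>x\<in>tuples k F. indicator (space (Xpow k) \<times> X m) (x, F)) \<partial>P)"
        using X[of m] by (intro emeasure_campbell) auto
      also have "\<dots> \<le> (\<integral>\<^sup>+F. of_nat (m ^ k) \<partial>P)"
      proof (rule nn_integral_mono)
        fix F assume "F \<in> space P"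
        then have F: "finite F" by (rule finite_config)
        show "(\<Sum>x\<in>tuples k F. indicator (space (Xpow k) \<times> X m) (x, F)) \<le> (of_nat (m ^ k) :: ennreal)"
        proof (cases "card F \<le> m")
          case True
          have "(\<Sum>x\<in>tuples k F. indicator (space (Xpow k) \<times> X m) (x, F)) \<le> (\<Sum>x\<in>tuples k F. 1 :: ennreal)"
            by (intro sum_mono) (auto simp: indicator_def)
          also have "\<dots> = of_nat (card F ^ k)" by (simp add: card_tuples F)
          also have "\<dots> \<le> of_nat (m ^ k)" using True by (intro of_nat_mono power_mono) auto
          finally show ?thesis .
        qed (simp add: X_def indicator_def)
      qed
      also have "\<dots> = of_nat (m ^ k)" by (simp add: emeasure_space_1)
      also have "\<dots> < \<infinity>" by (simp add: less_top[symmetric] del: of_nat_power)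
      finally show ?thesis by simp
    qed
  qed
  then have "integral\<^sup>N (campbell k) g = integral\<^sup>N ?D g" by simp
  also have "integral\<^sup>N ?D g = ?I g" by (rule D(3)[OF g])
  finally show ?thesis by (simp add: nn_integral_campbell)
qed

end

section \<open>Coincidence patterns of tuples\<close>

text \<open>Encodes the partition of the indices by equality of entries, each class being
  represented by its first index. The pattern takes finitely many values, which makes case
  distinctions over it measurable.\<close>

definition pat :: "nat \<Rightarrow> (nat \<Rightarrow> 'x) \<Rightarrow> nat list" where
  "pat n y = map (\<lambda>i. LEAST j. y j = y i) [0..<n]"

text \<open>The place of the class represented by \<open>a\<close> in the list of distinct values.
  \<open>remdups\<close> keeps the last occurrence of an element, so classes are listed by last
  occurrence although they are named by their first.\<close>

definition pos :: "nat list \<Rightarrow> nat \<Rightarrow> nat" where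
  "pos p a = (LEAST j. remdups p ! j = a)"

text \<open>A finite superset of the patterns that occur; the genuine ones are singled out below by
  the test \<open>pat n (spread n p x) = p\<close>.\<close>

definition patterns :: "nat \<Rightarrow> nat list set" where
  "patterns n = {p. set p \<subseteq> {..<n} \<and> length p = n}"

text \<open>On tuples with pattern \<open>p\<close>, the inverse of \<^const>\<open>dvec\<close>.\<close>
definition spread :: "nat \<Rightarrow> nat list \<Rightarrow> (nat \<Rightarrow> 'x) \<Rightarrow> nat \<Rightarrow> 'x" where
  "spread n p x = (\<lambda>i\<in>{..<n}. x (pos p (p ! i)))"

lemma finite_patterns [simp]: "finite (patterns n)"
  unfolding patterns_def by (rule finite_lists_length_eq) simp

lemma remdups_map_inj_on: "inj_on f (set xs) \<Longrightarrow> remdups (map f xs) = map f (remdups xs)"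
  by (induction xs) (auto simp: inj_on_def)

lemma length_pat [simp]: "length (pat n y) = n"
  by (simp add: pat_def)

lemma pat_nth_le: "i < n \<Longrightarrow> pat n y ! i \<le> i"
  by (auto simp: pat_def intro: Least_le)

lemma apply_pat_nth: "i < n \<Longrightarrow> y (pat n y ! i) = y i"
  by (simp add: pat_def) (rule LeastI, rule refl)

lemma pat_in_patterns: "pat n y \<in> patterns n"
proof -
  have "pat n y ! i < n" if "i < n" for i using pat_nth_le[OF that, of y] that by simp
  then show ?thesis by (auto simp: patterns_def in_set_conv_nth)
qed

lemma pat_nth_eq_iff:
  assumes "i < n" "j < n"
  shows "pat n y ! i = pat n y ! j \<longleftrightarrow> y i = y j"
proof
  assume "pat n y ! i = pat n y ! j"
  then have "y (pat n y ! i) = y (pat n y ! j)" by (rule arg_cong)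
  then show "y i = y j" by (simp only: apply_pat_nth assms)
next
  have nth: "pat n y ! l = (LEAST m. y m = y l)" if "l < n" for l
    using that by (simp add: pat_def)
  assume "y i = y j"
  then show "pat n y ! i = pat n y ! j" by (simp only: nth[OF assms(1)] nth[OF assms(2)])
qed

lemma inj_on_pat: "inj_on y (set (pat n y))"
proof (rule inj_onI)
  fix a b assume "a \<in> set (pat n y)" "b \<in> set (pat n y)" and ab: "y a = y b"
  then obtain i j where "i < n" "a = pat n y ! i" "j < n" "b = pat n y ! j"
    by (auto simp: in_set_conv_nth)
  with ab show "a = b" by (simp add: apply_pat_nth pat_nth_eq_iff)
qed

lemma pat_nth_idem:
  assumes "a \<in> set (pat n y)" shows "pat n y ! a = a"
proof -
  from assms obtain i where i: "i < n" "a = pat n y ! i" by (auto simp: in_set_conv_nth)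
  then have "a < n" using pat_nth_le[of i n y] by simp
  with i have "pat n y ! a = pat n y ! i" by (simp add: pat_nth_eq_iff apply_pat_nth)
  with i show ?thesis by simp
qed

text \<open>\<open>y\<close> is injective on the representatives of its classes, so removing
  duplicates commutes with applying \<open>y\<close>. Hence the number of distinct values and the
  indices that produce them are functions of the pattern.\<close>

lemma dvals_eq_pat: "dvals n y = map y (remdups (pat n y))"
proof -
  have "map y [0..<n] = map y (pat n y)"
    by (rule nth_equalityI) (simp_all add: apply_pat_nth)
  then show ?thesis by (simp add: dvals_def remdups_map_inj_on inj_on_pat)
qed

lemma distinct_dvals: "distinct (dvals n y)"
  and set_dvals: "set (dvals n y) = y ` {..<n}"
  by (auto simp: dvals_def)

lemma length_dvals: "length (dvals n y) = length (remdups (pat n y))"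
  by (simp add: dvals_eq_pat)

lemma dvec_eq_pat: "dvec n y = (\<lambda>j\<in>{..<length (remdups (pat n y))}. y (remdups (pat n y) ! j))"
  by (auto simp: dvec_def dvals_eq_pat fun_eq_iff)

lemma cnt_eq_pat:
  assumes "j < length (dvals n y)"
  shows "cnt n y j = card {i. i < n \<and> pat n y ! i = remdups (pat n y) ! j}"
proof -
  let ?r = "remdups (pat n y) ! j"
  have r: "?r \<in> set (pat n y)" using assms nth_mem[of j "remdups (pat n y)"] by (simp add: length_dvals)
  have "y i = dvals n y ! j \<longleftrightarrow> pat n y ! i = ?r" if "i < n" for i
  proof -
    have "y i = dvals n y ! j \<longleftrightarrow> y (pat n y ! i) = y ?r"
      using assms that by (simp add: dvals_eq_pat apply_pat_nth)
    also have "\<dots> \<longleftrightarrow> pat n y ! i = ?r"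
      using r that by (intro inj_on_eq_iff[OF inj_on_pat]) simp_all
    finally show ?thesis .
  qed
  then show ?thesis unfolding cnt_def by (intro arg_cong[where f = card]) auto
qed

lemma dvec_in_space: "dvec n y \<in> space (Xpow (length (dvals n y)))"
  by (auto simp: dvec_def space_Xpow tuples_def)

lemma dvec_in_tuples: "y \<in> tuples n F \<Longrightarrow> dvec n y \<in> tuples (length (dvals n y)) F"
  using nth_mem[of _ "dvals n y"] by (fastforce simp: dvec_def tuples_def set_dvals PiE_iff)

lemma remdups_index:
  assumes "i < length p"
  shows "pos p (p ! i) < length (remdups p)"
    and "remdups p ! (pos p (p ! i)) = p ! i"
proof -
  have "p ! i \<in> set (remdups p)" using assms by simp
  then obtain j where j: "j < length (remdups p)" "remdups p ! j = p ! i"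
    unfolding in_set_conv_nth by blast
  have "pos p (p ! i) \<le> j" unfolding pos_def by (rule Least_le) (rule j)
  with j show "pos p (p ! i) < length (remdups p)" by simp
  show "remdups p ! (pos p (p ! i)) = p ! i" unfolding pos_def using j(2) by (rule LeastI)
qed

lemma spread_in_tuples:
  assumes p: "p \<in> patterns n" and x: "x \<in> tuples (length (remdups p)) F"
  shows "spread n p x \<in> tuples n F"
proof -
  have "x (pos p (p ! i)) \<in> F" if "i < n" for i
    using x remdups_index(1)[of i p] p that by (auto simp: tuples_def patterns_def PiE_iff)
  then show ?thesis by (simp add: spread_def tuples_def)
qed

lemma spread_dvec:
  assumes "y \<in> tuples n F" shows "spread n (pat n y) (dvec n y) = y"
proof
  fix i show "spread n (pat n y) (dvec n y) i = y i"
  proof (cases "i < n")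
    case True
    with remdups_index[of i "pat n y"] show ?thesis
      by (simp add: spread_def dvec_eq_pat apply_pat_nth)
  next
    case False
    with assms show ?thesis by (simp add: spread_def tuples_def PiE_iff extensional_def)
  qed
qed

text \<open>The hypothesis on \<open>p\<close> says both that \<open>p\<close> is a genuine pattern
  and that the entries of \<open>x\<close> are distinct; otherwise some of them would merge in
  \<open>dvec\<close>.\<close>

lemma dvec_spread:
  assumes p: "pat n (spread n p x) = p" and x: "x \<in> tuples (length (remdups p)) F"
  shows "dvec n (spread n p x) = x"
proof
  fix j show "dvec n (spread n p x) j = x j"
  proof (cases "j < length (remdups p)")
    case True
    let ?r = "remdups p ! j"
    have r: "?r \<in> set p" using nth_mem[OF True] by simp
    have rn: "?r < n" using r pat_in_patterns[of n "spread n p x"] by (auto simp: p patterns_def)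
    have "p ! ?r = ?r" using pat_nth_idem[of ?r n "spread n p x"] r p by simp
    then have "spread n p x ?r = x (pos p ?r)"
      using rn by (simp add: spread_def)
    also have "pos p ?r = j"
      unfolding pos_def
    proof (rule Least_equality)
      fix j' assume eq: "remdups p ! j' = ?r"
      show "j \<le> j'"
      proof (rule ccontr)
        assume "\<not> j \<le> j'"
        with True eq have "j' = j"
          by (subst nth_eq_iff_index_eq[OF distinct_remdups, symmetric]) auto
        with \<open>\<not> j \<le> j'\<close> show False by simp
      qed
    qed simp
    finally show ?thesis using True by (simp add: dvec_eq_pat p)
  next
    case False
    then show ?thesis using x by (auto simp: dvec_eq_pat p tuples_def PiE_iff extensional_def)
  qed
qed

text \<open>For a fixed pattern, \<open>dvec\<close> and \<open>spread\<close> are mutually inverse.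
  The test is kept inside the summand so that the inner sum runs over all shorter tuples, the form
  to which the Palm identity of that order applies.\<close>

lemma sum_tuples_patterns:
  fixes g :: "(nat \<Rightarrow> 'x) \<Rightarrow> ennreal"
  assumes F: "finite F"
  shows "(\<Sum>y\<in>tuples n F. g y) = (\<Sum>p\<in>patterns n. \<Sum>x\<in>tuples (length (remdups p)) F.
    if pat n (spread n p x) = p then g (spread n p x) else 0)"
proof -
  have "(\<Sum>y\<in>tuples n F. g y) = (\<Sum>p\<in>patterns n. \<Sum>y\<in>{y \<in> tuples n F. pat n y = p}. g y)"
    by (rule sum.group[symmetric]) (auto simp: F pat_in_patterns)
  also have "\<dots> = (\<Sum>p\<in>patterns n. \<Sum>x\<in>{x \<in> tuples (length (remdups p)) F. pat n (spread n p x) = p}. g (spread n p x))"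
  proof (rule sum.cong[OF refl])
    fix p assume p: "p \<in> patterns n"
    show "(\<Sum>y\<in>{y \<in> tuples n F. pat n y = p}. g y) =
      (\<Sum>x\<in>{x \<in> tuples (length (remdups p)) F. pat n (spread n p x) = p}. g (spread n p x))"
    proof (rule sum.reindex_bij_witness[where i = "spread n p" and j = "dvec n"])
      fix y assume y: "y \<in> {y \<in> tuples n F. pat n y = p}"
      then have s: "spread n p (dvec n y) = y" using spread_dvec by auto
      then show "spread n p (dvec n y) = y" .
      show "dvec n y \<in> {x \<in> tuples (length (remdups p)) F. pat n (spread n p x) = p}"
        using y s dvec_in_tuples[of y n F] by (auto simp: length_dvals)
      show "g (spread n p (dvec n y)) = g y" by (simp add: s)
    next
      fix x assume x: "x \<in> {x \<in> tuples (length (remdups p)) F. pat n (spread n p x) = p}"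
      then show "dvec n (spread n p x) = x" by (auto intro: dvec_spread)
      show "spread n p x \<in> {y \<in> tuples n F. pat n y = p}"
        using x p by (auto intro: spread_in_tuples)
    qed
  qed
  also have "\<dots> = (\<Sum>p\<in>patterns n. \<Sum>x\<in>tuples (length (remdups p)) F.
    if pat n (spread n p x) = p then g (spread n p x) else 0)"
    by (intro sum.cong refl sum.mono_neutral_cong_left) (auto simp: F)
  finally show ?thesis .
qed

section \<open>Measurability in the data\<close>

lemma measurable_Xpow_component:
  assumes "g \<in> measurable N (Xpow n)" "i < n"
  shows "(\<lambda>w. g w i) \<in> measurable N borel"
  using measurable_compose[OF assms(1)[unfolded Xpow_def] measurable_component_singleton, of i] assms(2)
  by simp

text \<open>Unfolds the \<open>LEAST\<close> into finitely many equalities and inequalities between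
  coordinates, each of which is a measurable event.\<close>

lemma pat_eq_iff:
  "p \<in> patterns n \<Longrightarrow> pat n y = p \<longleftrightarrow> (\<forall>i\<in>{..<n}. y (p ! i) = y i \<and> (\<forall>j\<in>{..<p ! i}. y j \<noteq> y i))"
proof
  assume "pat n y = p"
  then show "\<forall>i\<in>{..<n}. y (p ! i) = y i \<and> (\<forall>j\<in>{..<p ! i}. y j \<noteq> y i)"
    by (auto simp: apply_pat_nth) (auto simp: pat_def dest: not_less_Least)
next
  assume "p \<in> patterns n" and *: "\<forall>i\<in>{..<n}. y (p ! i) = y i \<and> (\<forall>j\<in>{..<p ! i}. y j \<noteq> y i)"
  then show "pat n y = p"
    by (intro nth_equalityI) (auto simp: patterns_def pat_def intro!: Least_equality leI)
qed

lemma measurable_pat [measurable]: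
  "pat n \<in> measurable (Xpow n :: (nat \<Rightarrow> 'x::polish_space) measure) (count_space (patterns n))"
proof (subst measurable_count_space_eq2)
  show "finite (patterns n)" by simp
  show "pat n \<in> space (Xpow n :: (nat \<Rightarrow> 'x) measure) \<rightarrow> patterns n \<and>
    (\<forall>p\<in>patterns n. pat n -` {p} \<inter> space (Xpow n :: (nat \<Rightarrow> 'x) measure) \<in> sets (Xpow n))"
  proof (intro conjI ballI)
    fix p assume p: "p \<in> patterns n"
    have lt: "p ! i < n" if "i < n" for i
      using p that nth_mem[of i p] by (auto simp: patterns_def simp del: nth_mem)
    have eq: "{y \<in> space (Xpow n). y a = y b} \<in> sets (Xpow n :: (nat \<Rightarrow> 'x) measure)"
      if "a < n" "b < n" for a b
      using that
      by (intro measurable_equality_set measurable_Xpow_component[OF measurable_ident_sets[OF refl]])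
    have "pat n -` {p} \<inter> space (Xpow n :: (nat \<Rightarrow> 'x) measure) =
      {y \<in> space (Xpow n). \<forall>i\<in>{..<n}. y (p ! i) = y i \<and> (\<forall>j\<in>{..<p ! i}. y j \<noteq> y i)}"
      unfolding pat_eq_iff[OF p, symmetric] by auto
    also have "\<dots> \<in> sets (Xpow n)"
      by (intro sets.sets_Collect_finite_All sets.sets_Collect_conj sets.sets_Collect_neg eq)
        (auto dest: lt order.strict_trans)
    finally show "pat n -` {p} \<inter> space (Xpow n :: (nat \<Rightarrow> 'x) measure) \<in> sets (Xpow n)" .
  qed (auto simp: pat_in_patterns)
qed

text \<open>Reduces objects whose dimension varies with the data to a fixed pattern, hence to a
  fixed dimension.\<close>

lemma measurable_compose_pat:
  fixes g :: "'a \<Rightarrow> nat \<Rightarrow> 'x::polish_space"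
  assumes "\<And>p. p \<in> patterns n \<Longrightarrow> (\<lambda>w. f p w) \<in> measurable N M"
    and "g \<in> measurable N (Xpow n)"
  shows "(\<lambda>w. f (pat n (g w)) w) \<in> measurable N M"
  by (rule measurable_compose_countable'[OF assms(1)])
    (auto intro: measurable_compose[OF assms(2) measurable_pat] countable_finite)

lemma remdups_pattern_nth: "p \<in> patterns n \<Longrightarrow> j < length (remdups p) \<Longrightarrow> remdups p ! j < n"
  using nth_mem[of j "remdups p"] by (auto simp: patterns_def simp del: nth_mem)

lemma measurable_spread:
  assumes "p \<in> patterns n"
  shows "spread n p \<in> measurable (Xpow (length (remdups p))) (Xpow n :: (nat \<Rightarrow> 'x::topological_space) measure)"
  unfolding spread_def Xpow_def
  using assms remdups_index(1)[of _ p]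
  by (intro measurable_restrict measurable_component_singleton) (auto simp: patterns_def)

text \<open>The remaining points are counted through their indices in the enumeration
  \<open>pt\<close>: a point survives when it differs from every entry of the data, and equality of
  two measurable points is a measurable event.\<close>

lemma measurable_diff_dvals:
  fixes g :: "'a \<Rightarrow> nat \<Rightarrow> 'x::polish_space"
  assumes g [measurable]: "g \<in> measurable N (Xpow n)" and G [measurable]: "G \<in> measurable N fcnt"
  shows "(\<lambda>w. G w - set (dvals n (g w))) \<in> measurable N fcnt"
proof (rule measurable_fcntI)
  have fin: "finite (G x)" if "x \<in> space N" for x
    using measurable_space[OF G that] by (simp add: space_fcnt)
  then show "finite (G w - set (dvals n (g w)))" if "w \<in> space N" for w using that by simp
  fix A :: "'x set" assume A [measurable]: "A \<in> sets borel"
  let ?J = "\<lambda>m w. {i \<in> {..<m}. pt i (G w) \<in> A \<and> (\<forall>j\<in>{..<n}. g w j \<noteq> pt i (G w))}"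
  have eq: "card ((G w - set (dvals n (g w))) \<inter> A) =
      card (?J (card (G w)) w)"
    if "w \<in> space N" for w
  proof -
    have b: "bij_betw (\<lambda>i. pt i (G w)) {..<card (G w)} (G w)" using bij_betw_pt fin that by auto
    have "bij_betw (\<lambda>i. pt i (G w)) (?J (card (G w)) w)
        ((G w - set (dvals n (g w))) \<inter> A)"
    proof (rule bij_betw_subset[OF b], goal_cases)
      case 2
      have im: "(\<lambda>i. pt i (G w)) ` {..<card (G w)} = G w" using b by (simp add: bij_betw_def)
      have img: "f ` {i \<in> I. P (f i)} = {x \<in> f ` I. P x}" for f :: "nat \<Rightarrow> 'x" and I P by auto
      have "(\<lambda>i. pt i (G w)) ` {i \<in> {..<card (G w)}. P (pt i (G w))} = {x \<in> G w. P x}" for P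
        using img[of "\<lambda>i. pt i (G w)" "{..<card (G w)}" P] unfolding im .
      note this[of "\<lambda>x. x \<in> A \<and> (\<forall>j\<in>{..<n}. g w j \<noteq> x)"]
      also have "{x \<in> G w. x \<in> A \<and> (\<forall>j\<in>{..<n}. g w j \<noteq> x)} = (G w - set (dvals n (g w))) \<inter> A"
        by (auto simp: set_dvals)
      finally show ?case .
    qed auto
    then show ?thesis by (simp add: bij_betw_same_card)
  qed
  have "(\<lambda>w. card (?J (card (G w)) w))
      \<in> measurable N (count_space UNIV)"
  proof (rule measurable_compose_countable[where f = "\<lambda>m w. card (?J m w)"])
    show "(\<lambda>w. card (G w)) \<in> measurable N (count_space UNIV)" by measurable
    fix m :: nat
    have e: "{w \<in> space N. g w j \<noteq> pt i (G w)} \<in> sets N" if "j < n" for i j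
    proof -
      have "(\<lambda>w. g w j) \<in> measurable N borel" by (rule measurable_Xpow_component[OF g that])
      then show ?thesis by measurable
    qed
    have [measurable]: "Measurable.pred N (\<lambda>w. pt i (G w) \<in> A \<and> (\<forall>j\<in>{..<n}. g w j \<noteq> pt i (G w)))" for i
      unfolding pred_def
      by (intro sets.sets_Collect_conj sets.sets_Collect_finite_All e) auto
    show "(\<lambda>w. card (?J m w)) \<in> measurable N (count_space UNIV)"
      by measurable
  qed
  then show "(\<lambda>w. card ((G w - set (dvals n (g w))) \<inter> A)) \<in> measurable N (count_space UNIV)"
    by (subst measurable_cong[OF eq])
qed

lemma measurable_palm_dvec:
  fixes K :: "nat \<Rightarrow> (nat \<Rightarrow> 'x::polish_space) \<Rightarrow> 'y measure"
  assumes K: "\<And>k. K k \<in> measurable (Xpow k) M"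
  shows "(\<lambda>y. K (length (dvals n y)) (dvec n y)) \<in> measurable (Xpow n) M"
  unfolding length_dvals dvec_eq_pat
proof (rule measurable_compose_pat[where g = "\<lambda>y. y"
    and f = "\<lambda>p y. K (length (remdups p)) (\<lambda>j\<in>{..<length (remdups p)}. y (remdups p ! j))"])
  fix p assume p: "p \<in> patterns n"
  show "(\<lambda>y. K (length (remdups p)) (\<lambda>j\<in>{..<length (remdups p)}. y (remdups p ! j))) \<in> measurable (Xpow n) M"
  proof (rule measurable_compose[OF _ K])
    show "(\<lambda>y. \<lambda>j\<in>{..<length (remdups p)}. y (remdups p ! j)) \<in> measurable (Xpow n) (Xpow (length (remdups p)))"
      unfolding Xpow_def using remdups_pattern_nth[OF p]
      by (intro measurable_restrict measurable_component_singleton) auto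
  qed
qed simp

text \<open>For a fixed pattern the sum runs over tuples of the k distinct values, where the kernel
  of order k applies. It replaces \<open>f\<close> by its Palm average, a function of the tuple
  alone; regrouping these averages over the patterns gives a sum over n-tuples again, that is, an
  integral against the n-th moment measure.\<close>

lemma (in finite_point_process) nn_integral_palm_dvec:
  assumes K: "\<And>k. is_palm P k (K k)" and f [measurable]: "f \<in> borel_measurable (Xpow n \<Otimes>\<^sub>M fcnt)"
  shows "(\<integral>\<^sup>+F. (\<Sum>y\<in>tuples n F. f (y, F)) \<partial>P) =
    (\<integral>\<^sup>+y. (\<integral>\<^sup>+F. f (y, F) \<partial>K (length (dvals n y)) (dvec n y)) \<partial>moment P n)"
proof -
  have K1 [measurable]: "K k \<in> measurable (Xpow k) (subprob_algebra fcnt)" for k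
    using K by (auto simp: is_palm_def)
  let ?\<phi> = "\<lambda>y. \<integral>\<^sup>+F. f (y, F) \<partial>K (length (dvals n y)) (dvec n y)"
  have \<phi> [measurable]: "?\<phi> \<in> borel_measurable (Xpow n)"
    by (rule nn_integral_measurable_subprob_algebra2[OF _ measurable_palm_dvec[OF K1]]) simp
  let ?a = "\<lambda>p F. \<Sum>x\<in>tuples (length (remdups p)) F. if pat n (spread n p x) = p then f (spread n p x, F) else 0"
  let ?b = "\<lambda>p F. \<Sum>x\<in>tuples (length (remdups p)) F. if pat n (spread n p x) = p then ?\<phi> (spread n p x) else 0"
  have p_eq: "(\<integral>\<^sup>+F. ?a p F \<partial>P)
    = (\<integral>\<^sup>+F. ?b p F \<partial>P)"
    (is "?L = ?R")
    and p_meas: "?a p \<in> borel_measurable P"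
      "?b p \<in> borel_measurable P"
    if p: "p \<in> patterns n" for p
  proof -
    let ?k = "length (remdups p)"
    note s [measurable] = measurable_spread[OF p, where 'x = 'x]
    have m0: "Measurable.pred (Xpow ?k :: (nat \<Rightarrow> 'x) measure) (\<lambda>x. pat n (spread n p x) = p)"
      by (rule pred_eq_const1[OF measurable_compose[OF s measurable_pat]]) (simp add: p)
    have m1: "Measurable.pred ((Xpow ?k :: (nat \<Rightarrow> 'x) measure) \<Otimes>\<^sub>M (fcnt :: 'x set measure)) (\<lambda>z. pat n (spread n p (fst z)) = p)"
      by (rule measurable_compose[OF measurable_fst m0])
    have m2: "(\<lambda>z. if pat n (spread n p (fst z)) = p then f (spread n p (fst z), snd z) else 0) \<in> borel_measurable (Xpow ?k \<Otimes>\<^sub>M fcnt)"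
      using m1 by measurable
    have m3: "(\<lambda>x. if pat n (spread n p x) = p then ?\<phi> (spread n p x) else 0) \<in> borel_measurable (Xpow ?k)"
      using m0 by (intro measurable_If measurable_compose[OF s \<phi>]) auto
    show "?a p \<in> borel_measurable P"
      using measurable_sum_tuples_P[OF m2] by (simp cong: if_cong)
    show "?b p \<in> borel_measurable P"
      using measurable_sum_tuples_P[OF measurable_compose[OF measurable_fst m3]] by (simp cong: if_cong)
    have "?L = (\<integral>\<^sup>+x. (\<integral>\<^sup>+F. (if pat n (spread n p x) = p then f (spread n p x, F) else 0) \<partial>K ?k x) \<partial>moment P ?k)"
      using nn_integral_palm[OF K m2] by (simp cong: if_cong)
    also have "\<dots> = (\<integral>\<^sup>+x. (if pat n (spread n p x) = p then ?\<phi> (spread n p x) else 0) \<partial>moment P ?k)"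
    proof (rule nn_integral_cong)
      fix x assume "x \<in> space (moment P ?k)"
      then have x: "x \<in> tuples ?k UNIV"
        by (simp add: sets_eq_imp_space_eq[OF sets_moment] space_Xpow)
      show "(\<integral>\<^sup>+F. (if pat n (spread n p x) = p then f (spread n p x, F) else 0) \<partial>K ?k x)
          = (if pat n (spread n p x) = p then ?\<phi> (spread n p x) else 0)"
        using dvec_spread[OF _ x] by (auto simp: length_dvals)
    qed
    also have "\<dots> = ?R" by (rule nn_integral_moment[OF m3])
    finally show "?L = ?R" .
  qed
  have "(\<integral>\<^sup>+F. (\<Sum>y\<in>tuples n F. f (y, F)) \<partial>P) =
    (\<integral>\<^sup>+F. (\<Sum>p\<in>patterns n. ?a p F) \<partial>P)"
    by (intro nn_integral_cong sum_tuples_patterns finite_config)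
  also have "\<dots> = (\<Sum>p\<in>patterns n. \<integral>\<^sup>+F. ?a p F \<partial>P)"
    by (rule nn_integral_sum) (rule p_meas)
  also have "\<dots> = (\<Sum>p\<in>patterns n. \<integral>\<^sup>+F. ?b p F \<partial>P)"
    by (intro sum.cong refl p_eq)
  also have "\<dots> = (\<integral>\<^sup>+F. (\<Sum>p\<in>patterns n. ?b p F) \<partial>P)"
    by (rule nn_integral_sum[symmetric]) (rule p_meas)
  also have "\<dots> = (\<integral>\<^sup>+F. (\<Sum>y\<in>tuples n F. ?\<phi> y) \<partial>P)"
    by (intro nn_integral_cong sum_tuples_patterns[symmetric] finite_config)
  also have "\<dots> = (\<integral>\<^sup>+y. ?\<phi> y \<partial>moment P n)"
    by (rule nn_integral_moment[symmetric]) (rule \<phi>)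
  finally show ?thesis .
qed

section \<open>The joint law\<close>

text \<open>On boxes, multiplying out the product of the sums over \<open>F\<close> gives one term
  for each tuple of points; boxes determine the product measure.\<close>

lemma nn_integral_PiM_wmeasure:
  fixes F :: "'x::polish_space set"
  assumes F: "finite F" and g: "g \<in> borel_measurable (Xpow n)"
  shows "(\<integral>\<^sup>+y. g y \<partial>PiM {..<n} (\<lambda>_. wmeasure F s)) = (\<Sum>y\<in>tuples n F. (\<Prod>i<n. ennreal (s (y i))) * g y)"
proof -
  let ?I = "\<lambda>g. \<Sum>y\<in>tuples n F. (\<Prod>i<n. ennreal (s (y i))) * g y"
  let ?D = "measure_of (space (Xpow n)) (sets (Xpow n)) (\<lambda>E. ?I (indicator E))"
  have "integral_functional (Xpow n) ?I"
    using F tuples_subset_Xpow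
    by (intro integral_functional_sum integral_functional_cmult integral_functional_apply) auto
  note D = integral_functional_measure_of[OF this]
  have sw: "sets (wmeasure F s) = sets borel" by (rule sets_wmeasure[OF F])
  have "finite_measure (wmeasure F s)"
    by (rule finite_measureI)
      (simp add: sets_eq_imp_space_eq[OF sw] emeasure_wmeasure F)
  then interpret product_sigma_finite "\<lambda>_. wmeasure F s"
    by (simp add: product_sigma_finite_def finite_measure.axioms(1))
  have setsP: "sets (PiM {..<n} (\<lambda>_. wmeasure F s)) = sets (Xpow n)"
    unfolding Xpow_def by (rule sets_PiM_cong) (auto simp: sw)
  have "?D = PiM {..<n} (\<lambda>_. wmeasure F s)"
  proof (rule PiM_eqI)
    show "finite {..<n}" by simp
    show "sets ?D = sets (PiM {..<n} (\<lambda>_. wmeasure F s))" by (simp add: D(1) setsP)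
    fix A assume A: "\<And>i. i \<in> {..<n} \<Longrightarrow> A i \<in> sets (wmeasure F s)"
    have "PiE {..<n} A \<in> sets (PiM {..<n} (\<lambda>_. wmeasure F s))"
      using A by (intro sets_PiM_I_finite) auto
    then have "emeasure ?D (PiE {..<n} A) = ?I (indicator (PiE {..<n} A))"
      by (intro D(2)) (simp add: setsP)
    also have "\<dots> = (\<Sum>y\<in>tuples n F. \<Prod>i<n. if y i \<in> A i then ennreal (s (y i)) else 0)"
    proof (rule sum.cong[OF refl])
      fix y assume y: "y \<in> tuples n F"
      show "(\<Prod>i<n. ennreal (s (y i))) * indicator (PiE {..<n} A) y
          = (\<Prod>i<n. if y i \<in> A i then ennreal (s (y i)) else 0)"
      proof (cases "y \<in> PiE {..<n} A")
        case True
        then show ?thesis by (auto simp: PiE_iff intro!: prod.cong)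
      next
        case False
        with y obtain i where "i < n" "y i \<notin> A i" by (auto simp: PiE_iff tuples_def)
        with False show ?thesis by (auto intro!: prod_zero[symmetric])
      qed
    qed
    also have "\<dots> = (\<Prod>i<n. \<Sum>x\<in>F. if x \<in> A i then ennreal (s x) else 0)"
      unfolding tuples_def using F by (subst prod_sum_PiE) auto
    also have "\<dots> = (\<Prod>i<n. emeasure (wmeasure F s) (A i))"
      using A by (intro prod.cong refl emeasure_wmeasure[symmetric] F) (auto simp: sw)
    finally show "emeasure ?D (PiE {..<n} A) = (\<Prod>i<n. emeasure (wmeasure F s) (A i))" .
  qed
  with D(3)[OF g] show ?thesis by simp
qed

lemma measurable_nn_integral_PiM_finite:
  fixes \<kappa> :: "'a \<Rightarrow> 'x::polish_space measure"
  assumes \<kappa>: "\<kappa> \<in> measurable N rm" and fin: "\<And>w. w \<in> space N \<Longrightarrow> emeasure (\<kappa> w) UNIV < \<infinity>"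
    and f: "(\<lambda>(w, y). f w y) \<in> borel_measurable (N \<Otimes>\<^sub>M Xpow n)"
  shows "(\<lambda>w. \<integral>\<^sup>+y. f w y \<partial>PiM {..<n} (\<lambda>_. \<kappa> w)) \<in> borel_measurable N"
proof -
  \<comment> \<open>Dividing by \<open>c w\<close> makes the product measures a subprobability
    kernel, along which integration preserves measurability. The summand 1 keeps \<open>c w\<close>
    nonzero for a null measure, so that the division can be undone.\<close>
  define c where "c w = (1 + emeasure (\<kappa> w) UNIV) ^ n" for w
  have cm [measurable]: "c \<in> borel_measurable N"
    unfolding c_def using measurable_compose[OF \<kappa> measurable_rm_emeasure[of UNIV]] by simp
  have s\<kappa>: "sets (\<kappa> w) = sets borel" if "w \<in> space N" for w
    using measurable_space[OF \<kappa> that] by (simp add: space_rm)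
  have c0: "c w \<noteq> 0" "c w < \<infinity>" if "w \<in> space N" for w
    using fin[OF that] by (auto simp: c_def power_less_top_ennreal)
  let ?P = "\<lambda>w. PiM {..<n} (\<lambda>_. \<kappa> w)"
  let ?K = "\<lambda>w. density (?P w) (\<lambda>_. inverse (c w))"
  have setsP: "sets (?P w) = sets (Xpow n)" if "w \<in> space N" for w
    unfolding Xpow_def by (rule sets_PiM_cong) (auto simp: s\<kappa> that)
  have emP: "emeasure (?P w) (PiE {..<n} A) = (\<Prod>i<n. emeasure (\<kappa> w) (A i))"
    if "w \<in> space N" "\<And>i. i < n \<Longrightarrow> A i \<in> sets borel" for w A
  proof -
    have "finite_measure (\<kappa> w)"
      using fin[OF that(1)] by (intro finite_measureI) (simp add: sets_eq_imp_space_eq[OF s\<kappa>[OF that(1)]])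
    then interpret product_sigma_finite "\<lambda>_. \<kappa> w"
      by (simp add: product_sigma_finite_def finite_measure.axioms(1))
    show ?thesis using that s\<kappa> by (intro emeasure_PiM) auto
  qed
  have emK: "emeasure (?K w) A = inverse (c w) * emeasure (?P w) A" if "w \<in> space N" "A \<in> sets (Xpow n)" for w A
    using that by (intro emeasure_density_const) (simp add: setsP)
  have K: "?K \<in> measurable N (subprob_algebra (Xpow n))"
  proof (rule measurable_subprob_algebra_generated)
    let ?G = "prod_algebra {..<n} (\<lambda>_. borel :: 'x measure)"
    let ?\<Omega> = "PiE {..<n} (\<lambda>_. space (borel :: 'x measure))"
    show "sets (Xpow n :: (nat \<Rightarrow> 'x) measure) = sigma_sets ?\<Omega> ?G" unfolding Xpow_def by (rule sets_PiM)
    show "Int_stable ?G" by (rule Int_stable_prod_algebra)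
    show "?G \<subseteq> Pow ?\<Omega>" using prod_algebra_sets_into_space[of "{..<n}" "\<lambda>_. borel :: 'x measure"] .
    show "sets (?K w) = sets (Xpow n)" if "w \<in> space N" for w using that by (simp add: setsP)
    have *: "(\<lambda>w. emeasure (?K w) (PiE {..<n} A)) \<in> borel_measurable N"
      if A: "\<And>i. i < n \<Longrightarrow> A i \<in> sets borel" for A
    proof -
      have "PiE {..<n} A \<in> sets (Xpow n)" unfolding Xpow_def using A by (intro sets_PiM_I_finite) auto
      then have "emeasure (?K w) (PiE {..<n} A) = inverse (c w) * (\<Prod>i<n. emeasure (\<kappa> w) (A i))" if "w \<in> space N" for w
        using that A by (simp add: emK emP)
      moreover have "(\<lambda>w. inverse (c w) * (\<Prod>i<n. emeasure (\<kappa> w) (A i))) \<in> borel_measurable N"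
        using A by (intro borel_measurable_times_ennreal borel_measurable_prod_ennreal
            measurable_compose[OF \<kappa> measurable_rm_emeasure]) auto
      ultimately show ?thesis by (subst measurable_cong) auto
    qed
    show "(\<lambda>w. emeasure (?K w) A) \<in> borel_measurable N" if "A \<in> ?G" for A
    proof -
      from that obtain X where "A = PiE {..<n} X" "X \<in> (\<Pi> j\<in>{..<n}. sets borel)"
        by (auto simp: prod_algebra_eq_finite)
      then show ?thesis using * by auto
    qed
    show "(\<lambda>w. emeasure (?K w) ?\<Omega>) \<in> borel_measurable N" by (rule *) auto
    show "subprob_space (?K w)" if w: "w \<in> space N" for w
    proof (rule subprob_spaceI)
      have sp: "space (?K w) = ?\<Omega>" using sets_eq_imp_space_eq[OF s\<kappa>[OF w]] by (simp add: space_PiM)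
      have "?\<Omega> \<in> sets (Xpow n :: (nat \<Rightarrow> 'x) measure)" unfolding Xpow_def by (intro sets_PiM_I_finite) auto
      then have "emeasure (?K w) ?\<Omega> = inverse (c w) * emeasure (\<kappa> w) UNIV ^ n"
        using w by (simp add: emK emP)
      also have "\<dots> \<le> inverse (c w) * c w"
        unfolding c_def by (intro mult_left_mono power_mono) (auto simp: add_increasing)
      also have "\<dots> = 1" using c0[OF w] by (subst mult.commute) (simp add: divide_ennreal_def[symmetric])
      finally show "emeasure (?K w) (space (?K w)) \<le> 1" by (simp only: sp)
      show "space (?K w) \<noteq> {}" unfolding sp by (simp add: PiE_eq_empty_iff)
    qed
  qed
  have "(\<lambda>w. c w * (\<integral>\<^sup>+y. f w y \<partial>?K w)) \<in> borel_measurable N"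
    by (intro borel_measurable_times_ennreal cm nn_integral_measurable_subprob_algebra2[OF f K])
  moreover have "(\<integral>\<^sup>+y. f w y \<partial>?P w) = c w * (\<integral>\<^sup>+y. f w y \<partial>?K w)" if w: "w \<in> space N" for w
  proof -
    have fm: "f w \<in> borel_measurable (?P w)"
      using measurable_Pair2[OF f w] by (simp add: measurable_cong_sets[OF setsP[OF w] refl])
    then have "c w * (\<integral>\<^sup>+y. f w y \<partial>?K w) = c w * (inverse (c w) * (\<integral>\<^sup>+y. f w y \<partial>?P w))"
      by (simp add: nn_integral_density nn_integral_cmult)
    also have "\<dots> = (c w * inverse (c w)) * (\<integral>\<^sup>+y. f w y \<partial>?P w)" by (simp add: mult.assoc)
    also have "c w * inverse (c w) = 1" using c0[OF w] by (simp add: divide_ennreal_def[symmetric])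
    finally show ?thesis by simp
  qed
  ultimately show ?thesis by (subst measurable_cong) auto
qed

section \<open>Laws of the marked process and of the triple of data, auxiliary variable and random
  measure\<close>

lemma sets_Hm [simp]: "sets (Hm h) = sets borel"
  by (simp add: Hm_def)

lemma space_Hm [simp]: "space (Hm h) = UNIV"
  by (simp add: Hm_def)

definition gamma_weight :: "nat \<Rightarrow> real \<Rightarrow> 'x measure \<Rightarrow> ennreal" where
  "gamma_weight n u \<mu> = ennreal (indicator {0<..} u * u ^ (n - 1) / Gamma (real n) * exp (- Tm \<mu> * u))"

text \<open>The product \<open>PiM {..<n} (\<lambda>_. \<mu>)\<close> is only meaningful for \<open>\<sigma>\<close>-finite \<open>\<mu>\<close>; the law of the
  random measure charges finite measures only, so the others may be replaced by \<open>0\<close>.\<close>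
definition cut_infinite :: "'x::topological_space measure \<Rightarrow> 'x measure" where
  "cut_infinite M = (if emeasure M UNIV < \<infinity> then M else null_measure borel)"

lemma emeasure_cut_infinite: "emeasure (cut_infinite M) UNIV < \<infinity>"
  by (simp add: cut_infinite_def)

lemma measurable_cut_infinite [measurable]:
  "cut_infinite \<in> measurable rm (rm :: 'x::topological_space measure measure)"
proof -
  have "{M \<in> space rm. emeasure M (UNIV :: 'x set) < \<infinity>} \<in> sets rm" by measurable
  then show ?thesis
    unfolding cut_infinite_def by (intro measurable_If measurable_ident_sets measurable_const) (simp_all add: space_rm)
qed

lemma measurable_Tm [measurable]: "Tm \<in> borel_measurable (rm :: 'x::topological_space measure measure)"
proof -
  have "Tm \<in> borel_measurable (rm :: 'x measure measure) \<longleftrightarrow>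
      (\<lambda>M. enn2real (emeasure M UNIV)) \<in> borel_measurable (rm :: 'x measure measure)"
    by (intro measurable_cong) (simp add: Tm_def space_rmD)
  then show ?thesis by simp
qed

lemma measurable_gamma_weight [measurable]:
  assumes [measurable]: "g \<in> borel_measurable N" "M \<in> measurable N rm"
  shows "(\<lambda>w. gamma_weight n (g w) (M w)) \<in> borel_measurable N"
  unfolding gamma_weight_def by measurable

locale marked_process = finite_point_process P for P :: "'x::polish_space set measure" +
  fixes h :: "real \<Rightarrow> real"
  assumes measurable_h [measurable]: "h \<in> borel_measurable borel"
    and h_nonneg: "0 \<le> h s"
    and prob_Hm: "prob_space (Hm h)"
begin

abbreviation marks :: "'i set \<Rightarrow> ('i \<Rightarrow> real) measure" where
  "marks J \<equiv> PiM J (\<lambda>_. Hm h)"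

lemma prob_marks: "prob_space (marks J)"
  by (intro prob_space_PiM prob_Hm)

lemma psi_law_functional:
  "integral_functional rm (\<lambda>f. \<integral>\<^sup>+F. \<integral>\<^sup>+s. f (wmeasure F s) \<partial>marks F \<partial>P)"
proof (rule integral_functional_nn_integral)
  show "integral_functional rm (\<lambda>f. \<integral>\<^sup>+s. f (wmeasure F s) \<partial>marks F)" if "F \<in> space P" for F
    by (intro integral_functional_nn_integral_comp measurable_wmeasure finite_config that) simp
  fix f :: "'x measure \<Rightarrow> ennreal" assume [measurable]: "f \<in> borel_measurable rm"
  show "(\<lambda>F. \<integral>\<^sup>+s. f (wmeasure F s) \<partial>marks F) \<in> borel_measurable P"
    by (rule measurable_nn_integral_marks[where \<phi> = "\<lambda>_. f", OF prob_Hm sets_Hm]) measurable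
qed

lemma sets_psi_law [measurable_cong]: "sets (psi_law P h) = sets rm"
  unfolding psi_law_def by (rule integral_functional_measure_of[OF psi_law_functional])

lemma nn_integral_psi_law:
  assumes "f \<in> borel_measurable rm"
  shows "integral\<^sup>N (psi_law P h) f = (\<integral>\<^sup>+F. \<integral>\<^sup>+s. f (wmeasure F s) \<partial>marks F \<partial>P)"
  unfolding psi_law_def by (rule integral_functional_measure_of(3)[OF psi_law_functional assms])

lemma cut_infinite_wmeasure: "finite F \<Longrightarrow> cut_infinite (wmeasure F s) = wmeasure F s"
  by (simp add: cut_infinite_def emeasure_wmeasure less_top)

lemma AE_psi_law_finite: "AE M in psi_law P h. cut_infinite M = M"
proof -
  let ?N = "{M \<in> space rm. \<not> emeasure M UNIV < \<infinity>} :: 'x measure set"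
  have N: "?N \<in> sets rm" by measurable
  then have "emeasure (psi_law P h) ?N = integral\<^sup>N (psi_law P h) (indicator ?N)"
    by (simp add: sets_psi_law)
  also have "\<dots> = (\<integral>\<^sup>+F. \<integral>\<^sup>+s. indicator ?N (wmeasure F s) \<partial>marks F \<partial>P)"
    using N by (intro nn_integral_psi_law) simp
  also have "\<dots> = (\<integral>\<^sup>+F. \<integral>\<^sup>+s. 0 \<partial>marks F \<partial>P)"
    by (intro nn_integral_cong) (auto simp: indicator_def finite_config emeasure_wmeasure)
  finally have "emeasure (psi_law P h) ?N = 0" by simp
  then show ?thesis
    using N by (intro AE_I[where N = ?N])
      (auto simp: cut_infinite_def sets_psi_law sets_eq_imp_space_eq[OF sets_psi_law])
qed

abbreviation S :: "nat \<Rightarrow> ((nat \<Rightarrow> 'x) \<times> real \<times> 'x measure) measure" where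
  "S n \<equiv> Xpow n \<Otimes>\<^sub>M lborel \<Otimes>\<^sub>M rm"

text \<open>With \<open>cut_infinite\<close> inside, the product integral is measurable on all of
  \<open>rm\<close>; by \<open>joint_eq\<close> the joint law is unchanged.\<close>

definition joint_inner :: "nat \<Rightarrow> ((nat \<Rightarrow> 'x) \<times> real \<times> 'x measure \<Rightarrow> ennreal) \<Rightarrow> 'x measure \<Rightarrow> real \<Rightarrow> ennreal" where
  "joint_inner n f \<mu> u = gamma_weight n u (cut_infinite \<mu>) *
    (\<integral>\<^sup>+y. f (y, u, cut_infinite \<mu>) \<partial>PiM {..<n} (\<lambda>_. cut_infinite \<mu>))"

lemma measurable_joint_inner:
  assumes f [measurable]: "f \<in> borel_measurable (S n)"
  shows "(\<lambda>(\<mu>, u). joint_inner n f \<mu> u) \<in> borel_measurable (rm \<Otimes>\<^sub>M lborel)"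
proof -
  have "(\<lambda>w. \<integral>\<^sup>+y. f (y, snd w, cut_infinite (fst w)) \<partial>PiM {..<n} (\<lambda>_. cut_infinite (fst w)))
      \<in> borel_measurable (rm \<Otimes>\<^sub>M lborel)"
  proof (rule measurable_nn_integral_PiM_finite)
    show "(\<lambda>w. cut_infinite (fst w)) \<in> measurable (rm \<Otimes>\<^sub>M lborel) rm" by measurable
    show "(\<lambda>(w, y). f (y, snd w, cut_infinite (fst w))) \<in> borel_measurable ((rm \<Otimes>\<^sub>M lborel) \<Otimes>\<^sub>M Xpow n)"
      unfolding split_beta' by measurable
  qed (rule emeasure_cut_infinite)
  then show ?thesis unfolding joint_inner_def split_beta' by measurable
qed

lemma joint_functional:
  "integral_functional (S n) (\<lambda>f. \<integral>\<^sup>+\<mu>. \<integral>\<^sup>+u. joint_inner n f \<mu> u \<partial>lborel \<partial>psi_law P h)"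
proof (rule integral_functional_nn_integral)
  fix \<mu> :: "'x measure"
  assume "\<mu> \<in> space (psi_law P h)"
  then have \<mu>: "\<mu> \<in> space rm" by (simp add: sets_eq_imp_space_eq[OF sets_psi_law])
  then have cut: "cut_infinite \<mu> \<in> space rm" by (rule measurable_space[OF measurable_cut_infinite])
  then have "sets (cut_infinite \<mu>) = sets borel" by (simp add: space_rm)
  then have [measurable_cong]: "sets (PiM {..<n} (\<lambda>_. cut_infinite \<mu>)) = sets (Xpow n)"
    unfolding Xpow_def by (intro sets_PiM_cong) auto
  show "integral_functional (S n) (\<lambda>f. \<integral>\<^sup>+u. joint_inner n f \<mu> u \<partial>lborel)"
  proof (rule integral_functional_nn_integral)
    fix u :: real
    have "(\<lambda>y. (y, u, cut_infinite \<mu>)) \<in> measurable (PiM {..<n} (\<lambda>_. cut_infinite \<mu>)) (S n)"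
      using cut by measurable
    then show "integral_functional (S n) (\<lambda>f. joint_inner n f \<mu> u)"
      unfolding joint_inner_def by (rule integral_functional_cmult[OF integral_functional_nn_integral_comp])
  next
    fix f :: "(nat \<Rightarrow> 'x) \<times> real \<times> 'x measure \<Rightarrow> ennreal"
    assume f: "f \<in> borel_measurable (S n)"
    show "(\<lambda>u. joint_inner n f \<mu> u) \<in> borel_measurable lborel"
      using measurable_Pair2[OF measurable_joint_inner[OF f] \<mu>] by simp
  qed
next
  fix f :: "(nat \<Rightarrow> 'x) \<times> real \<times> 'x measure \<Rightarrow> ennreal"
  assume f: "f \<in> borel_measurable (S n)"
  show "(\<lambda>\<mu>. \<integral>\<^sup>+u. joint_inner n f \<mu> u \<partial>lborel) \<in> borel_measurable (psi_law P h)"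
    using lborel.borel_measurable_nn_integral[OF measurable_joint_inner[OF f]]
    by (simp add: measurable_cong_sets[OF sets_psi_law refl])
qed

lemma joint_eq:
  "joint P h n = measure_of (space (S n)) (sets (S n)) (\<lambda>E. \<integral>\<^sup>+\<mu>. \<integral>\<^sup>+u. joint_inner n (indicator E) \<mu> u \<partial>lborel \<partial>psi_law P h)"
  unfolding joint_def joint_inner_def gamma_weight_def
proof (rule measure_of_eq)
  fix E :: "((nat \<Rightarrow> 'x) \<times> real \<times> 'x measure) set"
  show "(\<integral>\<^sup>+ \<mu>. \<integral>\<^sup>+ u.
        ennreal (indicator {0<..} u * u ^ (n - 1) / Gamma (real n) * exp (- Tm \<mu> * u)) *
        (\<integral>\<^sup>+ y. indicator E (y, u, \<mu>) \<partial>PiM {..<n} (\<lambda>_. \<mu>)) \<partial>lborel \<partial>psi_law P h) =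
    (\<integral>\<^sup>+ \<mu>. \<integral>\<^sup>+ u.
        ennreal (indicator {0<..} u * u ^ (n - 1) / Gamma (real n) * exp (- Tm (cut_infinite \<mu>) * u)) *
        (\<integral>\<^sup>+ y. indicator E (y, u, cut_infinite \<mu>) \<partial>PiM {..<n} (\<lambda>_. cut_infinite \<mu>)) \<partial>lborel \<partial>psi_law P h)"
    by (rule nn_integral_cong_AE) (use AE_psi_law_finite in \<open>eventually_elim, simp\<close>)
qed (rule sets.space_closed)

lemma sets_joint [measurable_cong]: "sets (joint P h n) = sets (S n)"
  unfolding joint_eq by (rule integral_functional_measure_of[OF joint_functional])

lemma nn_integral_joint:
  assumes f [measurable]: "f \<in> borel_measurable (S n)"
  shows "integral\<^sup>N (joint P h n) f = (\<integral>\<^sup>+F. \<integral>\<^sup>+s. \<integral>\<^sup>+u. gamma_weight n u (wmeasure F s) *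
    (\<Sum>y\<in>tuples n F. (\<Prod>i<n. ennreal (s (y i))) * f (y, u, wmeasure F s)) \<partial>lborel \<partial>marks F \<partial>P)"
proof -
  let ?\<Phi> = "\<lambda>\<mu>. \<integral>\<^sup>+u. joint_inner n f \<mu> u \<partial>lborel"
  have "integral\<^sup>N (joint P h n) f = (\<integral>\<^sup>+\<mu>. ?\<Phi> \<mu> \<partial>psi_law P h)"
    unfolding joint_eq by (rule integral_functional_measure_of(3)[OF joint_functional f])
  also have "\<dots> = (\<integral>\<^sup>+F. \<integral>\<^sup>+s. ?\<Phi> (wmeasure F s) \<partial>marks F \<partial>P)"
    using lborel.borel_measurable_nn_integral[OF measurable_joint_inner[OF f]]
    by (intro nn_integral_psi_law)
  also have "\<dots> = (\<integral>\<^sup>+F. \<integral>\<^sup>+s. \<integral>\<^sup>+u. gamma_weight n u (wmeasure F s) *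
    (\<Sum>y\<in>tuples n F. (\<Prod>i<n. ennreal (s (y i))) * f (y, u, wmeasure F s)) \<partial>lborel \<partial>marks F \<partial>P)"
  proof (intro nn_integral_cong)
    fix F :: "'x set" and s :: "'x \<Rightarrow> real" and u :: real assume "F \<in> space P"
    then have F: "finite F" by (rule finite_config)
    have "(\<lambda>y. f (y, u, wmeasure F s)) \<in> borel_measurable (Xpow n)"
      using wmeasure_in_space_rm[OF F, of s] by measurable
    then show "joint_inner n f (wmeasure F s) u =
      gamma_weight n u (wmeasure F s) *
        (\<Sum>y\<in>tuples n F. (\<Prod>i<n. ennreal (s (y i))) * f (y, u, wmeasure F s))"
      by (simp add: joint_inner_def cut_infinite_wmeasure[OF F] nn_integral_PiM_wmeasure[OF F])
  qed
  finally show ?thesis .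
qed

end

section \<open>Splitting off the atoms at the observed values\<close>

lemma negexp_0 [simp]: "negexp 0 = 1"
  by (simp add: negexp_def)

lemma negexp_ennreal: "0 \<le> x \<Longrightarrow> negexp (ennreal x) = ennreal (exp (- x))"
  by (simp add: negexp_def)

lemma negexp_add: "negexp (a + b) = negexp a * negexp b"
proof (cases "a = \<top> \<or> b = \<top>")
  case False
  then have "a < \<top>" "b < \<top>" by (auto simp: less_top)
  with False show ?thesis
    by (simp add: negexp_def enn2real_plus ennreal_mult[symmetric] exp_add[symmetric])
qed (auto simp: negexp_def)

lemma negexp_sum: "negexp (\<Sum>j\<in>J. a j) = (\<Prod>j\<in>J. negexp (a j))"
  by (induction J rule: infinite_finite_induct) (auto simp: negexp_add)

lemma negexp_le_1: "negexp x \<le> 1"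
  by (auto simp: negexp_def ennreal_le_1)

lemma negexp_pos: "x < \<top> \<Longrightarrow> 0 < negexp x"
  by (auto simp: negexp_def)

lemma measurable_negexp [measurable]: "negexp \<in> borel_measurable borel"
  unfolding negexp_def by measurable

text \<open>The factor of \<open>gamma_weight\<close> that is free of the measure. The other factor
  is expressed through \<open>negexp\<close>, which turns sums over atoms into products.\<close>

definition power_weight :: "nat \<Rightarrow> real \<Rightarrow> ennreal" where
  "power_weight n u = ennreal (indicator {0<..} u * u ^ (n - 1) / Gamma (real n))"

lemma measurable_power_weight [measurable]: "power_weight n \<in> borel_measurable borel"
  unfolding power_weight_def by measurable

lemma power_weight_nonpos: "u \<le> 0 \<Longrightarrow> power_weight n u = 0"
  by (simp add: power_weight_def)

lemma gamma_weight_eq: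
  assumes "1 \<le> n" "sets M = sets borel" "emeasure M UNIV < \<infinity>"
  shows "gamma_weight n u M = power_weight n u * negexp (ennreal u * emeasure M UNIV)"
proof (cases "u > 0")
  case True
  have sp: "space M = UNIV" using sets_eq_imp_space_eq[OF assms(2)] by simp
  have "ennreal u * emeasure M UNIV = ennreal (u * Tm M)"
    using assms(3) True by (simp add: Tm_def sp ennreal_mult)
  moreover have "0 \<le> u * Tm M" using True by (simp add: Tm_def)
  moreover have "0 \<le> Gamma (real n)" using assms(1) by (simp add: Gamma_real_nonneg)
  ultimately show ?thesis
    using True by (simp add: gamma_weight_def power_weight_def negexp_ennreal mult.commute[of u] flip: ennreal_mult)
qed (simp add: gamma_weight_def power_weight_def)

lemma bij_betw_dvals: "bij_betw (\<lambda>j. dvals n y ! j) {..<length (dvals n y)} (set (dvals n y))"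
  by (rule bij_betw_nth) (auto simp: distinct_dvals)

lemma prod_tuple_eq_prod_dvals:
  fixes g :: "'x \<Rightarrow> 'b::comm_monoid_mult"
  shows "(\<Prod>i<n. g (y i)) = (\<Prod>j<length (dvals n y). g (dvals n y ! j) ^ cnt n y j)"
proof -
  have "(\<Prod>i<n. g (y i)) = (\<Prod>x\<in>set (dvals n y). \<Prod>i\<in>{i \<in> {..<n}. y i = x}. g (y i))"
    by (rule prod.group[symmetric]) (auto simp: set_dvals)
  also have "\<dots> = (\<Prod>x\<in>set (dvals n y). g x ^ card {i. i < n \<and> y i = x})"
    by (intro prod.cong refl) simp
  also have "\<dots> = (\<Prod>j<length (dvals n y). g (dvals n y ! j) ^ cnt n y j)"
    unfolding cnt_def by (rule prod.reindex_bij_betw[OF bij_betw_dvals, symmetric])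
  finally show ?thesis .
qed

lemma cnt_pos: "j < length (dvals n y) \<Longrightarrow> 0 < cnt n y j"
proof -
  assume "j < length (dvals n y)"
  then have "dvals n y ! j \<in> y ` {..<n}" using nth_mem[of j "dvals n y"] by (simp add: set_dvals)
  then show ?thesis by (auto simp: cnt_def card_gt_0_iff)
qed

lemma wmeasure_split:
  fixes F :: "'x::topological_space set"
  assumes F: "finite F" and ys: "distinct ys" "set ys \<subseteq> F"
    and eq: "\<And>x. x \<in> F - set ys \<Longrightarrow> s x = s' x" "\<And>j. j < length ys \<Longrightarrow> s (ys ! j) = t j"
  shows "wmeasure F s = atoms_plus ys t (wmeasure (F - set ys) s')"
proof (rule measure_eqI)
  have F': "finite (F - set ys)" using F by simp
  show "sets (wmeasure F s) = sets (atoms_plus ys t (wmeasure (F - set ys) s'))"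
    by (simp add: sets_wmeasure F F' sets_atoms_plus)
  fix A assume "A \<in> sets (wmeasure F s)"
  then have A: "A \<in> sets borel" by (simp add: sets_wmeasure F)
  let ?g = "\<lambda>x. if x \<in> A then ennreal (s x) else 0"
  have "emeasure (wmeasure F s) A = (\<Sum>x\<in>F. ?g x)" by (rule emeasure_wmeasure[OF F A])
  also have "\<dots> = (\<Sum>x\<in>set ys. ?g x) + (\<Sum>x\<in>F - set ys. ?g x)"
    using F ys(2) by (subst sum.subset_diff[OF ys(2)]) (auto simp: add.commute)
  also have "(\<Sum>x\<in>set ys. ?g x) = (\<Sum>j<length ys. ?g (ys ! j))"
    by (rule sum.reindex_bij_betw[symmetric]) (rule bij_betw_nth; simp add: ys)
  also have "\<dots> = (\<Sum>j<length ys. if ys ! j \<in> A then ennreal (t j) else 0)"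
    by (intro sum.cong refl) (simp add: eq)
  also have "(\<Sum>x\<in>F - set ys. ?g x) = emeasure (wmeasure (F - set ys) s') A"
    unfolding emeasure_wmeasure[OF F' A] by (intro sum.cong refl) (simp add: eq)
  finally show "emeasure (wmeasure F s) A = emeasure (atoms_plus ys t (wmeasure (F - set ys) s')) A"
    by (simp add: emeasure_atoms_plus sets_wmeasure F' A)
qed

context marked_process
begin

lemma AE_marks_nonneg:
  assumes "finite J" shows "AE s in marks J. \<forall>i\<in>J. 0 \<le> s i"
proof -
  have "AE s in Hm h. 0 \<le> s"
    unfolding Hm_def by (subst AE_density) (auto simp: indicator_def)
  then have "AE s in marks J. 0 \<le> s i" if "i \<in> J" for i
    using that by (intro AE_PiM_component prob_Hm)
  then show ?thesis using assms by (simp add: AE_finite_all)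
qed

text \<open>What remains of the weighted integrand after integrating out the marks at the observed
  values. \<open>M\<close> is the measure formed by the other atoms, while \<open>f\<close> sees the
  recombined measure.\<close>

definition tilted :: "nat \<Rightarrow> ((nat \<Rightarrow> 'x) \<times> real \<times> 'x measure \<Rightarrow> ennreal) \<Rightarrow> (nat \<Rightarrow> 'x) \<Rightarrow> real \<Rightarrow> 'x measure \<Rightarrow> ennreal" where
  "tilted n f y u M = negexp (ennreal u * emeasure M UNIV) *
    (\<integral>\<^sup>+t. (\<Prod>j<length (dvals n y). ennreal (exp (- u * t j) * t j ^ cnt n y j)) *
      f (y, u, atoms_plus (dvals n y) t M) \<partial>marks {..<length (dvals n y)})"

text \<open>Both the number of inner marks and the exponents depend on the data through the pattern
  alone, so for a fixed pattern this is a parameter integral over a fixed product.\<close>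

lemma measurable_tilted:
  assumes f [measurable]: "f \<in> borel_measurable (S n)"
    and [measurable]: "gy \<in> measurable N (Xpow n)" "gu \<in> borel_measurable N" "gM \<in> measurable N rm"
  shows "(\<lambda>w. tilted n f (gy w) (gu w) (gM w)) \<in> borel_measurable N"
proof -
  let ?k = "\<lambda>p. length (remdups p)"
  let ?c = "\<lambda>p j. card {i. i < n \<and> p ! i = remdups p ! j}"
  let ?f = "\<lambda>p w. negexp (ennreal (gu w) * emeasure (gM w) UNIV) *
    (\<integral>\<^sup>+t. (\<Prod>j<?k p. ennreal (exp (- gu w * t j) * t j ^ ?c p j)) *
      f (gy w, gu w, atoms_plus (map (\<lambda>j. gy w (remdups p ! j)) [0..<?k p]) t (gM w))
        \<partial>marks {..<?k p})"
  have "tilted n f (gy w) (gu w) (gM w) = ?f (pat n (gy w)) w" for w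
  proof -
    have "dvals n (gy w) = map (\<lambda>j. gy w (remdups (pat n (gy w)) ! j)) [0..<?k (pat n (gy w))]"
      unfolding dvals_eq_pat by (rule nth_equalityI) auto
    moreover have "(\<Prod>j<?k (pat n (gy w)). ennreal (exp (- gu w * t j) * t j ^ cnt n (gy w) j)) =
        (\<Prod>j<?k (pat n (gy w)). ennreal (exp (- gu w * t j) * t j ^ ?c (pat n (gy w)) j))" for t
      by (intro prod.cong refl) (simp add: cnt_eq_pat length_dvals)
    ultimately show ?thesis by (simp add: tilted_def length_dvals)
  qed
  moreover have "(\<lambda>w. ?f (pat n (gy w)) w) \<in> borel_measurable N"
  proof (rule measurable_compose_pat[where f = ?f])
    fix p assume p: "p \<in> patterns n"
    interpret PH: prob_space "marks {..<?k p}" by (rule prob_marks)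
    have [measurable_cong]: "sets (marks {..<?k p}) = sets (PiM {..<?k p} (\<lambda>_. borel))"
      by (intro sets_PiM_cong) auto
    have [measurable]: "(\<lambda>z. atoms_plus (map (\<lambda>j. gy (fst z) (remdups p ! j)) [0..<?k p]) (snd z) (gM (fst z)))
        \<in> measurable (N \<Otimes>\<^sub>M marks {..<?k p}) rm"
      using remdups_pattern_nth[OF p]
      by (intro measurable_atoms_plus) (auto intro!: measurable_Xpow_component[where n = n])
    have [measurable]: "(\<lambda>z. \<Prod>j<?k p. ennreal (exp (- gu (fst z) * snd z j) * snd z j ^ ?c p j))
        \<in> borel_measurable (N \<Otimes>\<^sub>M marks {..<?k p})"
      by measurable
    have [measurable]: "(\<lambda>w. \<integral>\<^sup>+t. (\<Prod>j<?k p. ennreal (exp (- gu w * t j) * t j ^ ?c p j)) *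
      f (gy w, gu w, atoms_plus (map (\<lambda>j. gy w (remdups p ! j)) [0..<?k p]) t (gM w))
        \<partial>marks {..<?k p}) \<in> borel_measurable N"
      by (rule PH.borel_measurable_nn_integral) (unfold split_beta', measurable)
    show "?f p \<in> borel_measurable N" by measurable
  qed measurable
  ultimately show ?thesis by (simp only:)
qed

text \<open>The marks at the observed values are independent of all others. Total mass is additive
  over the two groups and the product of the S at the data involves the first group only, so the
  weight factorises; the first group is then indexed by position in \<open>dvals\<close>.\<close>

lemma nn_integral_marks_split:
  assumes f [measurable]: "f \<in> borel_measurable (S n)"
    and F: "finite F" and y: "y \<in> tuples n F" and u: "0 < u"
  shows "(\<integral>\<^sup>+s. negexp (ennreal u * emeasure (wmeasure F s) UNIV) *
      ((\<Prod>i<n. ennreal (s (y i))) * f (y, u, wmeasure F s)) \<partial>marks F) =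
    (\<integral>\<^sup>+s. tilted n f y u (wmeasure (F - set (dvals n y)) s) \<partial>marks (F - set (dvals n y)))"
proof -
  let ?D = "set (dvals n y)" and ?k = "length (dvals n y)"
  have D: "?D \<subseteq> F" using y by (auto simp: set_dvals tuples_def)
  have F': "finite (F - ?D)" using F by simp
  have un: "(F - ?D) \<union> ?D = F" using D by auto
  have yS: "y \<in> space (Xpow n)" using y tuples_subset_Xpow by auto
  interpret H: prob_space "Hm h" by (rule prob_Hm)
  interpret product_sigma_finite "\<lambda>_ :: 'x. Hm h" by unfold_locales
  let ?g = "\<lambda>s. negexp (ennreal u * emeasure (wmeasure F s) UNIV) *
      ((\<Prod>i<n. ennreal (s (y i))) * f (y, u, wmeasure F s))"
  have [measurable]: "wmeasure F \<in> measurable (marks F) rm"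
    by (rule measurable_wmeasure[OF F sets_Hm])
  have [measurable]: "(\<lambda>s. \<Prod>i<n. ennreal (s (y i))) \<in> borel_measurable (marks F)"
  proof (rule borel_measurable_prod_ennreal)
    fix i assume "i \<in> {..<n}"
    then have "y i \<in> F" using y by (auto simp: tuples_def)
    then have "(\<lambda>s. s (y i)) \<in> measurable (marks F) (Hm h)" by measurable
    then show "(\<lambda>s. ennreal (s (y i))) \<in> borel_measurable (marks F)"
      by (simp add: measurable_cong_sets[OF refl sets_Hm])
  qed
  have g: "?g \<in> borel_measurable (marks F)"
    using yS by measurable
  have "(\<integral>\<^sup>+s. ?g s \<partial>marks F) =
      (\<integral>\<^sup>+s'. \<integral>\<^sup>+s. ?g (merge (F - ?D) ?D (s', s)) \<partial>marks ?D \<partial>marks (F - ?D))"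
    using product_nn_integral_fold[of "F - ?D" ?D ?g] g F' unfolding un by auto
  also have "\<dots> = (\<integral>\<^sup>+s. tilted n f y u (wmeasure (F - ?D) s) \<partial>marks (F - ?D))"
  proof (rule nn_integral_cong)
    fix s' :: "'x \<Rightarrow> real"
    let ?M = "wmeasure (F - ?D) s'"
    have M: "?M \<in> space rm" by (rule wmeasure_in_space_rm[OF F'])
    \<comment> \<open>The integrand as a function of the marks \<open>t\<close> at the observed
      values, with the measure \<open>?M\<close> of the remaining atoms held fixed.\<close>
    let ?G = "\<lambda>t. (\<Prod>j<?k. negexp (ennreal u * ennreal (t j))) * negexp (ennreal u * emeasure ?M UNIV) *
      ((\<Prod>j<?k. ennreal (t j) ^ cnt n y j) * f (y, u, atoms_plus (dvals n y) t ?M))"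
    have [measurable]: "(\<lambda>t. atoms_plus (dvals n y) t ?M) \<in> measurable (marks {..<?k}) rm"
      by (rule measurable_atoms_plus_const[OF sets_Hm M])
    have [measurable_cong]: "sets (marks {..<?k}) = sets (PiM {..<?k} (\<lambda>_. borel))"
      by (intro sets_PiM_cong) auto
    have [measurable]: "(\<lambda>t. \<Prod>j<?k. negexp (ennreal u * ennreal (t j))) \<in> borel_measurable (marks {..<?k})"
      "(\<lambda>t. \<Prod>j<?k. ennreal (t j) ^ cnt n y j) \<in> borel_measurable (marks {..<?k})"
      by measurable
    have G: "?G \<in> borel_measurable (marks {..<?k})" using yS by measurable
    let ?R = "\<lambda>s. \<lambda>j\<in>{..<?k}. s (dvals n y ! j)"
    have b: "inj_on (\<lambda>j. dvals n y ! j) {..<?k}" "(\<lambda>j. dvals n y ! j) \<in> {..<?k} \<rightarrow> ?D"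
      using bij_betw_dvals[of n y] by (auto simp: bij_betw_def)
    have "?g (merge (F - ?D) ?D (s', s)) = ?G (?R s)" for s
    proof -
      let ?s = "merge (F - ?D) ?D (s', s)"
      have wm: "wmeasure F ?s = atoms_plus (dvals n y) (?R s) ?M"
        by (rule wmeasure_split[OF F distinct_dvals D]) (auto simp: merge_def)
      have "emeasure (wmeasure F ?s) UNIV = (\<Sum>j<?k. ennreal (?R s j)) + emeasure ?M UNIV"
        unfolding wm by (subst emeasure_atoms_plus) (auto simp: sets_wmeasure F')
      then have "negexp (ennreal u * emeasure (wmeasure F ?s) UNIV) =
          (\<Prod>j<?k. negexp (ennreal u * ennreal (?R s j))) * negexp (ennreal u * emeasure ?M UNIV)"
        by (simp add: distrib_left negexp_add negexp_sum sum_distrib_left)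
      moreover have "(\<Prod>i<n. ennreal (?s (y i))) = (\<Prod>j<?k. ennreal (?R s j) ^ cnt n y j)"
        unfolding prod_tuple_eq_prod_dvals[of "\<lambda>x. ennreal (?s x)"]
        by (intro prod.cong refl) (auto simp: merge_def)
      ultimately show ?thesis by (simp only: wm)
    qed
    then have "(\<integral>\<^sup>+s. ?g (merge (F - ?D) ?D (s', s)) \<partial>marks ?D) = (\<integral>\<^sup>+s. ?G (?R s) \<partial>marks ?D)"
      by (simp only:)
    also have "\<dots> = integral\<^sup>N (distr (marks ?D) (marks {..<?k}) ?R) ?G"
    proof (rule nn_integral_distr[symmetric])
      show "?R \<in> measurable (marks ?D) (marks {..<?k})"
        using b by (intro measurable_restrict measurable_component_singleton) auto
    qed (use G in \<open>simp only: measurable_distr_eq1\<close>)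
    also have "distr (marks ?D) (marks {..<?k}) ?R = marks {..<?k}"
      using distr_PiM_reindex[OF _ b, of "\<lambda>_. Hm h"] prob_Hm by simp
    also have "integral\<^sup>N (marks {..<?k}) ?G = (\<integral>\<^sup>+t. negexp (ennreal u * emeasure ?M UNIV) *
      ((\<Prod>j<?k. ennreal (exp (- u * t j) * t j ^ cnt n y j)) * f (y, u, atoms_plus (dvals n y) t ?M)) \<partial>marks {..<?k})"
    \<comment> \<open>\<open>ennreal\<close> sends negative reals to 0, so the two weights agree
      only for nonnegative marks, which holds almost surely.\<close>
    proof (rule nn_integral_cong_AE)
      show "AE t in marks {..<?k}. ?G t = negexp (ennreal u * emeasure ?M UNIV) *
        ((\<Prod>j<?k. ennreal (exp (- u * t j) * t j ^ cnt n y j)) * f (y, u, atoms_plus (dvals n y) t ?M))"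
        using AE_marks_nonneg[OF finite_lessThan]
      proof eventually_elim
        fix t :: "nat \<Rightarrow> real" assume t: "\<forall>j\<in>{..<?k}. 0 \<le> t j"
        have "(\<Prod>j<?k. ennreal (exp (- u * t j) * t j ^ cnt n y j)) =
            (\<Prod>j<?k. negexp (ennreal u * ennreal (t j)) * ennreal (t j) ^ cnt n y j)"
          using t u by (intro prod.cong refl)
            (simp add: ennreal_mult[symmetric] negexp_ennreal ennreal_power)
        then show "?G t = negexp (ennreal u * emeasure ?M UNIV) *
          ((\<Prod>j<?k. ennreal (exp (- u * t j) * t j ^ cnt n y j)) * f (y, u, atoms_plus (dvals n y) t ?M))"
          by (simp add: prod.distrib ac_simps)
      qed
    qed
    also have "\<dots> = tilted n f y u ?M"
      unfolding tilted_def
    proof (rule nn_integral_cmult)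
      have [measurable]: "(\<lambda>t. \<Prod>j<?k. ennreal (exp (- u * t j) * t j ^ cnt n y j)) \<in> borel_measurable (marks {..<?k})"
        by (intro borel_measurable_prod_ennreal) measurable
      show "(\<lambda>t. (\<Prod>j<?k. ennreal (exp (- u * t j) * t j ^ cnt n y j)) * f (y, u, atoms_plus (dvals n y) t ?M))
          \<in> borel_measurable (marks {..<?k})" using yS by measurable
    qed
    finally show "(\<integral>\<^sup>+s. ?g (merge (F - ?D) ?D (s', s)) \<partial>marks ?D) = tilted n f y u ?M" .
  qed
  finally show ?thesis .
qed

end

section \<open>Disintegration over the data\<close>

text \<open>For s \<ge> 0 the integrand is at most (m/u)^m: by the inequality (1 + us/m)^m \<le>
  e^(us), the product (us/m)^m e^(-us) is at most 1. A bounded function has finite integral under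
  the probability measure H.\<close>

lemma kappa_less_top:
  assumes "prob_space (Hm h)" and [measurable]: "h \<in> borel_measurable borel"
    and u: "0 < u" and m: "0 < m"
  shows "kappa h u m < \<top>"
proof -
  interpret prob_space "Hm h" by fact
  have AE: "AE s in Hm h. 0 \<le> s"
    unfolding Hm_def by (subst AE_density) (auto simp: indicator_def)
  have "kappa h u m \<le> (\<integral>\<^sup>+s. ennreal ((real m / u) ^ m) \<partial>Hm h)"
    unfolding kappa_def
  proof (rule nn_integral_mono_AE)
    show "AE s in Hm h. ennreal (exp (- u * s) * s ^ m) \<le> ennreal ((real m / u) ^ m)"
      using AE
    proof eventually_elim
      fix s :: real assume s: "0 \<le> s"
      have "(u * s / real m) ^ m \<le> (1 + u * s / real m) ^ m"
        using s u m by (intro power_mono) auto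
      also have "\<dots> \<le> exp (u * s)"
        using s u m by (intro exp_ge_one_plus_x_over_n_power_n) (auto intro: order_trans[of _ 0])
      finally have "(u * s / real m) ^ m * exp (- (u * s)) \<le> exp (u * s) * exp (- (u * s))"
        by (rule mult_right_mono) simp
      then have "(u * s / real m) ^ m * exp (- (u * s)) \<le> 1" by (simp only: exp_minus_inverse)
      then have "(real m / u) ^ m * ((u * s / real m) ^ m * exp (- (u * s))) \<le> (real m / u) ^ m * 1"
        using u by (intro mult_left_mono) auto
      also have "(real m / u) ^ m * ((u * s / real m) ^ m * exp (- (u * s))) = exp (- u * s) * s ^ m"
        using u m by (simp add: power_divide power_mult_distrib)
      finally show "ennreal (exp (- u * s) * s ^ m) \<le> ennreal ((real m / u) ^ m)" by (simp add: ennreal_leI)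
    qed
  qed
  also have "\<dots> = ennreal ((real m / u) ^ m)" using emeasure_space_1 by simp
  also have "\<dots> < \<top>" by simp
  finally show ?thesis .
qed

text \<open>H has a density, so it does not charge 0 and the integrand is strictly positive almost
  surely.\<close>

lemma kappa_pos:
  assumes "prob_space (Hm h)" and [measurable]: "h \<in> borel_measurable borel"
  shows "0 < kappa h u m"
proof -
  interpret prob_space "Hm h" by fact
  have AE: "AE s in Hm h. 0 < s"
  proof -
    have "AE s in lborel. (s :: real) \<noteq> 0" by (rule AE_lborel_singleton)
    then show ?thesis
      unfolding Hm_def by (subst AE_density) (auto simp: indicator_def elim!: eventually_mono)
  qed
  have "kappa h u m \<noteq> 0"
  proof
    assume "kappa h u m = 0"
    then have "AE s in Hm h. ennreal (exp (- u * s) * s ^ m) = 0"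
      unfolding kappa_def by (subst (asm) nn_integral_0_iff_AE) (auto simp: Hm_def)
    with AE have "AE s in Hm h. False"
    proof eventually_elim
      fix s :: real assume "0 < s" "ennreal (exp (- u * s) * s ^ m) = 0"
      then have "exp (- u * s) * s ^ m \<le> 0" by simp
      moreover have "0 < exp (- u * s) * s ^ m" using \<open>0 < s\<close> by simp
      ultimately show False by linarith
    qed
    then show False by simp
  qed
  then show ?thesis by (simp add: zero_less_iff_neq_zero)
qed

lemma gamma_integral:
  assumes n: "1 \<le> n" and l: "0 < l"
  shows "(\<integral>\<^sup>+u. ennreal (indicator {0<..} u * u ^ (n - 1) / Gamma (real n) * exp (- l * u)) \<partial>lborel) * ennreal l ^ n = 1"
proof -
  have G: "Gamma (real n) = fact (n - 1)"
    using n Gamma_fact[of "n - 1", where 'a = real] by (simp add: of_nat_diff)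
  \<comment> \<open>Erlang shapes count from 0, so shape parameter \<open>n - 1\<close> is the Gamma
    distribution of shape \<open>n\<close>.\<close>
  interpret prob_space "density lborel (erlang_density (n - 1) l)"
    using l by (rule prob_space_erlang_density)
  have "(\<integral>\<^sup>+u. ennreal (indicator {0<..} u * u ^ (n - 1) / Gamma (real n) * exp (- l * u)) \<partial>lborel) * ennreal l ^ n
      = (\<integral>\<^sup>+u. ennreal (indicator {0<..} u * u ^ (n - 1) / Gamma (real n) * exp (- l * u)) * ennreal l ^ n \<partial>lborel)"
    by (subst nn_integral_multc) auto
  also have "\<dots> = (\<integral>\<^sup>+u. ennreal (erlang_density (n - 1) l u) \<partial>lborel)"
  proof (rule nn_integral_cong_AE)
    \<comment> \<open>For \<open>n = 1\<close> the Erlang density does not vanish at 0, whereas the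
      indicator of the open half-line does.\<close>
    have "AE u in lborel. (u :: real) \<noteq> 0" by (rule AE_lborel_singleton)
    then show "AE u in lborel. ennreal (indicator {0<..} u * u ^ (n - 1) / Gamma (real n) * exp (- l * u)) * ennreal l ^ n
        = ennreal (erlang_density (n - 1) l u)"
    proof eventually_elim
      fix u :: real assume "u \<noteq> 0"
      have "l ^ Suc (n - 1) = l ^ n" using n by simp
      then show "ennreal (indicator {0<..} u * u ^ (n - 1) / Gamma (real n) * exp (- l * u)) * ennreal l ^ n
        = ennreal (erlang_density (n - 1) l u)"
        using \<open>u \<noteq> 0\<close> l
        by (auto simp: erlang_density_def G ennreal_power ennreal_mult'[symmetric] indicator_def ac_simps not_less)
    qed
  qed
  also have "\<dots> = 1" using emeasure_space_1 by (simp add: emeasure_density)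
  finally show ?thesis .
qed

lemma sum_tuples_prod:
  fixes g :: "'x \<Rightarrow> ennreal"
  assumes "finite F"
  shows "(\<Sum>y\<in>tuples n F. \<Prod>i<n. g (y i)) = (\<Sum>x\<in>F. g x) ^ n"
  unfolding tuples_def using prod_sum_PiE[of "{..<n}" "\<lambda>_. F" "\<lambda>_. g"] assms by simp

text \<open>For T > 0 the Gamma density compensates the factor T^n exactly; for T = 0 this factor is
  0, because n is at least 1. The bound is what makes the normalising integral of \<open>gU\<close>
  finite almost everywhere.\<close>

lemma (in marked_process) joint_mass_le_1:
  assumes n: "1 \<le> n" shows "emeasure (joint P h n) (space (joint P h n)) \<le> 1"
proof -
  interpret H: prob_space "Hm h" by (rule prob_Hm)
  have "emeasure (joint P h n) (space (joint P h n)) = (\<integral>\<^sup>+z. 1 \<partial>joint P h n)" by simp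
  also have "\<dots> = (\<integral>\<^sup>+F. \<integral>\<^sup>+s. \<integral>\<^sup>+u. gamma_weight n u (wmeasure F s) *
    (\<Sum>y\<in>tuples n F. (\<Prod>i<n. ennreal (s (y i))) * 1) \<partial>lborel \<partial>marks F \<partial>P)"
    by (rule nn_integral_joint) simp
  also have "\<dots> \<le> (\<integral>\<^sup>+F. \<integral>\<^sup>+s. 1 \<partial>marks F \<partial>P)"
  proof (intro nn_integral_mono)
    fix F :: "'x set" and s :: "'x \<Rightarrow> real" assume "F \<in> space P"
    then have F: "finite F" by (rule finite_config)
    define T where "T = (\<Sum>x\<in>F. ennreal (s x))"
    have T: "emeasure (wmeasure F s) (space (wmeasure F s)) = T"
      using sets_eq_imp_space_eq[OF sets_wmeasure[OF F]] by (simp add: emeasure_wmeasure F T_def)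
    have Tfin: "T < \<top>" using F by (simp add: T_def less_top[symmetric])
    have "(\<integral>\<^sup>+u. gamma_weight n u (wmeasure F s) * (\<Sum>y\<in>tuples n F. (\<Prod>i<n. ennreal (s (y i))) * 1) \<partial>lborel)
        = (\<integral>\<^sup>+u. gamma_weight n u (wmeasure F s) * T ^ n \<partial>lborel)"
      by (simp only: mult_1_right sum_tuples_prod[OF F, of "\<lambda>x. ennreal (s x)"] T_def)
    also have "\<dots> = (\<integral>\<^sup>+u. gamma_weight n u (wmeasure F s) \<partial>lborel) * T ^ n"
      using wmeasure_in_space_rm[OF F] by (intro nn_integral_multc) measurable
    also have "\<dots> \<le> 1"
    proof (cases "T = 0")
      case True
      then show ?thesis using n by (simp add: power_0_left)
    next
      case False
      with Tfin have "0 < enn2real T" "T = ennreal (enn2real T)"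
        by (auto simp: enn2real_positive_iff zero_less_iff_neq_zero)
      then show ?thesis
        using gamma_integral[OF n, of "enn2real T"] by (simp add: gamma_weight_def Tm_def T)
    qed
    finally show "(\<integral>\<^sup>+u. gamma_weight n u (wmeasure F s) * (\<Sum>y\<in>tuples n F. (\<Prod>i<n. ennreal (s (y i))) * 1) \<partial>lborel) \<le> 1" .
  qed
  also have "\<dots> = 1"
    by (simp add: prob_space.emeasure_space_1[OF prob_marks] emeasure_space_1)
  finally show ?thesis .
qed

text \<open>Kernels of all orders are fixed together, since the order used at \<open>y\<close> is
  the number of distinct values of \<open>y\<close>.\<close>

locale palm_model = marked_process P h for P :: "'x::polish_space set measure" and h +
  fixes K :: "nat \<Rightarrow> (nat \<Rightarrow> 'x) \<Rightarrow> 'x set measure" and n :: nat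
  assumes palm: "is_palm P k (K k)" and n: "1 \<le> n"
begin

abbreviation Kd :: "(nat \<Rightarrow> 'x) \<Rightarrow> 'x set measure" where
  "Kd y \<equiv> K (length (dvals n y)) (dvec n y)"

lemma measurable_Kd [measurable]: "Kd \<in> measurable (Xpow n) (subprob_algebra fcnt)"
  using palm by (intro measurable_palm_dvec) (auto simp: is_palm_def)

lemma prob_Kd: "prob_space (Kd y)"
  using palm[of "length (dvals n y)"] dvec_in_space[of n y] by (simp add: is_palm_def)

lemma sets_Kd [measurable_cong]: "sets (Kd y) = sets fcnt"
  using palm dvec_in_space by (intro sets_kernel[of "K (length (dvals n y))"]) (auto simp: is_palm_def)

lemma finite_Kd: "F \<in> space (Kd y) \<Longrightarrow> finite F"
  by (simp add: sets_eq_imp_space_eq[OF sets_Kd] space_fcnt)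

text \<open>The expectation of \<open>g\<close> at the marked reduced Palm measure;
  \<open>redlap\<close> is the case of an exponential \<open>g\<close>.\<close>

definition reduced :: "(nat \<Rightarrow> 'x) \<Rightarrow> ('x measure \<Rightarrow> ennreal) \<Rightarrow> ennreal" where
  "reduced y g = (\<integral>\<^sup>+F. \<integral>\<^sup>+s. g (wmeasure (F - set (dvals n y)) s)
    \<partial>marks (F - set (dvals n y)) \<partial>Kd y)"

lemma measurable_marks_reduced:
  fixes gy :: "'b \<Rightarrow> nat \<Rightarrow> 'x"
  assumes [measurable]: "(\<lambda>(x, M). \<phi> x M) \<in> borel_measurable (N \<Otimes>\<^sub>M rm)"
    and [measurable]: "gy \<in> measurable N (Xpow n)" "G \<in> measurable N fcnt"
  shows "(\<lambda>x. \<integral>\<^sup>+s. \<phi> x (wmeasure (G x - set (dvals n (gy x))) s)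
    \<partial>marks (G x - set (dvals n (gy x)))) \<in> borel_measurable N"
  by (rule measurable_nn_integral_marks[OF prob_Hm sets_Hm assms(1) measurable_diff_dvals[OF assms(2,3)]])

text \<open>Fubini is used twice: first to integrate the marks at fixed \<open>u\<close>, where the
  weight factorises, and after the Campbell formula to take the integral over \<open>u\<close> out
  of the Palm expectation.\<close>

lemma nn_integral_joint_palm:
  assumes f [measurable]: "f \<in> borel_measurable (S n)"
  shows "integral\<^sup>N (joint P h n) f =
    (\<integral>\<^sup>+y. \<integral>\<^sup>+u. power_weight n u * reduced y (tilted n f y u) \<partial>lborel \<partial>moment P n)"
proof -
  interpret H: prob_space "Hm h" by (rule prob_Hm)
  define R where "R y F u = (\<integral>\<^sup>+s. tilted n f y u (wmeasure (F - set (dvals n y)) s)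
    \<partial>marks (F - set (dvals n y)))" for y F u
  have R: "(\<lambda>x. R (fst (fst x)) (snd (fst x)) (snd x)) \<in> borel_measurable ((Xpow n \<Otimes>\<^sub>M fcnt) \<Otimes>\<^sub>M lborel)"
    unfolding R_def
    by (rule measurable_marks_reduced[where \<phi> = "\<lambda>x. tilted n f (fst (fst x)) (snd x)"])
      (auto simp: split_beta' intro!: measurable_tilted f)
  have step: "(\<integral>\<^sup>+s. \<integral>\<^sup>+u. gamma_weight n u (wmeasure F s) *
      (\<Sum>y\<in>tuples n F. (\<Prod>i<n. ennreal (s (y i))) * f (y, u, wmeasure F s)) \<partial>lborel \<partial>marks F) =
    (\<Sum>y\<in>tuples n F. \<integral>\<^sup>+u. power_weight n u * R y F u \<partial>lborel)" if F: "finite F" for F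
  proof -
    define A where "A y s u = negexp (ennreal u * emeasure (wmeasure F s) UNIV) *
      ((\<Prod>i<n. ennreal (s (y i))) * f (y, u, wmeasure F s))" for y s u
    interpret PF: prob_space "marks F" by (rule prob_marks)
    interpret PL: pair_sigma_finite "marks F" lborel ..
    have [measurable]: "wmeasure F \<in> measurable (marks F) rm"
      by (rule measurable_wmeasure[OF F sets_Hm])
    have A: "(\<lambda>z. A y (fst z) (snd z)) \<in> borel_measurable (marks F \<Otimes>\<^sub>M lborel)"
      if y: "y \<in> tuples n F" for y
    proof -
      have yS: "y \<in> space (Xpow n)" using y tuples_subset_Xpow by auto
      have [measurable]: "(\<lambda>s. s (y i)) \<in> borel_measurable (marks F)" if "i \<in> {..<n}" for i
      proof -
        have "y i \<in> F" using y that by (auto simp: tuples_def)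
        then have "(\<lambda>s. s (y i)) \<in> measurable (marks F) (Hm h)" by measurable
        then show ?thesis by (simp add: measurable_cong_sets[OF refl sets_Hm])
      qed
      have [measurable]: "(\<lambda>s. \<Prod>i<n. ennreal (s (y i))) \<in> borel_measurable (marks F)"
        by (intro borel_measurable_prod_ennreal) measurable
      show ?thesis unfolding A_def using yS by measurable
    qed
    have A2: "(\<lambda>s. A y s u) \<in> borel_measurable (marks F)" if "y \<in> tuples n F" for y u
      using measurable_Pair1[OF A[OF that], of u] by simp
    have A3: "(\<lambda>u. \<integral>\<^sup>+s. A y s u \<partial>marks F) \<in> borel_measurable lborel" if "y \<in> tuples n F" for y
    proof -
      have "(\<lambda>z. A y (snd z) (fst z)) \<in> borel_measurable (lborel \<Otimes>\<^sub>M marks F)"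
        using measurable_compose[OF measurable_pair_swap' A[OF that]] by (simp add: split_beta')
      then show ?thesis
        by (intro PF.borel_measurable_nn_integral) (simp add: split_beta')
    qed
    have "(\<integral>\<^sup>+s. \<integral>\<^sup>+u. gamma_weight n u (wmeasure F s) *
      (\<Sum>y\<in>tuples n F. (\<Prod>i<n. ennreal (s (y i))) * f (y, u, wmeasure F s)) \<partial>lborel \<partial>marks F) =
      (\<integral>\<^sup>+s. \<integral>\<^sup>+u. (\<Sum>y\<in>tuples n F. power_weight n u * A y s u) \<partial>lborel \<partial>marks F)"
    proof (intro nn_integral_cong)
      fix s :: "'x \<Rightarrow> real" and u :: real
      have "emeasure (wmeasure F s) UNIV < \<infinity>" using F by (simp add: emeasure_wmeasure less_top)
      then show "gamma_weight n u (wmeasure F s) *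
        (\<Sum>y\<in>tuples n F. (\<Prod>i<n. ennreal (s (y i))) * f (y, u, wmeasure F s)) =
        (\<Sum>y\<in>tuples n F. power_weight n u * A y s u)"
        by (simp add: gamma_weight_eq[OF n] sets_wmeasure F A_def sum_distrib_left mult.assoc)
    qed
    also have "\<dots> = (\<integral>\<^sup>+u. \<integral>\<^sup>+s. (\<Sum>y\<in>tuples n F. power_weight n u * A y s u) \<partial>marks F \<partial>lborel)"
      by (rule PL.Fubini'[symmetric])
        (auto simp: split_beta' intro!: borel_measurable_sum borel_measurable_times_ennreal A)
    also have "\<dots> = (\<integral>\<^sup>+u. (\<Sum>y\<in>tuples n F. power_weight n u * (\<integral>\<^sup>+s. A y s u \<partial>marks F)) \<partial>lborel)"
      by (intro nn_integral_cong, subst nn_integral_sum)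
        (auto intro!: sum.cong nn_integral_cmult borel_measurable_times_ennreal A2)
    also have "\<dots> = (\<Sum>y\<in>tuples n F. \<integral>\<^sup>+u. power_weight n u * (\<integral>\<^sup>+s. A y s u \<partial>marks F) \<partial>lborel)"
      by (intro nn_integral_sum borel_measurable_times_ennreal A3) auto
    also have "\<dots> = (\<Sum>y\<in>tuples n F. \<integral>\<^sup>+u. power_weight n u * R y F u \<partial>lborel)"
    proof (intro sum.cong refl nn_integral_cong)
      fix y u assume y: "y \<in> tuples n F"
      show "power_weight n u * (\<integral>\<^sup>+s. A y s u \<partial>marks F) = power_weight n u * R y F u"
      proof (cases "0 < u")
        case True
        then show ?thesis using nn_integral_marks_split[OF f F y True] by (simp add: A_def R_def)
      qed (simp add: power_weight_nonpos)
    qed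
    finally show ?thesis .
  qed
  have "integral\<^sup>N (joint P h n) f = (\<integral>\<^sup>+F. (\<Sum>y\<in>tuples n F. \<integral>\<^sup>+u. power_weight n u * R y F u \<partial>lborel) \<partial>P)"
    unfolding nn_integral_joint[OF f] by (intro nn_integral_cong step finite_config)
  also have "\<dots> = (\<integral>\<^sup>+y. \<integral>\<^sup>+F. \<integral>\<^sup>+u. power_weight n u * R y F u \<partial>lborel \<partial>Kd y \<partial>moment P n)"
  proof -
    have "(\<lambda>x. \<integral>\<^sup>+u. power_weight n u * R (fst x) (snd x) u \<partial>lborel) \<in> borel_measurable (Xpow n \<Otimes>\<^sub>M fcnt)"
      by (rule lborel.borel_measurable_nn_integral)
        (auto simp: split_beta' intro!: borel_measurable_times_ennreal R)
    from nn_integral_palm_dvec[OF palm this] show ?thesis by simp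
  qed
  also have "\<dots> = (\<integral>\<^sup>+y. \<integral>\<^sup>+u. power_weight n u * reduced y (tilted n f y u) \<partial>lborel \<partial>moment P n)"
  proof (rule nn_integral_cong)
    fix y assume "y \<in> space (moment P n)"
    then have y: "y \<in> space (Xpow n)" by (simp add: sets_eq_imp_space_eq[OF sets_moment])
    interpret Ky: prob_space "Kd y" by (rule prob_Kd)
    interpret KL: pair_sigma_finite "Kd y" lborel ..
    have Ry: "(\<lambda>z. R y (fst z) (snd z)) \<in> borel_measurable (Kd y \<Otimes>\<^sub>M lborel)"
      using measurable_compose[OF _ R, of "\<lambda>z. ((y, fst z), snd z)" "Kd y \<Otimes>\<^sub>M lborel"] y by simp
    have Ry2: "(\<lambda>F. R y F u) \<in> borel_measurable (Kd y)" for u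
      using measurable_Pair1[OF Ry, of u] by simp
    have "(\<integral>\<^sup>+F. \<integral>\<^sup>+u. power_weight n u * R y F u \<partial>lborel \<partial>Kd y) =
        (\<integral>\<^sup>+u. \<integral>\<^sup>+F. power_weight n u * R y F u \<partial>Kd y \<partial>lborel)"
      by (rule KL.Fubini'[symmetric])
        (auto simp: split_beta' intro!: borel_measurable_times_ennreal Ry measurable_compose[OF measurable_snd])
    also have "\<dots> = (\<integral>\<^sup>+u. power_weight n u * reduced y (tilted n f y u) \<partial>lborel)"
      unfolding reduced_def R_def[symmetric]
      by (intro nn_integral_cong nn_integral_cmult Ry2)
    finally show "(\<integral>\<^sup>+F. \<integral>\<^sup>+u. power_weight n u * R y F u \<partial>lborel \<partial>Kd y) =
      (\<integral>\<^sup>+u. power_weight n u * reduced y (tilted n f y u) \<partial>lborel)" .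
  qed
  finally show ?thesis .
qed

end

section \<open>Uniqueness of Laplace functionals\<close>

text \<open>Continuity along increasing sequences, including the limit \<infinity>, because the
  measures in \<open>rm\<close> may be infinite.\<close>

lemma tendsto_negexp_SUP:
  assumes "incseq a" shows "(\<lambda>i. negexp (a i)) \<longlonglongrightarrow> negexp (SUP i. a i)"
proof (cases "(SUP i. a i) = \<top>")
  case False
  have lim: "a \<longlonglongrightarrow> (SUP i. a i)" using assms by (rule LIMSEQ_SUP)
  have fin: "a i \<noteq> \<top>" for i
  proof -
    have "a i \<le> (SUP i. a i)" by (rule SUP_upper) simp
    then show ?thesis using False by (metis top_unique)
  qed
  have "(SUP i. a i) = ennreal (enn2real (SUP i. a i))" using False by (metis ennreal_enn2real_if)
  with lim have "(\<lambda>i. enn2real (a i)) \<longlonglongrightarrow> enn2real (SUP i. a i)"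
    by (metis enn2real_nonneg tendsto_enn2real)
  then have "(\<lambda>i. ennreal (exp (- enn2real (a i)))) \<longlonglongrightarrow> ennreal (exp (- enn2real (SUP i. a i)))"
    by (intro tendsto_ennrealI tendsto_exp tendsto_minus)
  moreover have "negexp x = ennreal (exp (- enn2real x))" if "x \<noteq> \<top>" for x
    using that by (simp add: negexp_def)
  ultimately show ?thesis using False fin by presburger
next
  case True
  have lim: "a \<longlonglongrightarrow> \<top>" using LIMSEQ_SUP[OF assms] True by simp
  have "(\<lambda>i. negexp (a i)) \<longlonglongrightarrow> 0"
  proof (rule order_tendstoI)
    fix b :: ennreal assume "0 < b"
    then obtain x where x: "0 < x" "x < b" using dense by blast
    from x(2) have xtop: "x < \<top>" by (rule order_less_le_trans[OF _ top_greatest])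
    then have xr: "x = ennreal (enn2real x)" "0 < enn2real x"
      using x(1) by (auto simp: enn2real_positive_iff)
    \<comment> \<open>Above the level - ln x the exponential is smaller than x; the maximum with 0
      makes the level a faithful extended nonnegative number.\<close>
    let ?l = "max 0 (- ln (enn2real x))"
    have "eventually (\<lambda>i. ennreal ?l < a i) sequentially"
      using lim by (rule order_tendstoD) simp
    then show "eventually (\<lambda>i. negexp (a i) < b) sequentially"
    proof eventually_elim
      fix i assume i: "ennreal ?l < a i"
      show "negexp (a i) < b"
      proof (cases "a i = \<top>")
        case False
        then have "?l < enn2real (a i)"
          using i by (metis enn2real_ennreal ennreal_enn2real_if ennreal_less_iff max.cobounded1)
        then have "- enn2real (a i) < ln (enn2real x)" by simp
        then have "exp (- enn2real (a i)) < enn2real x"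
          using xr(2) by (metis exp_less_cancel_iff exp_ln)
        then have "negexp (a i) < x" using False xr by (simp add: negexp_def) (metis ennreal_lessI)
        with x show ?thesis by simp
      qed (use \<open>0 < b\<close> in \<open>simp add: negexp_def\<close>)
    qed
  qed simp
  then show ?thesis using True by (simp add: negexp_def)
qed

text \<open>The moment problem on the unit interval for the law of \<open>V\<close> weighted by
  \<open>W\<close>: Weierstrass passes from powers to continuous functions, and dominated
  convergence from these to indicators. The weight \<open>W\<close> carries whatever has been fixed
  about the other coordinates.\<close>

lemma expectation_cong_of_moments:
  fixes V W :: "'a \<Rightarrow> real"
  assumes Q: "prob_space Q1" "prob_space Q2" and S: "sets Q1 = sets S" "sets Q2 = sets S"
    and V [measurable]: "V \<in> borel_measurable S" and V01: "\<And>x. 0 \<le> V x" "\<And>x. V x \<le> 1"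
    and W [measurable]: "W \<in> borel_measurable S" and W01: "\<And>x. 0 \<le> W x" "\<And>x. W x \<le> 1"
    and moments: "\<And>k::nat. (\<integral>x. W x * V x ^ k \<partial>Q1) = (\<integral>x. W x * V x ^ k \<partial>Q2)"
  shows "(\<integral>x. W x * indicator {..c} (V x) \<partial>Q1) = (\<integral>x. W x * indicator {..c} (V x) \<partial>Q2)"
proof -
  have bnd: "integrable Q g" if "prob_space Q" "sets Q = sets S" "g \<in> borel_measurable S" "\<And>x. \<bar>g x\<bar> \<le> B" for Q g and B :: real
  proof -
    interpret prob_space Q by fact
    show ?thesis using that by (intro integrable_const_bound[of _ B]) (auto simp: measurable_cong_sets[OF that(2) refl])
  qed
  have intW: "integrable Q (\<lambda>x. W x * \<phi> (V x))"
    if "prob_space Q" "sets Q = sets S" "\<phi> \<in> borel_measurable borel" "\<And>x. x \<in> {0..1} \<Longrightarrow> \<bar>\<phi> x\<bar> \<le> B" for Q \<phi> and B :: real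
  proof (rule bnd[OF that(1,2), where B = B])
    show "(\<lambda>x. W x * \<phi> (V x)) \<in> borel_measurable S" using that(3) by measurable
    show "\<bar>W x * \<phi> (V x)\<bar> \<le> B" for x
      using W01[of x] that(4)[of "V x"] V01[of x] mult_mono[of "W x" 1 "\<bar>\<phi> (V x)\<bar>" B] by (simp add: abs_mult)
  qed
  have cont: "(\<integral>x. W x * \<phi> (V x) \<partial>Q1) = (\<integral>x. W x * \<phi> (V x) \<partial>Q2)" (is "?a1 = ?a2")
    if \<phi>: "continuous_on UNIV \<phi>" for \<phi> :: "real \<Rightarrow> real"
  proof (rule ccontr)
    assume ne: "?a1 \<noteq> ?a2"
    \<comment> \<open>Replacing \<phi> by a polynomial costs at most \<open>e\<close> under each of
      the two measures, so a third of the assumed gap gives the contradiction.\<close>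
    define e where "e = \<bar>?a1 - ?a2\<bar> / 3"
    have e: "0 < e" using ne by (simp add: e_def)
    obtain g where g: "real_polynomial_function g" "\<And>x. x \<in> {0..1} \<Longrightarrow> \<bar>\<phi> x - g x\<bar> < e"
      using Stone_Weierstrass_real_polynomial_function[of "{0..1::real}" \<phi> e] continuous_on_subset[OF \<phi>] e by auto
    then obtain a N where ga: "g = (\<lambda>x. \<Sum>i\<le>N. a i * x ^ i)" by (auto simp: real_polynomial_function_iff_sum)
    have [measurable]: "\<phi> \<in> borel_measurable borel" using \<phi> by (rule borel_measurable_continuous_onI)
    have [measurable]: "g \<in> borel_measurable borel" unfolding ga by measurable
    have "\<exists>B. \<forall>x\<in>{0..1}. \<bar>\<phi> x\<bar> \<le> B"
      using compact_imp_bounded[OF compact_continuous_image[OF continuous_on_subset[OF \<phi> subset_UNIV] compact_Icc[of 0 1]]]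
      by (auto simp: bounded_iff)
    then obtain B where B: "\<And>x. x \<in> {0..1} \<Longrightarrow> \<bar>\<phi> x\<bar> \<le> B" by blast
    have B': "\<bar>g x\<bar> \<le> B + e" if "x \<in> {0..1}" for x using B[OF that] g(2)[OF that] by linarith
    have poly: "(\<integral>x. W x * g (V x) \<partial>Q) = (\<Sum>i\<le>N. a i * (\<integral>x. W x * V x ^ i \<partial>Q))"
      if "prob_space Q" "sets Q = sets S" for Q
    proof -
      have "(\<integral>x. W x * g (V x) \<partial>Q) = (\<integral>x. (\<Sum>i\<le>N. a i * (W x * V x ^ i)) \<partial>Q)"
        unfolding ga by (simp add: sum_distrib_left ac_simps)
      also have "\<dots> = (\<Sum>i\<le>N. \<integral>x. a i * (W x * V x ^ i) \<partial>Q)"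
        by (intro Bochner_Integration.integral_sum integrable_mult_right intW[OF that, where B = 1])
          (auto simp: power_le_one)
      finally show ?thesis by simp
    qed
    have close: "\<bar>(\<integral>x. W x * \<phi> (V x) \<partial>Q) - (\<integral>x. W x * g (V x) \<partial>Q)\<bar> \<le> e"
      if q: "prob_space Q" "sets Q = sets S" for Q
    proof -
      interpret prob_space Q by fact
      have i: "integrable Q (\<lambda>x. W x * \<phi> (V x))" "integrable Q (\<lambda>x. W x * g (V x))"
        by (rule intW[OF q, where B = B and \<phi> = \<phi>]; use B in simp)
          (rule intW[OF q, where B = "B + e" and \<phi> = g]; use B' in simp)
      have "\<bar>(\<integral>x. W x * \<phi> (V x) \<partial>Q) - (\<integral>x. W x * g (V x) \<partial>Q)\<bar> = \<bar>\<integral>x. W x * \<phi> (V x) - W x * g (V x) \<partial>Q\<bar>"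
        using i by simp
      also have "\<dots> \<le> (\<integral>x. \<bar>W x * \<phi> (V x) - W x * g (V x)\<bar> \<partial>Q)"
        by (rule integral_abs_bound)
      also have "\<dots> \<le> (\<integral>x. e \<partial>Q)"
      proof (rule integral_mono)
        show "integrable Q (\<lambda>x. \<bar>W x * \<phi> (V x) - W x * g (V x)\<bar>)" using i by simp
        fix x
        have "\<bar>W x * \<phi> (V x) - W x * g (V x)\<bar> = W x * \<bar>\<phi> (V x) - g (V x)\<bar>"
          using W01 by (simp add: abs_mult right_diff_distrib[symmetric])
        also have "\<dots> \<le> 1 * e" using W01[of x] g(2)[of "V x"] V01[of x] by (intro mult_mono) auto
        finally show "\<bar>W x * \<phi> (V x) - W x * g (V x)\<bar> \<le> e" by simp
      qed simp
      also have "\<dots> = e" by (simp add: prob_space)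
      finally show ?thesis .
    qed
    have "(\<integral>x. W x * g (V x) \<partial>Q1) = (\<integral>x. W x * g (V x) \<partial>Q2)"
      by (simp add: poly Q S moments)
    with close[OF Q(1) S(1)] close[OF Q(2) S(2)] have "\<bar>?a1 - ?a2\<bar> \<le> 2 * e" by linarith
    with e show False by (simp add: e_def)
  qed
  \<comment> \<open>Continuous ramps: equal to 1 up to \<open>c\<close> and, for positive
    \<open>m\<close>, falling to 0 over a length of 1/m. They converge at every point to the
    indicator of the closed half-line.\<close>
  define \<phi> where "\<phi> m x = max 0 (min 1 (1 - real m * (x - c)))" for m :: nat and x :: real
  have \<phi>_cont: "continuous_on UNIV (\<phi> m)" for m unfolding \<phi>_def by (intro continuous_intros)
  have \<phi>m [measurable]: "\<phi> m \<in> borel_measurable borel" for m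
    using \<phi>_cont by (rule borel_measurable_continuous_onI)
  have \<phi>_lim: "(\<lambda>m. \<phi> m x) \<longlonglongrightarrow> indicator {..c} x" for x
  proof (cases "x \<le> c")
    case True
    then have "\<phi> m x = 1" for m
      using mult_nonneg_nonpos[of "real m" "x - c"] by (simp add: \<phi>_def)
    then show ?thesis using True by simp
  next
    case False
    then obtain N where N: "1 < real N * (x - c)" using reals_Archimedean3[of "x - c"] by auto
    have "eventually (\<lambda>m. \<phi> m x = 0) sequentially"
      using eventually_ge_at_top[of N]
    proof eventually_elim
      fix m assume "N \<le> m"
      then have "real N * (x - c) \<le> real m * (x - c)" using False by (intro mult_right_mono) auto
      with N show "\<phi> m x = 0" by (simp add: \<phi>_def)
    qed
    then have "(\<lambda>m. \<phi> m x) \<longlonglongrightarrow> 0" by (rule tendsto_eventually)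
    then show ?thesis using False by simp
  qed
  have lim: "(\<lambda>m. \<integral>x. W x * \<phi> m (V x) \<partial>Q) \<longlonglongrightarrow> (\<integral>x. W x * indicator {..c} (V x) \<partial>Q)"
    if q: "prob_space Q" "sets Q = sets S" for Q
  proof -
    interpret prob_space Q by fact
    note [measurable_cong] = q(2)
    show ?thesis
    proof (rule integral_dominated_convergence[where w = "\<lambda>_. 1"])
      show "AE x in Q. (\<lambda>m. W x * \<phi> m (V x)) \<longlonglongrightarrow> W x * indicator {..c} (V x)"
        by (intro AE_I2 tendsto_mult_left \<phi>_lim)
      show "AE x in Q. norm (W x * \<phi> m (V x)) \<le> 1" for m
        using W01 by (intro AE_I2) (auto simp: \<phi>_def abs_mult intro!: mult_le_one)
      show "(\<lambda>x. W x * indicator {..c} (V x)) \<in> borel_measurable Q" by measurable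
      show "(\<lambda>x. W x * \<phi> m (V x)) \<in> borel_measurable Q" for m by measurable
    qed simp
  qed
  show ?thesis
    using lim[OF Q(1) S(1)] lim[OF Q(2) S(2)] cont[OF \<phi>_cont]
    by (simp add: LIMSEQ_unique)
qed

section \<open>Laplace functionals as expectations of variables with values in the unit
  interval\<close>

definition lapl :: "('x \<Rightarrow> real) \<Rightarrow> 'x measure \<Rightarrow> real" where
  "lapl f M = enn2real (negexp (\<integral>\<^sup>+z. ennreal (f z) \<partial>M))"

lemma ennreal_lapl: "ennreal (lapl f M) = negexp (\<integral>\<^sup>+z. ennreal (f z) \<partial>M)"
  unfolding lapl_def using negexp_le_1[of "\<integral>\<^sup>+z. ennreal (f z) \<partial>M"]
  by (intro ennreal_enn2real) (auto simp: less_top[symmetric] top_unique)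

lemma lapl_nonneg: "0 \<le> lapl f M" and lapl_le_1: "lapl f M \<le> 1"
proof -
  show "0 \<le> lapl f M" by (simp add: lapl_def)
  have "ennreal (lapl f M) \<le> ennreal 1" using negexp_le_1 by (simp add: ennreal_lapl)
  then show "lapl f M \<le> 1" by (subst (asm) ennreal_le_iff) auto
qed

lemma measurable_lapl [measurable]:
  assumes [measurable]: "f \<in> borel_measurable borel"
  shows "lapl f \<in> borel_measurable (rm :: 'x::topological_space measure measure)"
  unfolding lapl_def by measurable

lemma lapl_add:
  assumes "M \<in> space (rm :: 'x::topological_space measure measure)"
    and [measurable]: "f \<in> borel_measurable borel" "g \<in> borel_measurable borel"
    and "\<And>z. 0 \<le> f z" "\<And>z. 0 \<le> g z"
  shows "lapl (\<lambda>z. f z + g z) M = lapl f M * lapl g M"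
proof -
  have [measurable_cong]: "sets M = sets borel" using assms(1) by (simp add: space_rm)
  have "(\<integral>\<^sup>+z. ennreal (f z + g z) \<partial>M) = (\<integral>\<^sup>+z. ennreal (f z) \<partial>M) + (\<integral>\<^sup>+z. ennreal (g z) \<partial>M)"
    using assms(4,5) by (simp add: nn_integral_add)
  then show ?thesis by (simp add: lapl_def negexp_add enn2real_mult)
qed

lemma lapl_mult_nat:
  assumes "M \<in> space (rm :: 'x::topological_space measure measure)"
    and f [measurable]: "f \<in> borel_measurable borel" and "\<And>z. 0 \<le> f z"
  shows "lapl (\<lambda>z. real k * f z) M = lapl f M ^ k"
proof (induction k)
  case 0 then show ?case by (simp add: lapl_def)
next
  case (Suc k)
  have "lapl (\<lambda>z. real (Suc k) * f z) M = lapl (\<lambda>z. f z + real k * f z) M" by (simp add: distrib_right)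
  also have "\<dots> = lapl f M * lapl (\<lambda>z. real k * f z) M"
    using assms by (intro lapl_add) auto
  finally show ?case using Suc by simp
qed

lemma laplace_eq_integral_lapl:
  assumes "prob_space Q" "sets Q = sets rm" "f \<in> borel_measurable borel"
  shows "laplace Q f = ennreal (\<integral>M. lapl f M \<partial>Q)"
proof -
  interpret prob_space Q by fact
  have "integrable Q (lapl f)"
    using assms(3) by (intro integrable_const_bound[of _ 1])
      (auto simp: lapl_nonneg lapl_le_1 measurable_cong_sets[OF assms(2) refl])
  then show ?thesis
    unfolding laplace_def ennreal_lapl[symmetric] by (intro nn_integral_eq_integral) (auto simp: lapl_nonneg)
qed

text \<open>\<open>admissible\<close> asks for bounded support, but the moment argument adds
  multiples of indicators of arbitrary Borel sets. Balls exhaust the space, and the Laplace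
  integrands are dominated by 1.\<close>

lemma laplace_truncate_tendsto:
  fixes f :: "'x::polish_space \<Rightarrow> real"
  assumes "prob_space Q" and Q: "sets Q = sets rm" and [measurable]: "f \<in> borel_measurable borel"
  shows "(\<lambda>m. laplace Q (\<lambda>z. f z * indicator (cball x0 (real m)) z)) \<longlonglongrightarrow> laplace Q f"
  unfolding laplace_def
proof (rule nn_integral_dominated_convergence[where w = "\<lambda>_. 1"])
  note [measurable_cong] = Q
  interpret prob_space Q by fact
  let ?f = "\<lambda>m z. ennreal (f z * indicator (cball x0 (real m)) z)"
  have [measurable]: "cball x0 (real m) \<in> sets borel" for m by simp
  have meas: "(\<lambda>M. negexp (\<integral>\<^sup>+ z. g z \<partial>M)) \<in> borel_measurable Q" if "g \<in> borel_measurable borel" for g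
    using measurable_compose[OF measurable_rm_nn_integral[OF that] measurable_negexp]
    by (simp add: measurable_cong_sets[OF Q refl])
  show "(\<lambda>M. negexp (\<integral>\<^sup>+ z. ?f m z \<partial>M)) \<in> borel_measurable Q" for m by (rule meas) measurable
  show "AE M in Q. (\<lambda>m. negexp (\<integral>\<^sup>+ z. ?f m z \<partial>M)) \<longlonglongrightarrow> negexp (\<integral>\<^sup>+ z. ennreal (f z) \<partial>M)"
  proof (rule AE_I2)
    fix M assume "M \<in> space Q"
    then have M [measurable_cong]: "sets M = sets borel"
      by (simp add: sets_eq_imp_space_eq[OF Q] space_rm)
    have inc: "incseq ?f"
      by (auto simp: incseq_def le_fun_def indicator_def)
    have "(SUP m. ?f m z) = ennreal (f z)" for z
    proof (rule antisym)
      show "(SUP m. ?f m z) \<le> ennreal (f z)" by (rule SUP_least) (auto simp: indicator_def)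
      obtain m :: nat where "dist x0 z \<le> real m" using real_arch_simple by blast
      then show "ennreal (f z) \<le> (SUP m. ?f m z)" by (intro SUP_upper2[of m]) simp_all
    qed
    then have "(\<integral>\<^sup>+ z. ennreal (f z) \<partial>M) = (\<integral>\<^sup>+ z. (SUP m. ?f m z) \<partial>M)" by simp
    also have "\<dots> = (SUP m. \<integral>\<^sup>+ z. ?f m z \<partial>M)"
      by (intro nn_integral_monotone_convergence_SUP inc) measurable
    finally have eq: "(\<integral>\<^sup>+ z. ennreal (f z) \<partial>M) = (SUP m. \<integral>\<^sup>+ z. ?f m z \<partial>M)" .
    have "incseq (\<lambda>m. \<integral>\<^sup>+ z. ?f m z \<partial>M)"
      using inc by (auto simp: incseq_def le_fun_def intro!: nn_integral_mono)
    from tendsto_negexp_SUP[OF this] show "(\<lambda>m. negexp (\<integral>\<^sup>+ z. ?f m z \<partial>M)) \<longlonglongrightarrow> negexp (\<integral>\<^sup>+ z. ennreal (f z) \<partial>M)"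
      unfolding eq .
  qed
  show "(\<integral>\<^sup>+ M. 1 \<partial>Q) < \<infinity>" by (simp add: emeasure_space_1)
  show "(\<lambda>M. negexp (\<integral>\<^sup>+ z. ennreal (f z) \<partial>M)) \<in> borel_measurable Q" by (rule meas) measurable
qed (auto simp: negexp_le_1)

text \<open>The cylinder events on finitely many variables exp (- M(A)) form a generator closed
  under intersection. The induction over the list of constraints keeps a free factor
  \<open>lapl f\<close>, which is what supplies the moments of the next variable.\<close>

lemma laplace_unique:
  fixes Q1 Q2 :: "'x::polish_space measure measure"
  assumes Q: "prob_space Q1" "prob_space Q2" and S: "sets Q1 = sets rm" "sets Q2 = sets rm"
    and eq: "\<And>f. admissible f \<Longrightarrow> laplace Q1 f = laplace Q2 f"
  shows "Q1 = Q2"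
proof -
  define ok where "ok f \<longleftrightarrow> f \<in> borel_measurable borel \<and> (\<forall>z. 0 \<le> f z) \<and> bounded (range f)" for f :: "'x \<Rightarrow> real"
  have lap: "(\<integral>M. lapl f M \<partial>Q1) = (\<integral>M. lapl f M \<partial>Q2)" if f: "ok f" for f
  proof -
    have fm: "f \<in> borel_measurable borel" using f by (simp add: ok_def)
    \<comment> \<open>The centre \<open>undefined\<close> of the balls is an arbitrary
      point.\<close>
    have "laplace Q1 (\<lambda>z. f z * indicator (cball undefined (real m)) z) =
        laplace Q2 (\<lambda>z. f z * indicator (cball undefined (real m)) z)" for m :: nat
    proof (rule eq)
      have "bounded {z. f z * indicator (cball undefined (real m)) z \<noteq> 0}"
        by (rule bounded_subset[OF bounded_cball[of undefined "real m"]]) (auto simp: indicator_def)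
      moreover have "range (\<lambda>z. f z * indicator (cball undefined (real m)) z) \<subseteq> insert 0 (range f)"
        by (auto simp: indicator_def)
      then have "bounded (range (\<lambda>z. f z * indicator (cball undefined (real m)) z))"
        by (rule bounded_subset[rotated]) (use f in \<open>simp add: ok_def\<close>)
      ultimately show "admissible (\<lambda>z. f z * indicator (cball undefined (real m)) z)"
        using f fm
        by (auto simp: admissible_def ok_def intro!: borel_measurable_times borel_measurable_indicator)
    qed
    then have "laplace Q1 f = laplace Q2 f"
      using laplace_truncate_tendsto[OF Q(1) S(1) fm, of undefined] laplace_truncate_tendsto[OF Q(2) S(2) fm, of undefined]
      by (simp add: LIMSEQ_unique)
    then show ?thesis
      by (simp add: laplace_eq_integral_lapl Q S fm lapl_nonneg integral_nonneg)
  qed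
  define V :: "'x set \<Rightarrow> 'x measure \<Rightarrow> real" where "V A = lapl (indicator A)" for A
  \<comment> \<open>A product of indicators, so that the induction can peel off one constraint at a
    time.\<close>
  define D :: "('x set \<times> real) list \<Rightarrow> 'x measure \<Rightarrow> real" where
    "D L M = (\<Prod>(A, c)\<leftarrow>L. indicator {..c} (V A M))" for L M
  have Vm [measurable]: "V A \<in> borel_measurable rm" if "A \<in> sets borel" for A
    unfolding V_def using that by measurable
  have D_Nil [simp]: "D [] M = 1" and D_Cons [simp]: "D ((A, c) # L) M = indicator {..c} (V A M) * D L M" for M A c L
    by (simp_all add: D_def)
  have D01: "0 \<le> D L M \<and> D L M \<le> 1" for L M
    by (induction L) (auto simp: indicator_def)
  have Dm: "D L \<in> borel_measurable rm" if "\<forall>(A, c)\<in>set L. A \<in> sets borel" for L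
    using that
  proof (induction L)
    case Nil
    then show ?case by (simp add: D_def)
  next
    case (Cons a L)
    then obtain A c where a: "a = (A, c)" "A \<in> sets borel" by (cases a) auto
    have [measurable]: "D L \<in> borel_measurable rm" "V A \<in> borel_measurable rm"
      using Cons Vm a by simp_all
    have "(\<lambda>M. indicator {..c} (V A M) * D L M) \<in> borel_measurable rm" by measurable
    then show ?case using a by (simp add: D_def)
  qed
  \<comment> \<open>Multiplying \<^term>\<open>lapl f\<close> by the \<open>k\<close>-th power of \<^term>\<open>V A\<close> replaces \<open>f\<close> by \<open>f + k 1\<^sub>A\<close>, so the
    hypothesis for all \<open>f\<close> provides the moments of the next coordinate.\<close>
  have key: "(\<integral>M. D L M * lapl f M \<partial>Q1) = (\<integral>M. D L M * lapl f M \<partial>Q2)"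
    if "\<forall>(A, c)\<in>set L. A \<in> sets borel" "ok f" for L f
    using that
  proof (induction L arbitrary: f)
    case Nil
    then show ?case using lap by simp
  next
    case (Cons a L)
    then obtain A c where a: "a = (A, c)" and A: "A \<in> sets borel" by (cases a) auto
    have L: "\<forall>(A, c)\<in>set L. A \<in> sets borel" using Cons by simp
    have fm: "f \<in> borel_measurable borel" and f0: "\<And>z. 0 \<le> f z" using Cons(3) by (auto simp: ok_def)
    have "(\<integral>M. (D L M * lapl f M) * indicator {..c} (V A M) \<partial>Q1) = (\<integral>M. (D L M * lapl f M) * indicator {..c} (V A M) \<partial>Q2)"
    proof (rule expectation_cong_of_moments[OF Q S])
      show "V A \<in> borel_measurable rm" using A by (rule Vm)
      show "(\<lambda>M. D L M * lapl f M) \<in> borel_measurable rm" using Dm[OF L] fm by measurable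
      show "0 \<le> V A M" "V A M \<le> 1" for M by (simp_all add: V_def lapl_nonneg lapl_le_1)
      show "0 \<le> D L M * lapl f M" "D L M * lapl f M \<le> 1" for M
        using D01 by (auto intro!: mult_le_one simp: lapl_nonneg lapl_le_1)
      fix k :: nat
      let ?g = "\<lambda>z. f z + real k * indicator A z"
      have "ok ?g"
      proof -
        have "\<exists>B. \<forall>z. \<bar>f z\<bar> \<le> B" using Cons(3) unfolding ok_def bounded_iff by (metis rangeI real_norm_def)
        then obtain B where B: "\<And>z. \<bar>f z\<bar> \<le> B" by blast
        have "\<bar>?g z\<bar> \<le> B + real k" for z
          using f0[of z] B[of z] by (auto simp: indicator_def)
        then have "bounded (range ?g)" unfolding bounded_iff by (intro exI[of _ "B + real k"]) auto
        then show ?thesis using fm f0 A by (auto simp: ok_def)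
      qed
      have g: "D L M * lapl f M * V A M ^ k = D L M * lapl ?g M" if "M \<in> space rm" for M
        using that fm f0 A by (subst lapl_add) (auto simp: lapl_mult_nat V_def)
      have "(\<integral>M. D L M * lapl f M * V A M ^ k \<partial>Q') = (\<integral>M. D L M * lapl ?g M \<partial>Q')" if "sets Q' = sets rm" for Q'
        by (intro Bochner_Integration.integral_cong refl g) (simp add: sets_eq_imp_space_eq[OF that])
      then show "(\<integral>M. D L M * lapl f M * V A M ^ k \<partial>Q1) = (\<integral>M. D L M * lapl f M * V A M ^ k \<partial>Q2)"
        using Cons.IH[OF L \<open>ok ?g\<close>] by (simp add: S)
    qed
    then show ?case by (simp add: a ac_simps)
  qed
  \<comment> \<open>A list of constraints may mention a set several times, so concatenating lists
    intersects cylinders.\<close>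
  define cyl where "cyl L = {M \<in> space (rm :: 'x measure measure). \<forall>(A, c)\<in>set L. V A M \<le> c}" for L
  define G where "G = {cyl L | L. \<forall>(A, c)\<in>set L. A \<in> sets borel}"
  have D_eq: "D L M = indicator (cyl L) M" if "M \<in> space rm" for L M
  proof (induction L)
    case (Cons a L)
    then show ?case using that by (cases a) (auto simp: cyl_def indicator_def)
  qed (simp add: cyl_def that)
  have cyl_sets: "cyl L \<in> sets rm" if "\<forall>(A, c)\<in>set L. A \<in> sets borel" for L
  proof -
    have "D L -` {1} \<inter> space rm \<in> sets rm" using Dm[OF that] by measurable
    also have "D L -` {1} \<inter> space rm = cyl L" using D_eq by (auto simp: cyl_def indicator_def split: if_splits)
    finally show ?thesis .
  qed
  have Gsub: "G \<subseteq> Pow (space rm)" by (auto simp: G_def cyl_def)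
  have gen: "sets rm = sigma_sets (space rm) G"
  proof
    show "sigma_sets (space rm) G \<subseteq> sets rm"
      by (rule sets.sigma_sets_subset) (auto simp: G_def cyl_sets)
    let ?\<Sigma> = "sigma (space rm) G"
    have VS: "V A \<in> borel_measurable ?\<Sigma>" if A: "A \<in> sets borel" for A
      unfolding borel_measurable_iff_le
    proof
      fix c
      have "{M \<in> space ?\<Sigma>. V A M \<le> c} = cyl [(A, c)]" using Gsub by (auto simp: cyl_def)
      moreover have "cyl [(A, c)] \<in> G" unfolding G_def using A by (intro CollectI exI[of _ "[(A, c)]"]) auto
      ultimately show "{M \<in> space ?\<Sigma>. V A M \<le> c} \<in> sets ?\<Sigma>"
        using Gsub by (auto simp: sets_measure_of)
    qed
    have "(\<lambda>M. M) \<in> measurable ?\<Sigma> rm"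
    proof (rule measurable_rmI)
      show "sets M = sets borel" if "M \<in> space ?\<Sigma>" for M using that Gsub by (simp add: space_rm)
      fix A :: "'x set" assume A: "A \<in> sets borel"
      \<comment> \<open>No information is lost in passing to exp (- M(A)): the value 0 stands for
        infinite mass.\<close>
      have em: "emeasure M A = (if V A M = 0 then \<top> else ennreal (- ln (V A M)))" if "M \<in> space ?\<Sigma>" for M
      proof -
        have sM: "sets M = sets borel" using that Gsub by (simp add: space_rm)
        have "(\<integral>\<^sup>+z. ennreal (indicator A z) \<partial>M) = emeasure M A"
          using A sM by (simp add: ennreal_indicator)
        then have "V A M = enn2real (negexp (emeasure M A))" by (simp add: V_def lapl_def)
        then show ?thesis by (auto simp: negexp_def ennreal_enn2real_if)
      qed
      have "(\<lambda>M. if V A M = 0 then \<top> else ennreal (- ln (V A M))) \<in> borel_measurable ?\<Sigma>"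
        using VS[OF A] by measurable
      then show "(\<lambda>M. emeasure M A) \<in> borel_measurable ?\<Sigma>" by (subst measurable_cong[OF em])
    qed
    then have "(\<lambda>M. M) -` X \<inter> space ?\<Sigma> \<in> sets ?\<Sigma>" if "X \<in> sets rm" for X using that by (rule measurable_sets)
    then show "sets rm \<subseteq> sigma_sets (space rm) G"
      using Gsub sets.sets_into_space[of _ rm] by (auto simp: sets_measure_of Int_absorb2)
  qed
  show "Q1 = Q2"
  proof (rule measure_eqI_generator_eq[of G "space rm" _ _ "\<lambda>_. cyl []"])
    show "Int_stable G"
    proof (rule Int_stableI)
      fix a b assume "a \<in> G" "b \<in> G"
      then obtain L L' where "a = cyl L" "b = cyl L'" "\<forall>(A, c)\<in>set L. A \<in> sets borel" "\<forall>(A, c)\<in>set L'. A \<in> sets borel"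
        by (auto simp: G_def)
      moreover have "cyl L \<inter> cyl L' = cyl (L @ L')" by (auto simp: cyl_def)
      ultimately show "a \<inter> b \<in> G" unfolding G_def by (intro CollectI exI[of _ "L @ L'"]) auto
    qed
    show "G \<subseteq> Pow (space rm)" by fact
    show "sets Q1 = sigma_sets (space rm) G" "sets Q2 = sigma_sets (space rm) G" using S gen by simp_all
    show "range (\<lambda>_::nat. cyl []) \<subseteq> G" unfolding G_def by (auto intro!: exI[of _ "[]"])
    show "(\<Union>i::nat. cyl []) = space rm" by (simp add: cyl_def)
    show "emeasure Q1 (cyl []) \<noteq> \<infinity>"
      using finite_measure.emeasure_finite[OF prob_space.finite_measure[OF Q(1)]] by simp
    fix X assume "X \<in> G"
    then obtain L where X: "X = cyl L" and L: "\<forall>(A, c)\<in>set L. A \<in> sets borel" by (auto simp: G_def)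
    \<comment> \<open>With the zero function for \<open>f\<close>, the identity \<open>key\<close>
      compares the probabilities of cylinders.\<close>
    have ok0: "ok (\<lambda>_. 0)" by (simp add: ok_def)
    have m: "emeasure Q' X = ennreal (\<integral>M. D L M * lapl (\<lambda>_. 0) M \<partial>Q')" if "prob_space Q'" "sets Q' = sets rm" for Q'
    proof -
      interpret prob_space Q' by fact
      have "(\<integral>M. D L M * lapl (\<lambda>_. 0) M \<partial>Q') = (\<integral>M. indicator (cyl L) M \<partial>Q')"
        using that by (intro Bochner_Integration.integral_cong refl) (simp add: lapl_def D_eq sets_eq_imp_space_eq[OF that(2)])
      also have "\<dots> = measure Q' (cyl L)" using cyl_sets[OF L] that by simp
      finally show ?thesis by (simp add: X emeasure_eq_measure)
    qed
    show "emeasure Q1 X = emeasure Q2 X" by (simp add: m Q S key[OF L ok0])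
  qed
qed

section \<open>The posterior law\<close>

lemma (in prob_space) nn_integral_pos:
  assumes [measurable]: "f \<in> borel_measurable M" and pos: "\<And>x. x \<in> space M \<Longrightarrow> 0 < f x"
  shows "0 < (\<integral>\<^sup>+x. f x \<partial>M)"
proof -
  have "(\<integral>\<^sup>+x. f x \<partial>M) \<noteq> 0"
  proof
    assume "(\<integral>\<^sup>+x. f x \<partial>M) = 0"
    then have "AE x in M. f x = 0" by (subst (asm) nn_integral_0_iff_AE) auto
    then have "AE x in M. False"
      by (rule AE_mp) (rule AE_I2, use pos in fastforce)
    then show False by simp
  qed
  then show ?thesis by (simp add: zero_less_iff_neq_zero)
qed

lemma PiM_density:
  assumes "finite I" and M: "prob_space M"
    and f [measurable]: "\<And>i. i \<in> I \<Longrightarrow> f i \<in> borel_measurable M"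
    and p: "\<And>i. prob_space (density M (f i))"
  shows "PiM I (\<lambda>i. density M (f i)) = density (PiM I (\<lambda>_. M)) (\<lambda>x. \<Prod>i\<in>I. f i (x i))"
proof -
  interpret D: product_sigma_finite "\<lambda>i. density M (f i)"
    using p by (simp add: product_sigma_finite_def prob_space_imp_sigma_finite)
  interpret M: product_sigma_finite "\<lambda>_. M"
    using M by (simp add: product_sigma_finite_def prob_space_imp_sigma_finite)
  have fm [measurable]: "(\<lambda>x. \<Prod>i\<in>I. f i (x i)) \<in> borel_measurable (PiM I (\<lambda>_. M))"
  proof (rule borel_measurable_prod_ennreal)
    fix i assume i: "i \<in> I"
    have "(\<lambda>x. x i) \<in> measurable (PiM I (\<lambda>_. M)) M"
      using measurable_component_singleton[OF i, of "\<lambda>_. M"] .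
    from measurable_compose[OF this f[OF i]]
    show "(\<lambda>x. f i (x i)) \<in> borel_measurable (PiM I (\<lambda>_. M))" .
  qed
  have "density (PiM I (\<lambda>_. M)) (\<lambda>x. \<Prod>i\<in>I. f i (x i)) = PiM I (\<lambda>i. density M (f i))"
  proof (rule D.PiM_eqI)
    show "finite I" by fact
    show "sets (density (PiM I (\<lambda>_. M)) (\<lambda>x. \<Prod>i\<in>I. f i (x i))) = sets (PiM I (\<lambda>i. density M (f i)))"
      by (simp cong: sets_PiM_cong)
    fix A assume A: "\<And>i. i \<in> I \<Longrightarrow> A i \<in> sets (density M (f i))"
    then have A' [measurable]: "PiE I A \<in> sets (PiM I (\<lambda>_. M))"
      using \<open>finite I\<close> by (intro sets_PiM_I_finite) auto
    have "emeasure (density (PiM I (\<lambda>_. M)) (\<lambda>x. \<Prod>i\<in>I. f i (x i))) (PiE I A) =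
        (\<integral>\<^sup>+x. (\<Prod>i\<in>I. f i (x i)) * indicator (PiE I A) x \<partial>PiM I (\<lambda>_. M))"
      by (rule emeasure_density) measurable
    also have "\<dots> = (\<integral>\<^sup>+x. (\<Prod>i\<in>I. f i (x i) * indicator (A i) (x i)) \<partial>PiM I (\<lambda>_. M))"
    proof (rule nn_integral_cong)
      fix x assume x: "x \<in> space (PiM I (\<lambda>_. M))"
      then have "indicator (PiE I A) x = (\<Prod>i\<in>I. indicator (A i) (x i) :: ennreal)"
        using \<open>finite I\<close> by (auto simp: indicator_def PiE_iff space_PiM prod_zero_iff)
      then show "(\<Prod>i\<in>I. f i (x i)) * indicator (PiE I A) x = (\<Prod>i\<in>I. f i (x i) * indicator (A i) (x i))"
        by (simp add: prod.distrib)
    qed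
    also have "\<dots> = (\<Prod>i\<in>I. \<integral>\<^sup>+x. f i x * indicator (A i) x \<partial>M)"
      using A by (intro M.product_nn_integral_prod \<open>finite I\<close>) auto
    also have "\<dots> = (\<Prod>i\<in>I. emeasure (density M (f i)) (A i))"
      using A by (intro prod.cong refl emeasure_density[symmetric]) auto
    finally show "emeasure (density (PiM I (\<lambda>_. M)) (\<lambda>x. \<Prod>i\<in>I. f i (x i))) (PiE I A) =
        (\<Prod>i\<in>I. emeasure (density M (f i)) (A i))" .
  qed
  then show ?thesis ..
qed

lemma prob_space_density_normalized:
  assumes [measurable]: "f \<in> borel_measurable M" and "0 < integral\<^sup>N M f" "integral\<^sup>N M f < \<top>"
  shows "prob_space (density M (\<lambda>x. f x / integral\<^sup>N M f))"
proof (rule prob_spaceI)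
  have "emeasure (density M (\<lambda>x. f x / integral\<^sup>N M f)) (space M) = (\<integral>\<^sup>+x. f x / integral\<^sup>N M f * indicator (space M) x \<partial>M)"
    by (rule emeasure_density) auto
  also have "\<dots> = (\<integral>\<^sup>+x. f x / integral\<^sup>N M f \<partial>M)"
    by (intro nn_integral_cong) auto
  also have "\<dots> = integral\<^sup>N M f / integral\<^sup>N M f" by (rule nn_integral_divide) simp
  also have "\<dots> = 1" using assms(2,3) by (simp add: ennreal_divide_self)
  finally show "emeasure (density M (\<lambda>x. f x / integral\<^sup>N M f)) (space (density M (\<lambda>x. f x / integral\<^sup>N M f))) = 1"
    by simp
qed

lemma (in marked_process) Sdist_eq_density_Hm:
  "Sdist h u m = density (Hm h) (\<lambda>s. ennreal (exp (- u * s) * s ^ m) / kappa h u m)"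
proof -
  have "ennreal (indicator {0..} s * h s) * (ennreal (exp (- u * s) * s ^ m) / kappa h u m) =
      ennreal (indicator {0..} s * exp (- u * s) * s ^ m * h s) / kappa h u m" for s
    using h_nonneg[of s]
    by (cases "0 \<le> s") (auto simp: ennreal_times_divide ennreal_mult[symmetric] ac_simps)
  then show ?thesis
    unfolding Hm_def Sdist_def by (subst density_density_eq) (auto simp: Hm_def)
qed

text \<open>Finiteness excludes a product of 0 and \<infinity>, on which inversion of extended reals
  is not multiplicative.\<close>

lemma prod_inverse_ennreal:
  fixes c :: "'i \<Rightarrow> ennreal"
  assumes "\<And>j. j \<in> J \<Longrightarrow> c j < \<top>"
  shows "(\<Prod>j\<in>J. inverse (c j)) = inverse (\<Prod>j\<in>J. c j)"
  using assms
proof (induction J rule: infinite_finite_induct)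
  case (insert j J)
  then have "(\<Prod>j\<in>J. c j) < \<top>" by (auto simp: less_top[symmetric] ennreal_prod_eq_top)
  with insert show ?case by (simp add: ennreal_inverse_mult)
qed simp_all

lemma (in marked_process) PiM_Sdist:
  fixes k :: nat
  assumes u: "0 < u" and m: "\<And>j. 0 < m j"
  shows "PiM {..<k} (\<lambda>j. Sdist h u (m j)) =
    density (marks {..<k}) (\<lambda>t. \<Prod>j<k. ennreal (exp (- u * t j) * t j ^ m j) / kappa h u (m j))"
    and "prob_space (Sdist h u (m j))"
proof -
  have [measurable_cong]: "sets (Hm h) = sets borel" by simp
  have p: "prob_space (density (Hm h) (\<lambda>s. ennreal (exp (- u * s) * s ^ m j) / kappa h u (m j)))" for j
    unfolding kappa_def
    by (rule prob_space_density_normalized)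
      (use kappa_pos[OF prob_Hm measurable_h, of u "m j"] kappa_less_top[OF prob_Hm measurable_h u m[of j]]
        in \<open>simp_all add: kappa_def\<close>)
  then show "prob_space (Sdist h u (m j))" unfolding Sdist_eq_density_Hm .
  show "PiM {..<k} (\<lambda>j. Sdist h u (m j)) =
    density (marks {..<k}) (\<lambda>t. \<Prod>j<k. ennreal (exp (- u * t j) * t j ^ m j) / kappa h u (m j))"
    unfolding Sdist_eq_density_Hm
    by (rule PiM_density[where f = "\<lambda>j s. ennreal (exp (- u * s) * s ^ m j) / kappa h u (m j)"])
      (use p prob_Hm in auto)
qed

section \<open>The exponentially tilted reduced Palm law and the posterior kernel\<close>

context palm_model
begin

lemma measurable_marks_reduced_fixed:
  assumes y: "y \<in> space (Xpow n)" and g [measurable]: "g \<in> borel_measurable rm"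
  shows "(\<lambda>F. \<integral>\<^sup>+s. g (wmeasure (F - set (dvals n y)) s) \<partial>marks (F - set (dvals n y))) \<in> borel_measurable (Kd y)"
  by (rule measurable_marks_reduced[where \<phi> = "\<lambda>_. g" and G = "\<lambda>F. F" and gy = "\<lambda>_. y"])
    (use y in \<open>simp_all add: measurable_cong_sets[OF sets_Kd refl]\<close>)

lemma reduced_functional:
  assumes y: "y \<in> space (Xpow n)" shows "integral_functional rm (reduced y)"
  unfolding reduced_def
  by (intro integral_functional_nn_integral measurable_marks_reduced_fixed[OF y]
      integral_functional_nn_integral_comp measurable_wmeasure sets_Hm finite_Diff finite_Kd[of _ y])

lemma reduced_cong: "(\<And>M. M \<in> space rm \<Longrightarrow> f M = g M) \<Longrightarrow> reduced y f = reduced y g"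
  unfolding reduced_def by (intro nn_integral_cong) (simp add: wmeasure_in_space_rm finite_Kd)

lemma reduced_cmult:
  "y \<in> space (Xpow n) \<Longrightarrow> g \<in> borel_measurable rm \<Longrightarrow> reduced y (\<lambda>M. c * g M) = c * reduced y g"
  using reduced_functional[of y] by (simp add: integral_functional_def)

text \<open>The same expectation turned into a measure on \<open>rm\<close>, so that it can be given
  a density.\<close>

definition red_law :: "(nat \<Rightarrow> 'x) \<Rightarrow> 'x measure measure" where
  "red_law y = measure_of (space rm) (sets rm) (\<lambda>E. reduced y (indicator E))"

lemma sets_red_law: "y \<in> space (Xpow n) \<Longrightarrow> sets (red_law y) = sets rm"
  unfolding red_law_def by (rule integral_functional_measure_of[OF reduced_functional])

lemma nn_integral_red_law:
  "y \<in> space (Xpow n) \<Longrightarrow> g \<in> borel_measurable rm \<Longrightarrow> integral\<^sup>N (red_law y) g = reduced y g"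
  unfolding red_law_def by (rule integral_functional_measure_of(3)[OF reduced_functional])

abbreviation damp :: "real \<Rightarrow> 'x measure \<Rightarrow> ennreal" where
  "damp u M \<equiv> negexp (ennreal u * emeasure M UNIV)"

text \<open>Adding the constant \<open>u\<close> to the test function multiplies the integrand by
  e^(-u M(X)). Hence the required quotient of Laplace functionals is that of an exponentially tilted
  law.\<close>

lemma redlap_eq_reduced:
  assumes "g \<in> borel_measurable borel" "\<And>z. 0 \<le> g z" "0 \<le> u"
  shows "redlap h K n y (\<lambda>z. g z + u) = reduced y (\<lambda>M. damp u M * negexp (\<integral>\<^sup>+z. ennreal (g z) \<partial>M))"
proof -
  have "redlap h K n y (\<lambda>z. g z + u) = reduced y (\<lambda>M. negexp (\<integral>\<^sup>+z. ennreal (g z + u) \<partial>M))"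
    by (simp add: redlap_def reduced_def)
  also have "\<dots> = reduced y (\<lambda>M. damp u M * negexp (\<integral>\<^sup>+z. ennreal (g z) \<partial>M))"
  proof (rule reduced_cong)
    fix M :: "'x measure" assume M: "M \<in> space rm"
    then have sM [measurable_cong]: "sets M = sets borel" by (simp add: space_rm)
    have "(\<lambda>z. ennreal (g z)) \<in> borel_measurable M"
      using assms(1) by (simp add: measurable_cong_sets[OF sM refl])
    then have "(\<integral>\<^sup>+z. ennreal (g z + u) \<partial>M) = (\<integral>\<^sup>+z. ennreal (g z) \<partial>M) + ennreal u * emeasure M UNIV"
      using assms by (simp add: nn_integral_add space_rmD[OF M])
    then show "negexp (\<integral>\<^sup>+z. ennreal (g z + u) \<partial>M) = damp u M * negexp (\<integral>\<^sup>+z. ennreal (g z) \<partial>M)"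
      by (simp add: negexp_add mult.commute)
  qed
  finally show ?thesis .
qed

abbreviation \<rho> :: "(nat \<Rightarrow> 'x) \<Rightarrow> real \<Rightarrow> ennreal" where
  "\<rho> y u \<equiv> redlap h K n y (\<lambda>_. u)"

lemma \<rho>_eq: "0 \<le> u \<Longrightarrow> \<rho> y u = reduced y (damp u)"
  using redlap_eq_reduced[of "\<lambda>_. 0" u y] by simp

text \<open>Finitely many points with real marks have finite total mass, so the integrand is
  strictly positive everywhere. The tilting is thus well defined for every \<open>y\<close> and not
  just for almost every one.\<close>

lemma \<rho>_pos:
  assumes y: "y \<in> space (Xpow n)" and u: "0 < u" shows "0 < \<rho> y u"
proof -
  interpret Ky: prob_space "Kd y" by (rule prob_Kd)
  have "0 < reduced y (damp u)"
    unfolding reduced_def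
  proof (rule Ky.nn_integral_pos)
    show "(\<lambda>F. \<integral>\<^sup>+s. damp u (wmeasure (F - set (dvals n y)) s) \<partial>marks (F - set (dvals n y))) \<in> borel_measurable (Kd y)"
      by (rule measurable_marks_reduced_fixed[OF y]) measurable
    fix F assume "F \<in> space (Kd y)"
    then have F: "finite (F - set (dvals n y))" by (simp add: finite_Kd)
    interpret PF: prob_space "marks (F - set (dvals n y))" by (rule prob_marks)
    have [measurable]: "wmeasure (F - set (dvals n y)) \<in> measurable (marks (F - set (dvals n y))) rm"
      by (rule measurable_wmeasure[OF F sets_Hm])
    show "0 < (\<integral>\<^sup>+s. damp u (wmeasure (F - set (dvals n y)) s) \<partial>marks (F - set (dvals n y)))"
    proof (rule PF.nn_integral_pos)
      show "(\<lambda>s. damp u (wmeasure (F - set (dvals n y)) s)) \<in> borel_measurable (marks (F - set (dvals n y)))"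
        by (rule measurable_compose[of _ _ rm "damp u"]) measurable
      fix s :: "'x \<Rightarrow> real"
      have "(\<Sum>x\<in>F - set (dvals n y). ennreal (s x)) < \<top>" using F by (simp add: less_top[symmetric])
      then show "0 < damp u (wmeasure (F - set (dvals n y)) s)"
        by (intro negexp_pos) (simp add: emeasure_wmeasure F ennreal_mult_less_top)
    qed
  qed
  with \<rho>_eq[of u y] u show ?thesis by simp
qed

lemma \<rho>_le_1: "0 < u \<Longrightarrow> \<rho> y u \<le> 1"
proof -
  assume u: "0 < u"
  have "reduced y (damp u) \<le> (\<integral>\<^sup>+F. \<integral>\<^sup>+s. 1 \<partial>marks (F - set (dvals n y)) \<partial>Kd y)"
    unfolding reduced_def by (intro nn_integral_mono negexp_le_1)
  also have "\<dots> = 1"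
    by (simp add: prob_space.emeasure_space_1[OF prob_marks] prob_space.emeasure_space_1[OF prob_Kd])
  finally show ?thesis using u by (simp add: \<rho>_eq)
qed

text \<open>The witness for \<open>good_Q\<close>; by uniqueness of Laplace functionals every other
  choice agrees with it at positive \<open>u\<close>.\<close>

definition Q0 :: "(nat \<Rightarrow> 'x) \<Rightarrow> real \<Rightarrow> 'x measure measure" where
  "Q0 y u = density (red_law y) (\<lambda>M. damp u M / \<rho> y u)"

lemma nn_integral_Q0:
  assumes y: "y \<in> space (Xpow n)" and g [measurable]: "g \<in> borel_measurable rm"
  shows "integral\<^sup>N (Q0 y u) g = reduced y (\<lambda>M. damp u M * g M) / \<rho> y u"
proof -
  have [measurable_cong]: "sets (red_law y) = sets rm" by (rule sets_red_law[OF y])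
  have "integral\<^sup>N (Q0 y u) g = (\<integral>\<^sup>+M. damp u M / \<rho> y u * g M \<partial>red_law y)"
    unfolding Q0_def by (rule nn_integral_density) measurable
  also have "\<dots> = (\<integral>\<^sup>+M. (damp u M * g M) / \<rho> y u \<partial>red_law y)"
    by (simp add: divide_ennreal_def ac_simps)
  also have "\<dots> = (\<integral>\<^sup>+M. damp u M * g M \<partial>red_law y) / \<rho> y u"
    by (rule nn_integral_divide) measurable
  finally show ?thesis by (simp add: nn_integral_red_law[OF y])
qed

lemma good_Q0: "good_Q h K n Q0"
  unfolding good_Q_def
proof (intro ballI allI impI conjI)
  fix y :: "nat \<Rightarrow> 'x" and u :: real assume y: "y \<in> space (Xpow n)" and u: "0 < u"
  have \<rho>: "0 < \<rho> y u" "\<rho> y u < \<top>"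
    using \<rho>_pos[OF y u] \<rho>_le_1[OF u, of y] by (auto simp: less_top[symmetric] top_unique)
  show sets: "sets (Q0 y u) = sets rm" by (simp add: Q0_def sets_red_law y)
  show "prob_space (Q0 y u)"
  proof (rule prob_spaceI)
    have "emeasure (Q0 y u) (space (Q0 y u)) = (\<integral>\<^sup>+M. 1 \<partial>Q0 y u)" by simp
    also have "\<dots> = reduced y (damp u) / \<rho> y u" using nn_integral_Q0[OF y, of "\<lambda>_. 1" u] by simp
    also have "\<dots> = 1" using \<rho> u by (simp add: \<rho>_eq[symmetric] ennreal_divide_self)
    finally show "emeasure (Q0 y u) (space (Q0 y u)) = 1" .
  qed
  fix f :: "'x \<Rightarrow> real" assume f: "admissible f"
  then have fm [measurable]: "f \<in> borel_measurable borel" by (simp add: admissible_def)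
  have "(\<lambda>M. negexp (\<integral>\<^sup>+z. ennreal (f z) \<partial>M)) \<in> borel_measurable rm"
    by (rule measurable_compose[OF measurable_rm_nn_integral measurable_negexp]) simp
  then show "laplace (Q0 y u) f = redlap h K n y (\<lambda>z. f z + u) / redlap h K n y (\<lambda>_. u)"
    using f u unfolding laplace_def
    by (subst nn_integral_Q0[OF y]) (auto simp: redlap_eq_reduced admissible_def)
qed

lemma good_Q_unique:
  assumes "good_Q h K n Q" "y \<in> space (Xpow n)" "0 < u" shows "Q y u = Q0 y u"
  using assms good_Q0 unfolding good_Q_def by (intro laplace_unique) auto

text \<open>The conditional expectation of \<open>f\<close> given the data and \<open>u\<close>,
  before division by \<open>Z (\<lambda>_. 1)\<close>.\<close>

definition Z :: "((nat \<Rightarrow> 'x) \<times> real \<times> 'x measure \<Rightarrow> ennreal) \<Rightarrow> (nat \<Rightarrow> 'x) \<Rightarrow> real \<Rightarrow> ennreal" where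
  "Z f y u = reduced y (tilted n f y u)"

lemma measurable_Z:
  assumes f: "f \<in> borel_measurable (S n)"
  shows "(\<lambda>x. Z f (fst x) (snd x)) \<in> borel_measurable (Xpow n \<Otimes>\<^sub>M lborel)"
  unfolding Z_def reduced_def
proof (rule nn_integral_measurable_subprob_algebra2)
  show "(\<lambda>x. Kd (fst x)) \<in> measurable (Xpow n \<Otimes>\<^sub>M lborel) (subprob_algebra fcnt)"
    by (rule measurable_compose[OF measurable_fst measurable_Kd])
  show "(\<lambda>(x, F). \<integral>\<^sup>+s. tilted n f (fst x) (snd x) (wmeasure (F - set (dvals n (fst x))) s)
      \<partial>marks (F - set (dvals n (fst x)))) \<in> borel_measurable ((Xpow n \<Otimes>\<^sub>M lborel) \<Otimes>\<^sub>M fcnt)"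
    unfolding split_beta'
    by (rule measurable_marks_reduced[where \<phi> = "\<lambda>x. tilted n f (fst (fst x)) (snd (fst x))"])
      (auto simp: split_beta' intro!: measurable_tilted f)
qed

lemma nn_integral_joint_Z:
  "f \<in> borel_measurable (S n) \<Longrightarrow>
    integral\<^sup>N (joint P h n) f = (\<integral>\<^sup>+y. \<integral>\<^sup>+u. power_weight n u * Z f y u \<partial>lborel \<partial>moment P n)"
  unfolding Z_def by (rule nn_integral_joint_palm)

text \<open>A function of the data alone is constant in the marks. What is left splits into
  independent one-mark integrals, the \<open>kappa\<close> factors, and the tilting constant of the
  remaining atoms.\<close>

lemma Z_function_of_data:
  assumes y: "y \<in> space (Xpow n)" and u: "0 \<le> u"
  shows "Z (\<lambda>z. \<phi> (fst z) (fst (snd z))) y u =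
    \<phi> y u * (\<rho> y u * (\<Prod>j<length (dvals n y). kappa h u (cnt n y j)))"
proof -
  let ?k = "length (dvals n y)"
  interpret H: prob_space "Hm h" by (rule prob_Hm)
  interpret product_sigma_finite "\<lambda>_::nat. Hm h" by unfold_locales
  have [measurable_cong]: "sets (marks {..<?k}) = sets (PiM {..<?k} (\<lambda>_. borel))"
    by (intro sets_PiM_cong) auto
  have "(\<integral>\<^sup>+t. (\<Prod>j<?k. ennreal (exp (- u * t j) * t j ^ cnt n y j)) * \<phi> y u \<partial>marks {..<?k}) =
      (\<integral>\<^sup>+t. (\<Prod>j<?k. ennreal (exp (- u * t j) * t j ^ cnt n y j)) \<partial>marks {..<?k}) * \<phi> y u"
    by (rule nn_integral_multc) measurable
  also have "(\<integral>\<^sup>+t. (\<Prod>j<?k. ennreal (exp (- u * t j) * t j ^ cnt n y j)) \<partial>marks {..<?k}) =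
      (\<Prod>j<?k. kappa h u (cnt n y j))"
    unfolding kappa_def by (rule product_nn_integral_prod) (auto simp: measurable_cong_sets[OF sets_Hm refl])
  finally have "tilted n (\<lambda>z. \<phi> (fst z) (fst (snd z))) y u =
      (\<lambda>M. (\<phi> y u * (\<Prod>j<?k. kappa h u (cnt n y j))) * damp u M)"
    by (simp add: tilted_def fun_eq_iff ac_simps)
  then have "Z (\<lambda>z. \<phi> (fst z) (fst (snd z))) y u = (\<phi> y u * (\<Prod>j<?k. kappa h u (cnt n y j))) * reduced y (damp u)"
    unfolding Z_def by (simp only:) (rule reduced_cmult[OF y], measurable)
  then show ?thesis using u by (simp add: \<rho>_eq ac_simps)
qed

lemma Z_1: "y \<in> space (Xpow n) \<Longrightarrow> 0 \<le> u \<Longrightarrow>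
    Z (\<lambda>_. 1) y u = \<rho> y u * (\<Prod>j<length (dvals n y). kappa h u (cnt n y j))"
  using Z_function_of_data[of y u "\<lambda>_ _. 1"] by simp

lemma Z_mult_data:
  "y \<in> space (Xpow n) \<Longrightarrow> 0 \<le> u \<Longrightarrow> Z (\<lambda>z. \<phi> (fst z) (fst (snd z))) y u = \<phi> y u * Z (\<lambda>_. 1) y u"
  by (simp add: Z_function_of_data Z_1)

lemma Z_1_pos_finite:
  assumes "y \<in> space (Xpow n)" "0 < u" shows "0 < Z (\<lambda>_. 1) y u" "Z (\<lambda>_. 1) y u < \<top>"
proof -
  have "\<rho> y u < \<top>" using \<rho>_le_1[OF assms(2), of y] by (auto simp: less_top[symmetric] top_unique)
  moreover have "(\<Prod>j<length (dvals n y). kappa h u (cnt n y j)) < \<top>"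
    using kappa_less_top[OF prob_Hm measurable_h assms(2) cnt_pos, of _ n y]
    by (auto simp: less_top[symmetric] ennreal_prod_eq_top)
  moreover have "(\<Prod>j<length (dvals n y). kappa h u (cnt n y j)) \<noteq> 0"
    using kappa_pos[OF prob_Hm measurable_h] by (auto simp: prod_zero_iff zero_less_iff_neq_zero)
  ultimately show "0 < Z (\<lambda>_. 1) y u" "Z (\<lambda>_. 1) y u < \<top>"
    using \<rho>_pos[OF assms] assms by (auto simp: Z_1 ennreal_zero_less_mult_iff ennreal_mult_less_top zero_less_iff_neq_zero)
qed

text \<open>The densities of the S at the observed values contribute the product of the
  \<open>kappa\<close>, and the tilting contributes \<rho>; their product is exactly the normaliser
  \<open>Z (\<lambda>_. 1)\<close>.\<close>

lemma emeasure_post_law: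
  assumes y: "y \<in> space (Xpow n)" and u: "0 < u" and L: "L \<in> sets rm"
  shows "emeasure (post_law h n y u (Q0 y u)) L = Z (\<lambda>z. indicator L (snd (snd z))) y u / Z (\<lambda>_. 1) y u"
proof -
  let ?k = "length (dvals n y)"
  \<comment> \<open>\<open>PiM_Sdist\<close> asks for positive exponents at every index, while
    \<open>cnt\<close> is meaningful only below \<open>?k\<close>; the padding value 1 never enters
    the product.\<close>
  define m where "m j = (if j < ?k then cnt n y j else 1)" for j
  have m: "0 < m j" for j using cnt_pos[of j n y] by (simp add: m_def)
  define C where "C = (\<Prod>j<?k. kappa h u (cnt n y j))"
  have SP: "PiM {..<?k} (\<lambda>j. Sdist h u (cnt n y j)) = PiM {..<?k} (\<lambda>j. Sdist h u (m j))"
    by (rule PiM_cong) (auto simp: m_def)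
  let ?P = "PiM {..<?k} (\<lambda>j. Sdist h u (m j))"
  let ?\<omega> = "\<lambda>t. \<Prod>j<?k. ennreal (exp (- u * t j) * t j ^ cnt n y j)"
  let ?a = "\<lambda>t M. atoms_plus (dvals n y) t M"
  have sQ [measurable_cong]: "sets (Q0 y u) = sets rm" and pQ: "prob_space (Q0 y u)"
    using good_Q0 y u by (auto simp: good_Q_def)
  have sP [measurable_cong]: "sets ?P = sets (PiM {..<?k} (\<lambda>_. borel))"
    by (intro sets_PiM_cong) (auto simp: Sdist_def)
  have sH [measurable_cong]: "sets (marks {..<?k}) = sets (PiM {..<?k} (\<lambda>_. borel))"
    by (intro sets_PiM_cong) auto
  interpret P: prob_space ?P by (intro prob_space_PiM PiM_Sdist(2)[OF u, of m] m)
  interpret Q: prob_space "Q0 y u" by (rule pQ)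
  interpret PQ: pair_sigma_finite ?P "Q0 y u" ..
  have a0: "(\<lambda>z. ?a (fst z) (snd z)) \<in> measurable (PiM {..<?k} (\<lambda>_. borel) \<Otimes>\<^sub>M rm) rm"
  proof -
    have "(\<lambda>z. atoms_plus (map (\<lambda>j. dvals n y ! j) [0..<?k]) (fst z) (snd z)) \<in> measurable (PiM {..<?k} (\<lambda>_. borel) \<Otimes>\<^sub>M rm) rm"
      by (rule measurable_atoms_plus) auto
    then show ?thesis by (simp add: map_nth)
  qed
  have a: "(\<lambda>(t, M). ?a t M) \<in> measurable (?P \<Otimes>\<^sub>M Q0 y u) rm"
    using a0 unfolding split_beta' by (simp add: measurable_cong_sets[OF sets_pair_measure_cong[OF sP sQ] refl])
  have aL: "(\<lambda>z. indicator L (?a (fst z) (snd z)) :: ennreal) \<in> borel_measurable (PiM {..<?k} (\<lambda>_. borel) \<Otimes>\<^sub>M rm)"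
    using L by (intro measurable_compose[OF a0]) simp
  have aM: "(\<lambda>t. indicator L (?a t M) :: ennreal) \<in> borel_measurable (marks {..<?k})" if "M \<in> space rm" for M
    using measurable_compose[OF measurable_Pair2' aL, OF that]
    by (simp add: measurable_cong_sets[OF sH refl])
  have \<omega>m [measurable]: "?\<omega> \<in> borel_measurable (marks {..<?k})" by measurable
  have prodC: "(\<Prod>j<?k. ennreal (exp (- u * t j) * t j ^ m j) / kappa h u (m j)) = ?\<omega> t / C" for t
  proof -
    have "(\<Prod>j<?k. ennreal (exp (- u * t j) * t j ^ m j) / kappa h u (m j)) =
        ?\<omega> t * (\<Prod>j<?k. inverse (kappa h u (cnt n y j)))"
      by (simp add: m_def divide_ennreal_def prod.distrib)
    also have "(\<Prod>j<?k. inverse (kappa h u (cnt n y j))) = inverse C"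
      unfolding C_def by (rule prod_inverse_ennreal) (simp add: kappa_less_top[OF prob_Hm measurable_h u] cnt_pos)
    finally show ?thesis by (simp add: divide_ennreal_def)
  qed
  have inner: "(\<integral>\<^sup>+t. indicator L (?a t M) \<partial>?P) = (\<integral>\<^sup>+t. ?\<omega> t * indicator L (?a t M) \<partial>marks {..<?k}) / C"
    if "M \<in> space rm" for M
  proof -
    note aM[OF that, measurable]
    have "(\<integral>\<^sup>+t. indicator L (?a t M) \<partial>?P) = (\<integral>\<^sup>+t. ?\<omega> t / C * indicator L (?a t M) \<partial>marks {..<?k})"
      unfolding PiM_Sdist(1)[OF u m] prodC by (rule nn_integral_density) measurable
    also have "\<dots> = (\<integral>\<^sup>+t. (?\<omega> t * indicator L (?a t M)) / C \<partial>marks {..<?k})"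
      by (simp add: divide_ennreal_def ac_simps)
    also have "\<dots> = (\<integral>\<^sup>+t. ?\<omega> t * indicator L (?a t M) \<partial>marks {..<?k}) / C"
      by (rule nn_integral_divide) measurable
    finally show ?thesis .
  qed
  let ?f = "\<lambda>z :: (nat \<Rightarrow> 'x) \<times> real \<times> 'x measure. indicator L (snd (snd z)) :: ennreal"
  have tm: "tilted n ?f y u \<in> borel_measurable rm"
    using L y by (intro measurable_tilted[where gM = "\<lambda>M. M" and gu = "\<lambda>_. u" and gy = "\<lambda>_. y"]) auto
  have "emeasure (post_law h n y u (Q0 y u)) L = integral\<^sup>N (post_law h n y u (Q0 y u)) (indicator L)"
    using L by (simp add: post_law_def)
  also have "\<dots> = (\<integral>\<^sup>+z. indicator L (?a (fst z) (snd z)) \<partial>(?P \<Otimes>\<^sub>M Q0 y u))"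
    unfolding post_law_def SP using a L by (subst nn_integral_distr) (auto simp: split_beta')
  also have "\<dots> = (\<integral>\<^sup>+M. \<integral>\<^sup>+t. indicator L (?a t M) \<partial>?P \<partial>Q0 y u)"
    using aL by (subst PQ.nn_integral_snd[symmetric])
      (auto simp: measurable_cong_sets[OF sets_pair_measure_cong[OF sP sQ] refl])
  also have "\<dots> = (\<integral>\<^sup>+M. (\<integral>\<^sup>+t. ?\<omega> t * indicator L (?a t M) \<partial>marks {..<?k}) / C \<partial>Q0 y u)"
    by (intro nn_integral_cong inner) (simp add: sets_eq_imp_space_eq[OF sQ])
  also have "\<dots> = reduced y (\<lambda>M. damp u M * ((\<integral>\<^sup>+t. ?\<omega> t * indicator L (?a t M) \<partial>marks {..<?k}) / C)) / \<rho> y u"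
  proof (rule nn_integral_Q0[OF y])
    interpret PH: prob_space "marks {..<?k}" by (rule prob_marks)
    have "(\<lambda>M. \<integral>\<^sup>+t. ?\<omega> t * indicator L (?a t M) \<partial>marks {..<?k}) \<in> borel_measurable rm"
    proof (rule PH.borel_measurable_nn_integral)
      have [measurable]: "(\<lambda>z. indicator L (?a (snd z) (fst z)) :: ennreal) \<in> borel_measurable (rm \<Otimes>\<^sub>M marks {..<?k})"
        using measurable_compose[OF measurable_pair_swap' aL]
        by (simp add: split_beta' measurable_cong_sets[OF sets_pair_measure_cong[OF refl sH] refl])
      show "(\<lambda>(M, t). ?\<omega> t * indicator L (?a t M)) \<in> borel_measurable (rm \<Otimes>\<^sub>M marks {..<?k})"
        unfolding split_beta' by measurable
    qed
    then show "(\<lambda>M. (\<integral>\<^sup>+t. ?\<omega> t * indicator L (?a t M) \<partial>marks {..<?k}) / C) \<in> borel_measurable rm"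
      by measurable
  qed
  also have "(\<lambda>M. damp u M * ((\<integral>\<^sup>+t. ?\<omega> t * indicator L (?a t M) \<partial>marks {..<?k}) / C)) =
      (\<lambda>M. inverse C * tilted n ?f y u M)"
    by (simp add: tilted_def divide_ennreal_def fun_eq_iff ac_simps)
  also have "reduced y \<dots> / \<rho> y u = inverse C * Z ?f y u / \<rho> y u"
    unfolding Z_def by (simp add: reduced_cmult[OF y tm])
  also have "\<dots> = Z ?f y u / Z (\<lambda>_. 1) y u"
  proof -
    have "inverse (\<rho> y u * C) = inverse (\<rho> y u) * inverse C"
    proof (rule ennreal_inverse_mult)
      show "\<rho> y u < \<top>" using \<rho>_le_1[OF u, of y] by (auto simp: less_top[symmetric] top_unique)
      show "C < \<top>" unfolding C_def
        using kappa_less_top[OF prob_Hm measurable_h u cnt_pos, of _ n y]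
        by (auto simp: less_top[symmetric] ennreal_prod_eq_top)
    qed
    then show ?thesis using y u by (simp add: Z_1 C_def[symmetric] divide_ennreal_def ac_simps)
  qed
  finally show ?thesis .
qed

end

section \<open>The two conditional distributions\<close>

context palm_model
begin

lemma space_moment: "space (moment P n) = space (Xpow n)"
  by (rule sets_eq_imp_space_eq[OF sets_moment])

lemma space_joint: "space (joint P h n) = space (S n)"
  by (rule sets_eq_imp_space_eq[OF sets_joint])

lemma Z_cong: "(\<And>M. M \<in> space rm \<Longrightarrow> f (y, u, M) = g (y, u, M)) \<Longrightarrow> Z f y u = Z g y u"
  unfolding Z_def
proof (rule reduced_cong)
  fix M :: "'x measure" assume *: "\<And>M. M \<in> space rm \<Longrightarrow> f (y, u, M) = g (y, u, M)" and "M \<in> space rm"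
  then have "atoms_plus (dvals n y) t M \<in> space rm" for t by (simp add: space_rm sets_atoms_plus)
  with * show "tilted n f y u M = tilted n g y u M" by (simp add: tilted_def)
qed

lemma Z_0: "Z (\<lambda>_. 0) y u = 0"
  by (simp add: Z_def tilted_def reduced_def)

text \<open>\<open>good_Q\<close> constrains \<open>Q\<close> only at positive \<open>u\<close>, so
  the replacement of \<open>Q\<close> by \<open>Q0\<close> is an almost-everywhere statement for the
  joint law.\<close>

lemma AE_joint_pos: "AE z in joint P h n. 0 < fst (snd z)"
proof -
  let ?N = "{z \<in> space (S n). \<not> 0 < fst (snd z)}"
  have N: "?N \<in> sets (S n)" by measurable
  have "emeasure (joint P h n) ?N = integral\<^sup>N (joint P h n) (indicator ?N)"
    using N by (simp add: sets_joint)
  also have "\<dots> = (\<integral>\<^sup>+y. \<integral>\<^sup>+u. power_weight n u * Z (indicator ?N) y u \<partial>lborel \<partial>moment P n)"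
    using N by (intro nn_integral_joint_Z) simp
  also have "\<dots> = (\<integral>\<^sup>+y. \<integral>\<^sup>+u. 0 \<partial>(lborel :: real measure) \<partial>moment P n)"
  proof (intro nn_integral_cong)
    fix y :: "nat \<Rightarrow> 'x" and u :: real
    show "power_weight n u * Z (indicator ?N) y u = 0"
    proof (cases "0 < u")
      case True
      then have "Z (indicator ?N) y u = Z (\<lambda>_. 0) y u" by (intro Z_cong) simp
      then show ?thesis by (simp add: Z_0)
    qed (simp add: power_weight_nonpos)
  qed
  finally have "emeasure (joint P h n) ?N = 0" by simp
  then show ?thesis
    using N by (intro AE_I[where N = ?N]) (auto simp: space_joint sets_joint)
qed

lemma measurable_joint_fst: "fst \<in> measurable (joint P h n) (Xpow n)"
  and measurable_joint_data: "(\<lambda>(y, u, \<mu>). (y, u)) \<in> measurable (joint P h n) (Xpow n \<Otimes>\<^sub>M lborel)"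
  unfolding split_beta' by measurable

lemma power_weight_Z_data:
  assumes "y \<in> space (Xpow n)"
  shows "power_weight n u * Z (\<lambda>z. \<phi> (fst z) (fst (snd z))) y u = \<phi> y u * (power_weight n u * Z (\<lambda>_. 1) y u)"
  using assms by (cases "0 < u") (simp_all add: Z_mult_data power_weight_nonpos ac_simps)

lemma power_weight_Z_rectangle:
  assumes L: "L \<in> sets rm"
  shows "power_weight n u * Z (indicator (A \<times> B \<times> L)) y u =
    indicator A y * (indicator B u * (power_weight n u * Z (\<lambda>z. indicator L (snd (snd z))) y u))"
proof (cases "y \<in> A \<and> u \<in> B")
  case True
  then have "Z (indicator (A \<times> B \<times> L)) y u = Z (\<lambda>z. indicator L (snd (snd z))) y u"
    by (intro Z_cong) (simp add: indicator_def)
  then show ?thesis using True by simp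
next
  case False
  then have "Z (indicator (A \<times> B \<times> L)) y u = Z (\<lambda>_. 0) y u"
    by (intro Z_cong) (auto simp: indicator_def)
  then show ?thesis using False by (auto simp: Z_0)
qed

lemma emeasure_joint_rectangle:
  assumes "A \<in> sets (Xpow n)" "B \<in> sets lborel" "L \<in> sets rm"
  shows "emeasure (joint P h n) (A \<times> B \<times> L) = (\<integral>\<^sup>+y. \<integral>\<^sup>+u.
    indicator A y * (indicator B u * (power_weight n u * Z (\<lambda>z. indicator L (snd (snd z))) y u)) \<partial>lborel \<partial>moment P n)"
proof -
  have E: "A \<times> B \<times> L \<in> sets (S n)" using assms by auto
  have "emeasure (joint P h n) (A \<times> B \<times> L) = integral\<^sup>N (joint P h n) (indicator (A \<times> B \<times> L))"
    using E by (simp add: sets_joint)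
  also have "\<dots> = (\<integral>\<^sup>+y. \<integral>\<^sup>+u. power_weight n u * Z (indicator (A \<times> B \<times> L)) y u \<partial>lborel \<partial>moment P n)"
    using E by (intro nn_integral_joint_Z) simp
  finally show ?thesis by (simp only: power_weight_Z_rectangle[OF assms(3)])
qed

text \<open>The posterior probability of \<open>L\<close> is a quotient with denominator
  \<open>Z (\<lambda>_. 1)\<close>. As a function of the data it leaves the joint integral
  multiplied by that same normaliser, which cancels and leaves the integral for the
  rectangle.\<close>

lemma posterior_law:
  assumes Q: "good_Q h K n Q" and A: "A \<in> sets (Xpow n)" and B: "B \<in> sets lborel" and L: "L \<in> sets rm"
  shows "emeasure (joint P h n) (A \<times> B \<times> L) =
    (\<integral>\<^sup>+ yu \<in> A \<times> B. emeasure (post_law h n (fst yu) (snd yu) (Q (fst yu) (snd yu))) L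
       \<partial>distr (joint P h n) (Xpow n \<Otimes>\<^sub>M lborel) (\<lambda>(y, u, \<mu>). (y, u)))"
proof -
  let ?D = "distr (joint P h n) (Xpow n \<Otimes>\<^sub>M lborel) (\<lambda>(y, u, \<mu>). (y, u))"
  let ?ZL = "Z (\<lambda>z. indicator L (snd (snd z)))" and ?Z1 = "Z (\<lambda>_. 1)"
  \<comment> \<open>A jointly measurable version of the integrand: \<open>good_Q\<close> treats each
    \<open>y\<close> and \<open>u\<close> separately, so measurability in the data has to come from
    \<open>Z\<close>.\<close>
  define \<psi> where "\<psi> y u = ?ZL y u / ?Z1 y u * indicator (A \<times> B) (y, u)" for y u
  have Lf: "(\<lambda>z. indicator L (snd (snd z)) :: ennreal) \<in> borel_measurable (S n)" using L by measurable
  note [measurable] = measurable_Z[OF Lf] measurable_Z[of "\<lambda>_. 1", simplified]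
  have AB [measurable]: "A \<times> B \<in> sets (Xpow n \<Otimes>\<^sub>M lborel)" using A B by (rule pair_measureI)
  have \<psi>: "(\<lambda>x. \<psi> (fst x) (snd x)) \<in> borel_measurable (Xpow n \<Otimes>\<^sub>M lborel)"
    unfolding \<psi>_def by measurable
  have AE: "AE yu in ?D. 0 < snd yu"
    using AE_joint_pos by (subst AE_distr_iff[OF measurable_joint_data]) (measurable, simp add: split_beta')
  have "(\<integral>\<^sup>+ yu \<in> A \<times> B. emeasure (post_law h n (fst yu) (snd yu) (Q (fst yu) (snd yu))) L \<partial>?D) =
      (\<integral>\<^sup>+yu. \<psi> (fst yu) (snd yu) \<partial>?D)"
  proof (rule nn_integral_cong_AE)
    from AE AE_space[of ?D]
    show "AE yu in ?D. emeasure (post_law h n (fst yu) (snd yu) (Q (fst yu) (snd yu))) L * indicator (A \<times> B) yu =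
        \<psi> (fst yu) (snd yu)"
    proof eventually_elim
      case (elim yu)
      then have "fst yu \<in> space (Xpow n)" by (auto simp: space_pair_measure)
      with elim(1) L Q show ?case by (simp add: good_Q_unique emeasure_post_law \<psi>_def)
    qed
  qed
  also have "\<dots> = (\<integral>\<^sup>+z. \<psi> (fst z) (fst (snd z)) \<partial>joint P h n)"
    using \<psi> by (subst nn_integral_distr[OF measurable_joint_data]) (auto simp: split_beta')
  also have "\<dots> = (\<integral>\<^sup>+y. \<integral>\<^sup>+u. power_weight n u * Z (\<lambda>z. \<psi> (fst z) (fst (snd z))) y u \<partial>lborel \<partial>moment P n)"
    by (rule nn_integral_joint_Z)
      (rule measurable_compose[OF _ \<psi>, of "\<lambda>z. (fst z, fst (snd z))", simplified], measurable)
  also have "\<dots> = (\<integral>\<^sup>+y. \<integral>\<^sup>+u. indicator A y * (indicator B u * (power_weight n u * ?ZL y u)) \<partial>lborel \<partial>moment P n)"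
  proof (intro nn_integral_cong)
    fix y and u :: real assume "y \<in> space (moment P n)"
    then have y: "y \<in> space (Xpow n)" by (simp add: space_moment)
    show "power_weight n u * Z (\<lambda>z. \<psi> (fst z) (fst (snd z))) y u =
        indicator A y * (indicator B u * (power_weight n u * ?ZL y u))"
    proof (cases "0 < u")
      case True
      have "?ZL y u / ?Z1 y u * ?Z1 y u = ?ZL y u"
        using Z_1_pos_finite[OF y True] by (simp add: ennreal_divide_times)
      moreover have "power_weight n u * Z (\<lambda>z. \<psi> (fst z) (fst (snd z))) y u =
          indicator A y * (indicator B u * (power_weight n u * (?ZL y u / ?Z1 y u * ?Z1 y u)))"
        unfolding power_weight_Z_data[OF y] by (simp only: \<psi>_def indicator_times fst_conv snd_conv ac_simps)
      ultimately show ?thesis by (simp only:)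
    qed (simp add: power_weight_nonpos)
  qed
  also have "\<dots> = emeasure (joint P h n) (A \<times> B \<times> L)"
    by (rule emeasure_joint_rectangle[OF A B L, symmetric])
  finally show ?thesis ..
qed

lemma gU_eq:
  assumes "y \<in> space (Xpow n)"
  shows "power_weight n u * Z (\<lambda>_. 1) y u = gU h K n y u / ennreal (Gamma (real n))"
proof (cases "0 < u")
  case True
  have "0 < Gamma (real n)" using n by (intro Gamma_real_pos) simp
  then have "power_weight n u = ennreal (indicator {0<..} u * u ^ (n - 1)) / ennreal (Gamma (real n))"
    using True by (simp add: power_weight_def divide_ennreal)
  then show ?thesis using True assms by (simp add: gU_def Z_1 divide_ennreal_def ac_simps)
qed (simp add: power_weight_nonpos gU_def)

text \<open>Weighting the quotient \<open>GB / G\<close> by the density \<open>G\<close> of the data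
  gives back \<open>GB\<close>. The constant Gamma(n) of the joint law cancels when
  \<open>gU\<close> is divided by its own integral.\<close>

lemma density_of_U:
  assumes A: "A \<in> sets (Xpow n)" and B: "B \<in> sets lborel"
  shows "emeasure (joint P h n) (A \<times> B \<times> space rm) =
    (\<integral>\<^sup>+ y \<in> A. (\<integral>\<^sup>+ u \<in> B. gU h K n y u / (\<integral>\<^sup>+ v. gU h K n y v \<partial>lborel) \<partial>lborel)
       \<partial>distr (joint P h n) (Xpow n) fst)"
proof -
  let ?c = "ennreal (Gamma (real n))" and ?g = "gU h K n"
  define w where "w y u = power_weight n u * Z (\<lambda>_. 1) y u" for y u
  \<comment> \<open>\<open>G\<close> is the density of the law of the data with respect to the
    moment measure; \<open>GB\<close> is its analogue with the auxiliary variable restricted to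
    \<open>B\<close>.\<close>
  define G where "G y = (\<integral>\<^sup>+u. w y u \<partial>lborel)" for y
  define GB where "GB y = (\<integral>\<^sup>+u. w y u * indicator B u \<partial>lborel)" for y
  have c0: "0 < ?c" "?c < \<top>" using n Gamma_real_pos[of "real n"] by auto
  have [measurable]: "A \<in> sets (Xpow n)" "B \<in> sets lborel" by fact+
  have wm [measurable]: "(\<lambda>x. w (fst x) (snd x)) \<in> borel_measurable (Xpow n \<Otimes>\<^sub>M lborel)"
    unfolding w_def using measurable_Z[of "\<lambda>_. 1"] by measurable
  have wy: "w y \<in> borel_measurable lborel" if "y \<in> space (Xpow n)" for y
    using measurable_Pair2[OF wm that] by simp
  have wyB: "(\<lambda>u. w y u * indicator B u) \<in> borel_measurable lborel" if "y \<in> space (Xpow n)" for y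
    by (rule borel_measurable_times_ennreal[OF wy[OF that] borel_measurable_indicator[OF B]])
  have Gm [measurable]: "G \<in> borel_measurable (Xpow n)" unfolding G_def
    by (rule lborel.borel_measurable_nn_integral) (simp add: split_beta')
  have GBm [measurable]: "GB \<in> borel_measurable (Xpow n)" unfolding GB_def
    by (rule lborel.borel_measurable_nn_integral) (unfold split_beta', measurable)
  have gw: "?g y u = ?c * w y u" if "y \<in> space (Xpow n)" for y u
  proof -
    have "?c * w y u = ?g y u * ?c / ?c"
      unfolding w_def gU_eq[OF that] by (simp only: ennreal_times_divide mult.commute)
    also have "\<dots> = ?g y u" using c0 by (intro mult_divide_eq_ennreal) auto
    finally show ?thesis ..
  qed
  have \<psi>: "(\<integral>\<^sup>+ u \<in> B. ?g y u / (\<integral>\<^sup>+ v. ?g y v \<partial>lborel) \<partial>lborel) = GB y / G y" if y: "y \<in> space (Xpow n)" for y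
  proof -
    have eq: "(\<integral>\<^sup>+ v. ?g y v \<partial>lborel) = ?c * G y"
      unfolding G_def gw[OF y] by (rule nn_integral_cmult[OF wy[OF y]])
    have "(\<integral>\<^sup>+ u \<in> B. ?g y u / (\<integral>\<^sup>+ v. ?g y v \<partial>lborel) \<partial>lborel) = (\<integral>\<^sup>+u. (w y u * indicator B u) / G y \<partial>lborel)"
    proof (intro nn_integral_cong)
      fix u :: real
      have "inverse (?c * G y) = inverse ?c * inverse (G y)" using c0 by (intro ennreal_inverse_mult') auto
      moreover have "?c * inverse ?c = 1" using c0 by (simp add: divide_ennreal_def[symmetric])
      moreover have "?c * w y u * (inverse ?c * inverse (G y)) * indicator B u =
          (?c * inverse ?c) * (w y u * indicator B u * inverse (G y))" by (simp only: ac_simps)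
      ultimately show "?g y u / (\<integral>\<^sup>+ v. ?g y v \<partial>lborel) * indicator B u = (w y u * indicator B u) / G y"
        unfolding eq by (simp only: gw[OF y] divide_ennreal_def mult_1)
    qed
    also have "\<dots> = GB y / G y"
      unfolding GB_def by (rule nn_integral_divide[OF wyB[OF y]])
    finally show ?thesis .
  qed
  have total: "(\<integral>\<^sup>+y. G y \<partial>moment P n) \<le> 1"
  proof -
    have "(\<integral>\<^sup>+y. G y \<partial>moment P n) = (\<integral>\<^sup>+z. 1 \<partial>joint P h n)"
      unfolding G_def w_def by (rule nn_integral_joint_Z[symmetric]) simp
    then show ?thesis using joint_mass_le_1[OF n] by simp
  qed
  \<comment> \<open>Where \<open>G\<close> is infinite the quotient \<open>GB / G\<close> is \<open>0\<close> and the density formula fails.\<close>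
  have AEfin: "AE y in moment P n. G y \<noteq> \<infinity>"
    by (rule nn_integral_PInf_AE) (use total in \<open>auto simp: top_unique\<close>)
  have "(\<integral>\<^sup>+ y \<in> A. (\<integral>\<^sup>+ u \<in> B. ?g y u / (\<integral>\<^sup>+ v. ?g y v \<partial>lborel) \<partial>lborel) \<partial>distr (joint P h n) (Xpow n) fst) =
      (\<integral>\<^sup>+ y. GB y / G y * indicator A y \<partial>distr (joint P h n) (Xpow n) fst)"
    by (intro nn_integral_cong) (simp add: \<psi>)
  also have "\<dots> = (\<integral>\<^sup>+ z. GB (fst z) / G (fst z) * indicator A (fst z) \<partial>joint P h n)"
    by (rule nn_integral_distr[OF measurable_joint_fst]) simp
  also have "\<dots> = (\<integral>\<^sup>+y. \<integral>\<^sup>+u. power_weight n u * Z (\<lambda>z. GB (fst z) / G (fst z) * indicator A (fst z)) y u \<partial>lborel \<partial>moment P n)"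
    by (rule nn_integral_joint_Z) measurable
  also have "\<dots> = (\<integral>\<^sup>+y. GB y / G y * indicator A y * G y \<partial>moment P n)"
  proof (rule nn_integral_cong)
    fix y assume "y \<in> space (moment P n)"
    then have y: "y \<in> space (Xpow n)" by (simp add: space_moment)
    have "(\<integral>\<^sup>+u. power_weight n u * Z (\<lambda>z. GB (fst z) / G (fst z) * indicator A (fst z)) y u \<partial>lborel) =
        (\<integral>\<^sup>+u. (GB y / G y * indicator A y) * w y u \<partial>lborel)"
      unfolding w_def
      by (intro nn_integral_cong power_weight_Z_data[OF y, of _ "\<lambda>y u. GB y / G y * indicator A y"])
    also have "\<dots> = GB y / G y * indicator A y * G y"
      unfolding G_def by (rule nn_integral_cmult[OF wy[OF y]])
    finally show "(\<integral>\<^sup>+u. power_weight n u * Z (\<lambda>z. GB (fst z) / G (fst z) * indicator A (fst z)) y u \<partial>lborel) =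
      GB y / G y * indicator A y * G y" .
  qed
  also have "\<dots> = (\<integral>\<^sup>+y. indicator A y * GB y \<partial>moment P n)"
  proof (rule nn_integral_cong_AE)
    show "AE y in moment P n. GB y / G y * indicator A y * G y = indicator A y * GB y"
      using AEfin
    proof eventually_elim
      case (elim y)
      have le: "GB y \<le> G y" unfolding GB_def G_def by (intro nn_integral_mono) (auto simp: indicator_def)
      show ?case
      \<comment> \<open>Where \<open>G\<close> vanishes, so does the smaller \<open>GB\<close>, and
        both sides are 0.\<close>
      proof (cases "G y = 0")
        case False
        then have "GB y / G y * G y = GB y"
          using elim by (simp add: ennreal_divide_times less_top zero_less_iff_neq_zero)
        then show ?thesis by (simp add: indicator_def)
      qed (use le in simp)
    qed
  qed
  also have "\<dots> = (\<integral>\<^sup>+y. \<integral>\<^sup>+u. indicator A y * (indicator B u *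
      (power_weight n u * Z (\<lambda>z. indicator (space rm) (snd (snd z))) y u)) \<partial>lborel \<partial>moment P n)"
  proof (rule nn_integral_cong)
    fix y assume "y \<in> space (moment P n)"
    then have y: "y \<in> space (Xpow n)" by (simp add: space_moment)
    have "Z (\<lambda>z. indicator (space rm) (snd (snd z))) y u = Z (\<lambda>_. 1) y u" for u
      by (rule Z_cong) simp
    then have "(\<integral>\<^sup>+u. indicator A y * (indicator B u * (power_weight n u * Z (\<lambda>z. indicator (space rm) (snd (snd z))) y u)) \<partial>lborel)
        = (\<integral>\<^sup>+u. indicator A y * (w y u * indicator B u) \<partial>lborel)"
      by (simp add: w_def mult.commute)
    also have "\<dots> = indicator A y * GB y"
      unfolding GB_def by (rule nn_integral_cmult[OF wyB[OF y]])
    finally show "indicator A y * GB y = (\<integral>\<^sup>+u. indicator A y * (indicator B u *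
      (power_weight n u * Z (\<lambda>z. indicator (space rm) (snd (snd z))) y u)) \<partial>lborel)" ..
  qed
  also have "\<dots> = emeasure (joint P h n) (A \<times> B \<times> space rm)"
    by (rule emeasure_joint_rectangle[OF A B sets.top, symmetric])
  finally show ?thesis ..
qed

end

theorem theorem1:
  fixes P\<Phi> :: "'x::polish_space set measure"
    and h :: "real \<Rightarrow> real"
    and n :: nat
    and P :: "nat \<Rightarrow> (nat \<Rightarrow> 'x) \<Rightarrow> 'x set measure"
  assumes "prob_space P\<Phi>" and "sets P\<Phi> = sets fcnt"
    and "h \<in> borel_measurable borel" and "\<And>s. 0 \<le> h s"
    and "prob_space (Hm h)"
    and "n \<ge> 1"
    and "\<And>k. is_palm P\<Phi> k (P k)"
  shows "(\<exists>Q. good_Q h P n Q) \<and>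
    (\<forall>Q. good_Q h P n Q \<longrightarrow>
       (\<forall>A \<in> sets (Xpow n). \<forall>B \<in> sets lborel. \<forall>L \<in> sets rm.
          emeasure (joint P\<Phi> h n) (A \<times> B \<times> L) =
          (\<integral>\<^sup>+ yu \<in> A \<times> B. emeasure (post_law h n (fst yu) (snd yu) (Q (fst yu) (snd yu))) L
             \<partial>distr (joint P\<Phi> h n) (Xpow n \<Otimes>\<^sub>M lborel) (\<lambda>(y, u, \<mu>). (y, u))))) \<and>
    (\<forall>A \<in> sets (Xpow n). \<forall>B \<in> sets lborel.
       emeasure (joint P\<Phi> h n) (A \<times> B \<times> space rm) =
       (\<integral>\<^sup>+ y \<in> A. (\<integral>\<^sup>+ u \<in> B. gU h P n y u / (\<integral>\<^sup>+ v. gU h P n y v \<partial>lborel) \<partial>lborel)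
          \<partial>distr (joint P\<Phi> h n) (Xpow n) fst))"
proof -
  interpret palm_model P\<Phi> h P n
    using assms
    by (intro palm_model.intro marked_process.intro finite_point_process.intro
        finite_point_process_axioms.intro marked_process_axioms.intro palm_model_axioms.intro)
  have "\<exists>Q. good_Q h P n Q" by (rule exI[of _ Q0]) (rule good_Q0)
  then show ?thesis by (intro conjI allI impI ballI) (assumption, rule posterior_law, assumption+, rule density_of_U, assumption+)
qed

end
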